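(* Let $X$, $Y$, $G$, $J:X\to\mathbb{R}$, $\mathcal{M}$, $\psi$, $\mathcal{S}$, $\mathcal{P}$, $\mathcal{U}$, $m_{\mathcal{P}}$, $m_{\mathcal{U}}$ be as described in the context. Suppose that $J:X\to\mathbb{R}$ is of class $\mathcal{C}^1$ and that assumptions (A1)–(A3) (stated in the context) hold. (a) If $(M)_\beta\,(i)$ holds for $\beta=\inf_{\mathcal{M}}J$, then $J$ has a critical point $u\in\mathcal{M}$ such that $J(u)=\inf_{\mathcal{M}}J$. (b) Assume that $(M)_\beta\,(i)$ and $(M)_\beta\,(ii)$ hold for every $\beta\geq\inf_{\mathcal{M}}J$ and that (S) is satisfied. Then $J$ has infinitely many $G$-distinct critical points in $\mathcal{M}$, i.e. there is a sequence of critical points $(u_n)\subset\mathcal{M}$ of $J$ such that $(G\ast u_n)\cap(G\ast u_m)=\emptyset$ for $n\neq m$. (c) Assume that $G=\{\mathrm{id}\}$, (S) is satisfied and for every $(PS)_\beta$-sequence $(u_n)\subset\mathcal{U}$ of $J\circ m_{\mathcal{U}}$ with $\beta\geq\inf_{\mathcal{M}}J$ there is $u\in\mathcal{U}$ such that $J'(m_{\mathcal{U}}(u))=0$ and $u_n\to u$ along a subsequence. Then $J$ has infinitely many critical points in $\mathcal{M}$.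
   Context: Setting. $G$ is a group acting isometrically on a reflexive Banach space $X$ with norm $\|\cdot\|$, and $J:X\to\mathbb{R}$ is a $\mathcal{C}^1$-functional. $\mathcal{M}\subset X\setminus\{0\}$ is a closed nonempty subset of $X$. $Y\subset X$ is a closed $G$-invariant subspace, $\psi\in\mathcal{C}^{1,1}(Y,\mathbb{R})$ is $G$-invariant, and $\mathcal{S}=\{u\in Y:\psi(u)=1\}$, where $\psi'(u)\neq0$ for $u\in\mathcal{S}$; thus $\mathcal{S}$ is a $G$-invariant manifold of class $\mathcal{C}^{1,1}$ and codimension $1$ in $Y$ with tangent space $T_u\mathcal{S}=\{v\in Y:\psi'(u)(v)=0\}$. Assumptions: (A1) $J$ is $G$-invariant, i.e. $J(gu)=J(u)$ for $u\in X$, $g\in G$. If $gu=-u$ (for some $g\in G$), then $u=0$. Moreover, if $g_n\in G$, $u\in X$ and $g_nu\rightharpoonup v$ (weakly), then $v=gu$ for some $g\in G$ or $v=0$. (A2) $\mathcal{M}$ is $G$-invariant and $\inf_{\mathcal{M}}J>0=J(0)$. (A3) There are a $G$-invariant open neighbourhood $\mathcal{P}\subset X\setminus\{0\}$ of $\mathcal{M}$ and a $G$-equivariant map $m_{\mathcal{P}}:\mathcal{P}\to\mathcal{M}$ such that $m_{\mathcal{P}}(u)=u$ for $u\in\mathcal{M}$ and the restriction $m_{\mathcal{U}}:=m_{\mathcal{P}}|_{\mathcal{U}}:\mathcal{U}\to\mathcal{M}$, where $\mathcal{U}:=\mathcal{S}\cap\mathcal{P}$, is a homeomorphism. Moreover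 $J\circ m_{\mathcal{U}}:\mathcal{U}\to\mathbb{R}$ is of class $\mathcal{C}^1$, and $(J\circ m_{\mathcal{U}})(u_n)\to\infty$ whenever $u_n\in\mathcal{U}$, $u_n\to u\in\partial\mathcal{U}$, where the boundary of $\mathcal{U}$ is taken in $\mathcal{S}$. A $(PS)_\beta$-sequence of $J\circ m_{\mathcal{U}}$ is a sequence $(u_n)\subset\mathcal{U}$ with $(J\circ m_{\mathcal{U}})(u_n)\to\beta$ and $(J\circ m_{\mathcal{U}})'(u_n)\to0$ (the derivative being taken on the manifold $\mathcal{U}$, i.e. as a functional on $T_{u_n}\mathcal{S}$). Let $\mathcal{K}=\{u\in\mathcal{U}:(J\circ m_{\mathcal{U}})'(u)(v)=0\text{ for any }v\in T_u\mathcal{S}\}$. For $u\in X$ let $G\ast u=\{gu:g\in G\}$; it is called a critical orbit if $u\in\mathcal{K}$. For $\beta\in\mathbb{R}$: $(M)_\beta\,(i)$: for every $(PS)_\beta$-sequence $(u_n)\subset\mathcal{U}$ of $J\circ m_{\mathcal{U}}$ there are a sequence $(g_n)\subset G$ and $u\in\mathcal{P}$ such that $g_nm_{\mathcal{U}}(u_n)\rightharpoonup u$ along a subsequence, $J'(m_{\mathcal{P}}(u))=0$ and $J(m_{\mathcal{P}}(u))\leq\beta$. $(M)_\beta\,(ii)$: if the number of distinct critical orbits is finite, then there is $m_\beta>0$ such that for every $(u_n)\subset\mathcal{U}$ such that $(J\circ m_{\mathcal{U}})'(u_n)\to0$ as $n\to\infty$, $(J\circ m_{\mathcal{U}})(u_n)\leq\beta$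 and $\|u_n-u_{n+1}\|<m_\beta$ for $n\geq1$, there holds $\liminf_{n\to\infty}\|u_n-u_{n+1}\|=0$. (S): $J$ is even, $m_{\mathcal{P}}$ is odd, $\mathcal{U}=-\mathcal{U}$, $\mathcal{M}=-\mathcal{M}$, and for any $k\geq1$ there exists a continuous and odd map $\tau:S^{k-1}\to\mathcal{P}$, where $S^{k-1}$ is the unit sphere in $\mathbb{R}^k$.
   Formalization: In (A3) the G-equivariant map m_P: P→M is taken to be continuous; if it were an arbitrary function, discontinuous away from U, parts (b) and (c) would be false. *)

theory Defs
  imports "HOL-Analysis.Analysis" "HOL-Algebra.Group_Action"
begin

definition reflexive_space :: "'a::real_normed_vector itself \<Rightarrow> bool" where
  "reflexive_space _ \<longleftrightarrow>
     (\<forall>F :: ('a \<Rightarrow>\<^sub>L real) \<Rightarrow>\<^sub>L real. \<exists>x::'a. \<forall>f. blinfun_apply F f = blinfun_apply f x)"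

definition weakly_tendsto :: "(nat \<Rightarrow> 'a::real_normed_vector) \<Rightarrow> 'a \<Rightarrow> bool" where
  "weakly_tendsto x l \<longleftrightarrow>
     (\<forall>f :: 'a \<Rightarrow>\<^sub>L real. (\<lambda>n. blinfun_apply f (x n)) \<longlonglongrightarrow> blinfun_apply f l)"

definition C1_functional :: "('a::real_normed_vector \<Rightarrow> real) \<Rightarrow> bool" where
  "C1_functional J \<longleftrightarrow>
     (\<exists>J' :: 'a \<Rightarrow> 'a \<Rightarrow>\<^sub>L real.
        (\<forall>u. (J has_derivative blinfun_apply (J' u)) (at u)) \<and> continuous_on UNIV J')"

definition critical_point :: "('a::real_normed_vector \<Rightarrow> real) \<Rightarrow> 'a \<Rightarrow> bool" where
  "critical_point J u \<longleftrightarrow> (J has_derivative (\<lambda>_. 0)) (at u)"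

text \<open>
  For a subspace \<open>Y\<close> and \<open>u \<in> Y\<close>, a derivative of \<open>\<psi>\<close> within \<open>Y\<close> is a bounded functional on the
  whole space, of which only the restriction to \<open>Y\<close> is determined. All uses below
  evaluate it on \<open>Y\<close> only; that restriction is the derivative of \<open>\<psi> : Y \<rightarrow> \<real>\<close> at \<open>u\<close>.
\<close>

abbreviation deriv_within :: "'a::real_normed_vector set \<Rightarrow> ('a \<Rightarrow> real) \<Rightarrow> 'a \<Rightarrow> 'a \<Rightarrow> real" where
  "deriv_within A f u \<equiv> frechet_derivative f (at u within A)"

text \<open>
  Class \<open>C\<^sup>1\<^sup>,\<^sup>1\<close>: the derivative is locally Lipschitz for the norm of the dual of \<open>Y\<close>.
\<close>

definition C11_on_subspace :: "'a::real_normed_vector set \<Rightarrow> ('a \<Rightarrow> real) \<Rightarrow> bool" where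
  "C11_on_subspace Y \<psi> \<longleftrightarrow>
     (\<forall>u\<in>Y. \<psi> differentiable (at u within Y)) \<and>
     (\<forall>u\<in>Y. \<exists>r>0. \<exists>L. \<forall>v\<in>Y \<inter> ball u r. \<forall>w\<in>Y \<inter> ball u r. \<forall>h\<in>Y.
        \<bar>deriv_within Y \<psi> v h - deriv_within Y \<psi> w h\<bar> \<le> L * norm (v - w) * norm h)"

definition unit_level :: "'a set \<Rightarrow> ('a \<Rightarrow> real) \<Rightarrow> 'a set" where
  "unit_level Y \<psi> = {u\<in>Y. \<psi> u = 1}"

definition tangent_space :: "'a::real_normed_vector set \<Rightarrow> ('a \<Rightarrow> real) \<Rightarrow> 'a \<Rightarrow> 'a set" where
  "tangent_space Y \<psi> u = {v\<in>Y. deriv_within Y \<psi> u v = 0}"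

text \<open>
  Functions \<open>\<Phi>\<close> on a relatively open part \<open>U\<close> of the hypersurface \<open>S = unit_level Y \<psi>\<close>.
  Differentiability on the manifold is Frechet differentiability within \<open>U\<close>, and the derivative
  at \<open>u\<close> is the restriction of \<open>deriv_within U \<Phi> u\<close> to the tangent space at \<open>u\<close> (which, unlike the
  functional on the whole space, is uniquely determined, as \<open>\<psi>\<close> has nonzero derivative at \<open>u\<close>).
  The second clause of \<open>C1_on_hypersurface\<close> is continuity of the derivative on the tangent
  bundle, uniformly on the unit balls of the tangent spaces. In the local trivialisations
  \<open>v \<mapsto> v - (\<psi>'(w) v / \<psi>'(w) e) e\<close> of the tangent bundle, with \<open>e \<in> Y\<close> transversal to \<open>S\<close>,
  this is continuity of the derivative in the dual norm.
\<close>

definition C1_on_hypersurface ::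
    "'a::real_normed_vector set \<Rightarrow> ('a \<Rightarrow> real) \<Rightarrow> 'a set \<Rightarrow> ('a \<Rightarrow> real) \<Rightarrow> bool" where
  "C1_on_hypersurface Y \<psi> U \<Phi> \<longleftrightarrow>
     (\<forall>u\<in>U. \<Phi> differentiable (at u within U)) \<and>
     (\<forall>u\<in>U. \<forall>e>0. \<exists>d>0. \<forall>w\<in>U.
        \<forall>v \<in> tangent_space Y \<psi> u \<inter> cball 0 1. \<forall>v' \<in> tangent_space Y \<psi> w \<inter> cball 0 1.
          dist w u < d \<and> dist v' v < d \<longrightarrow> \<bar>deriv_within U \<Phi> w v' - deriv_within U \<Phi> u v\<bar> < e)"

text \<open>The norm of \<open>\<Phi>'(u)\<close> as a functional on the tangent space at \<open>u\<close>.\<close>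

definition tangential_deriv_norm ::
    "'a::real_normed_vector set \<Rightarrow> ('a \<Rightarrow> real) \<Rightarrow> 'a set \<Rightarrow> ('a \<Rightarrow> real) \<Rightarrow> 'a \<Rightarrow> real" where
  "tangential_deriv_norm Y \<psi> U \<Phi> u =
     (SUP v \<in> tangent_space Y \<psi> u \<inter> cball 0 1. \<bar>deriv_within U \<Phi> u v\<bar>)"

definition critical_set ::
    "'a::real_normed_vector set \<Rightarrow> ('a \<Rightarrow> real) \<Rightarrow> 'a set \<Rightarrow> ('a \<Rightarrow> real) \<Rightarrow> 'a set" where
  "critical_set Y \<psi> U \<Phi> = {u\<in>U. \<forall>v \<in> tangent_space Y \<psi> u. deriv_within U \<Phi> u v = 0}"

definition PS_seq ::
    "'a::real_normed_vector set \<Rightarrow> ('a \<Rightarrow> real) \<Rightarrow> 'a set \<Rightarrow> ('a \<Rightarrow> real) \<Rightarrow> real \<Rightarrow> (nat \<Rightarrow> 'a) \<Rightarrow> bool"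
  where
  "PS_seq Y \<psi> U \<Phi> \<beta> u \<longleftrightarrow>
     (\<forall>n. u n \<in> U) \<and> (\<lambda>n. \<Phi> (u n)) \<longlonglongrightarrow> \<beta> \<and>
     (\<lambda>n. tangential_deriv_norm Y \<psi> U \<Phi> (u n)) \<longlonglongrightarrow> 0"

text \<open>
  A group \<open>G\<close> acts through \<open>act\<close>; invariance under every element of the group gives equality
  of \<open>act g ` A\<close> and \<open>A\<close>. The action is by isometries of the metric space; linearity is not required.
\<close>

definition isometric_action ::
    "('g, 'm) monoid_scheme \<Rightarrow> ('g \<Rightarrow> 'a::real_normed_vector \<Rightarrow> 'a) \<Rightarrow> bool" where
  "isometric_action G act \<longleftrightarrow>
     group_action G UNIV act \<and> (\<forall>g\<in>carrier G. \<forall>u v. dist (act g u) (act g v) = dist u v)"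

definition invariant_set :: "('g, 'm) monoid_scheme \<Rightarrow> ('g \<Rightarrow> 'a \<Rightarrow> 'a) \<Rightarrow> 'a set \<Rightarrow> bool" where
  "invariant_set G act A \<longleftrightarrow> (\<forall>g\<in>carrier G. act g ` A \<subseteq> A)"

definition invariant_fun_on ::
    "('g, 'm) monoid_scheme \<Rightarrow> ('g \<Rightarrow> 'a \<Rightarrow> 'a) \<Rightarrow> 'a set \<Rightarrow> ('a \<Rightarrow> real) \<Rightarrow> bool" where
  "invariant_fun_on G act A f \<longleftrightarrow> (\<forall>g\<in>carrier G. \<forall>u\<in>A. f (act g u) = f u)"

definition condition_A1 ::
    "('g, 'm) monoid_scheme \<Rightarrow> ('g \<Rightarrow> 'a::real_normed_vector \<Rightarrow> 'a) \<Rightarrow> ('a \<Rightarrow> real) \<Rightarrow> bool" where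
  "condition_A1 G act J \<longleftrightarrow>
     invariant_fun_on G act UNIV J \<and>
     (\<forall>g\<in>carrier G. \<forall>u. act g u = - u \<longrightarrow> u = 0) \<and>
     (\<forall>g u v. (\<forall>n. g n \<in> carrier G) \<and> weakly_tendsto (\<lambda>n. act (g n) u) v \<longrightarrow>
        (\<exists>h\<in>carrier G. v = act h u) \<or> v = 0)"

text \<open>
  Positivity of the infimum includes that \<open>J\<close> is bounded below on \<open>M\<close>, which has to be said
  because \<open>INF\<close> on the reals is unspecified otherwise.
\<close>

definition condition_A2 ::
    "('g, 'm) monoid_scheme \<Rightarrow> ('g \<Rightarrow> 'a::real_normed_vector \<Rightarrow> 'a) \<Rightarrow> ('a \<Rightarrow> real) \<Rightarrow> 'a set \<Rightarrow> bool"
  where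
  "condition_A2 G act J M \<longleftrightarrow>
     invariant_set G act M \<and> bdd_below (J ` M) \<and> (INF u\<in>M. J u) > 0 \<and> J 0 = 0"

text \<open>
  \<open>S\<close> is \<open>unit_level Y \<psi>\<close> and \<open>U\<close> is \<open>S \<inter> P\<close>. As a map of topological spaces, \<open>mP\<close> is continuous.
\<close>

definition condition_A3 ::
    "('g, 'm) monoid_scheme \<Rightarrow> ('g \<Rightarrow> 'a::real_normed_vector \<Rightarrow> 'a) \<Rightarrow> ('a \<Rightarrow> real) \<Rightarrow> 'a set \<Rightarrow>
     'a set \<Rightarrow> ('a \<Rightarrow> real) \<Rightarrow> 'a set \<Rightarrow> ('a \<Rightarrow> 'a) \<Rightarrow> bool"
  where
  "condition_A3 G act J M Y \<psi> P mP \<longleftrightarrow>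
     (let S = unit_level Y \<psi>; U = S \<inter> P in
        open P \<and> 0 \<notin> P \<and> M \<subseteq> P \<and> invariant_set G act P \<and>
        continuous_on P mP \<and> mP ` P \<subseteq> M \<and>
        (\<forall>g\<in>carrier G. \<forall>u\<in>P. mP (act g u) = act g (mP u)) \<and>
        (\<forall>u\<in>M. mP u = u) \<and>
        (\<exists>k. homeomorphism U M mP k) \<and>
        C1_on_hypersurface Y \<psi> U (J \<circ> mP) \<and>
        (\<forall>u l. (\<forall>n. u n \<in> U) \<and> u \<longlonglongrightarrow> l \<and> l \<in> (top_of_set S) frontier_of U \<longrightarrow>
           filterlim (\<lambda>n. (J \<circ> mP) (u n)) at_top sequentially))"

definition condition_M_i ::
    "('g, 'm) monoid_scheme \<Rightarrow> ('g \<Rightarrow> 'a::real_normed_vector \<Rightarrow> 'a) \<Rightarrow> ('a \<Rightarrow> real) \<Rightarrow>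
     'a set \<Rightarrow> ('a \<Rightarrow> real) \<Rightarrow> 'a set \<Rightarrow> ('a \<Rightarrow> 'a) \<Rightarrow> real \<Rightarrow> bool"
  where
  "condition_M_i G act J Y \<psi> P mP \<beta> \<longleftrightarrow>
     (\<forall>u. PS_seq Y \<psi> (unit_level Y \<psi> \<inter> P) (J \<circ> mP) \<beta> u \<longrightarrow>
        (\<exists>g. (\<forall>n. g n \<in> carrier G) \<and>
          (\<exists>l\<in>P. \<exists>r. strict_mono (r :: nat \<Rightarrow> nat) \<and>
             weakly_tendsto (\<lambda>n. act (g (r n)) (mP (u (r n)))) l \<and>
             critical_point J (mP l) \<and> J (mP l) \<le> \<beta>)))"

definition condition_M_ii ::
    "('g, 'm) monoid_scheme \<Rightarrow> ('g \<Rightarrow> 'a::real_normed_vector \<Rightarrow> 'a) \<Rightarrow> ('a \<Rightarrow> real) \<Rightarrow>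
     'a set \<Rightarrow> ('a \<Rightarrow> real) \<Rightarrow> 'a set \<Rightarrow> ('a \<Rightarrow> 'a) \<Rightarrow> real \<Rightarrow> bool"
  where
  "condition_M_ii G act J Y \<psi> P mP \<beta> \<longleftrightarrow>
     (let U = unit_level Y \<psi> \<inter> P; \<Phi> = J \<circ> mP in
        finite {orbit G act u | u. u \<in> critical_set Y \<psi> U \<Phi>} \<longrightarrow>
        (\<exists>\<mu>>0. \<forall>u. (\<forall>n. u n \<in> U) \<and>
            (\<lambda>n. tangential_deriv_norm Y \<psi> U \<Phi> (u n)) \<longlonglongrightarrow> 0 \<and>
            (\<forall>n. \<Phi> (u n) \<le> \<beta>) \<and> (\<forall>n. norm (u n - u (Suc n)) < \<mu>) \<longrightarrow>
            liminf (\<lambda>n. ereal (norm (u n - u (Suc n)))) = 0))"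

text \<open>
  \<open>nsphere (k - 1)\<close> is the unit sphere of \<open>\<real>\<^sup>k\<close>, its points being real sequences supported on the
  first \<open>k\<close> indices. Oddness of \<open>mP\<close> comprises the symmetry of its domain \<open>P\<close>.
\<close>

definition condition_S ::
    "('a::real_normed_vector \<Rightarrow> real) \<Rightarrow> 'a set \<Rightarrow> 'a set \<Rightarrow> ('a \<Rightarrow> real) \<Rightarrow> 'a set \<Rightarrow> ('a \<Rightarrow> 'a) \<Rightarrow> bool"
  where
  "condition_S J M Y \<psi> P mP \<longleftrightarrow>
     (let U = unit_level Y \<psi> \<inter> P in
        (\<forall>u. J (- u) = J u) \<and>
        (\<forall>u\<in>P. - u \<in> P \<and> mP (- u) = - mP u) \<and>
        uminus ` U = U \<and> uminus ` M = M \<and>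
        (\<forall>k\<ge>1. \<exists>\<tau>. continuous_map (nsphere (k - 1)) (top_of_set P) \<tau> \<and>
           (\<forall>x\<in>topspace (nsphere (k - 1)). \<tau> (\<lambda>i. - x i) = - \<tau> x)))"

end

theory Submission
  imports Defs "HOL-Homology.Homology"
begin

text \<open>
  Write \<open>\<Phi> = J \<circ> mP\<close> on \<open>U = S \<inter> P\<close>. Sublevel sets of \<open>\<Phi>\<close> are complete, because \<open>\<Phi>\<close> tends to
  infinity at the boundary of \<open>U\<close>. Ekeland's variational principle (\<open>almost_critical_minimizer\<close>)
  therefore yields a Palais--Smale sequence at the level \<open>inf J\<close> over \<open>M\<close>, which the first hypothesis
  turns into a critical point of \<open>J\<close> in \<open>M\<close> of no larger value.

  For the multiplicity results suppose that there are only finitely many critical orbits. Then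
  \<open>\<Phi>\<close> has finitely many critical values, and under the hypotheses of either result there are no
  chains: sequences of bounded energy with \<open>\<Phi>' \<rightarrow> 0\<close> whose steps are small but bounded away from
  zero. This suffices for a Lusternik--Schnirelmann argument. Instead of a pseudogradient flow it
  uses a countable family of odd continuous maps of \<open>U\<close> that decrease \<open>\<Phi>\<close> at a rate proportional
  to the slope and jointly move every noncritical point (\<open>descent_maps\<close>). The local deformations
  from which they are built come from curves on the hypersurface (\<open>descent_near_noncritical\<close>).
  When the maps are iterated so that each recurs infinitely often, every trajectory converges to a
  critical point (\<open>descending_Cauchy\<close>, \<open>limit_crit\<close>), because an oscillating trajectory would
  contain a chain.
  The absence of chains also makes critical points isolated and bounds the slope below
  on annuli around them, so that on a set of trajectories that never fall below a critical level,
  with limits at this level, the limit is locally constant (\<open>limit_locally_constant\<close>). Therefore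
  each critical value adds at most 1 to the Krasnoselskii genus, and the genus of compact symmetric
  subsets of \<open>U\<close> is at most the number of critical values (\<open>genus_le_card_critical_values\<close>).

  On the other hand \<open>U\<close> contains odd continuous images of all spheres, whose genus is unbounded by the
  Borsuk--Ulam theorem. The latter is derived from the parity of the Brouwer degree of odd maps
  (\<open>odd_degree_odd_map\<close>).

  Finally, a critical point \<open>u\<close> of \<open>\<Phi>\<close> gives a constant Palais--Smale sequence. The Palais--Smale
  hypothesis then shows that \<open>mP u\<close>, or one of its translates, is a critical point of \<open>J\<close>;
  different orbits in \<open>U\<close> give different orbits in \<open>M\<close>.
\<close>

section \<open>Local descent on a hypersurface\<close>

lemma nonincreasing_if_deriv_nonpos:
  fixes g :: "real \<Rightarrow> real"
  assumes "0 \<le> t" and "\<And>s. s \<in> {0..t} \<Longrightarrow> \<exists>y\<le>0. (g has_real_derivative y) (at s within {0..t})"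
  shows "g t \<le> g 0"
proof (cases "t = 0")
  case False
  have "\<forall>s\<in>{0..t}. \<exists>y. y \<le> 0 \<and> (g has_real_derivative y) (at s within {0..t})" using assms(2) by blast
  from bchoice[OF this] obtain g' where
    g': "\<And>s. s \<in> {0..t} \<Longrightarrow> g' s \<le> 0" "\<And>s. s \<in> {0..t} \<Longrightarrow> (g has_real_derivative g' s) (at s within {0..t})"
    by blast
  have "\<exists>x\<in>{0<..<t}. g t - g 0 = g' x * (t - 0)"
    by (rule mvt_simple) (use assms(1) False g'(2) in \<open>auto simp: has_field_derivative_def\<close>)
  then obtain x where x: "x \<in> {0<..<t}" "g t - g 0 = g' x * t" by auto
  then have "g' x * t \<le> 0" using g'(1)[of x] assms(1) by (simp add: mult_nonpos_nonneg)
  then show ?thesis using x(2) by linarith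
qed simp

text \<open>
  Near \<open>u\<close> the set \<open>U\<close> can be deformed in itself so that points move at most with unit speed and
  \<open>\<Phi>\<close> decreases at a rate \<open>\<kappa>\<close>, which is at least an eighth of the slope \<open>N\<close> at the points concerned.
\<close>

definition descent_near :: "'a::metric_space set \<Rightarrow> ('a \<Rightarrow> real) \<Rightarrow> ('a \<Rightarrow> real) \<Rightarrow> 'a \<Rightarrow> bool" where
  "descent_near U \<Phi> N u \<longleftrightarrow>
     (\<exists>r>0. \<exists>\<kappa>>0. \<exists>H. continuous_on ((U \<inter> ball u r) \<times> {0..r}) (\<lambda>(x, t). H x t) \<and>
        (\<forall>x\<in>U \<inter> ball u r. N x \<le> 8 * \<kappa> \<and>
          (\<forall>t\<in>{0..r}. H x t \<in> U \<and> dist (H x t) x \<le> t \<and> \<Phi> (H x t) \<le> \<Phi> x - \<kappa> * t)))"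

text \<open>
  The functional \<open>\<Phi>\<close> is of class \<open>C\<^sup>1\<close> on the open part \<open>U = S \<inter> P\<close> of the hypersurface
  \<open>S = {u \<in> Y. \<psi> u = 1}\<close>. The abbreviations below are its derivative \<open>L\<close>, the derivative \<open>D\<close>
  of \<open>\<psi>\<close>, the tangent spaces \<open>T\<close> and the slope \<open>N u = \<parallel>\<Phi>'(u)\<parallel>\<close>.
\<close>

locale hypersurface_functional =
  fixes Y :: "'a::real_normed_vector set" and \<psi> :: "'a \<Rightarrow> real" and P :: "'a set"
    and \<Phi> :: "'a \<Rightarrow> real"
  assumes subspace_Y: "subspace Y"
    and C11: "C11_on_subspace Y \<psi>"
    and regular: "\<forall>u\<in>unit_level Y \<psi>. \<exists>v\<in>Y. deriv_within Y \<psi> u v \<noteq> 0"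
    and open_P: "open P"
    and C1: "C1_on_hypersurface Y \<psi> (unit_level Y \<psi> \<inter> P) \<Phi>"
begin

abbreviation U :: "'a set" where "U \<equiv> unit_level Y \<psi> \<inter> P"
abbreviation D :: "'a \<Rightarrow> 'a \<Rightarrow> real" where "D \<equiv> deriv_within Y \<psi>"
abbreviation L :: "'a \<Rightarrow> 'a \<Rightarrow> real" where "L \<equiv> deriv_within U \<Phi>"
abbreviation T :: "'a \<Rightarrow> 'a set" where "T \<equiv> tangent_space Y \<psi>"
abbreviation N :: "'a \<Rightarrow> real" where "N \<equiv> tangential_deriv_norm Y \<psi> U \<Phi>"

lemma U_subset_Y: "u \<in> U \<Longrightarrow> u \<in> Y"
  by (auto simp: unit_level_def)

lemma has_derivative_\<psi>: "u \<in> Y \<Longrightarrow> (\<psi> has_derivative D u) (at u within Y)"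
  using C11 unfolding C11_on_subspace_def by (simp add: frechet_derivative_works)

lemma has_derivative_\<Phi>: "u \<in> U \<Longrightarrow> (\<Phi> has_derivative L u) (at u within U)"
  using C1 unfolding C1_on_hypersurface_def by (simp add: frechet_derivative_works)

lemma linear_D: "u \<in> Y \<Longrightarrow> linear (D u)"
  using has_derivative_\<psi> has_derivative_linear by blast

lemma bounded_linear_L: "u \<in> U \<Longrightarrow> bounded_linear (L u)"
  using has_derivative_\<Phi> has_derivative_bounded_linear by blast

lemma continuous_on_\<psi>: "continuous_on Y \<psi>"
  by (meson continuous_on_eq_continuous_within has_derivative_\<psi> has_derivative_continuous)

lemma continuous_on_\<Phi>: "continuous_on U \<Phi>"
  by (meson continuous_on_eq_continuous_within has_derivative_\<Phi> has_derivative_continuous)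

text \<open>
  The derivative of \<open>\<psi>\<close> is continuous in the dual norm of \<open>Y\<close>.
\<close>

lemma D_close:
  assumes "u \<in> Y" "e > 0"
  obtains r where "r > 0" "\<And>w h. w \<in> Y \<Longrightarrow> dist w u < r \<Longrightarrow> h \<in> Y \<Longrightarrow> \<bar>D w h - D u h\<bar> \<le> e * norm h"
proof -
  obtain r K where r: "r > 0" and K: "\<And>v w h. v \<in> Y \<inter> ball u r \<Longrightarrow> w \<in> Y \<inter> ball u r \<Longrightarrow> h \<in> Y \<Longrightarrow>
      \<bar>D v h - D w h\<bar> \<le> K * norm (v - w) * norm h"
    using C11 assms(1) unfolding C11_on_subspace_def by meson
  define s where "s = min r (e / (\<bar>K\<bar> + 1))"
  have "s > 0" using r assms by (simp add: s_def)
  moreover have "\<bar>D w h - D u h\<bar> \<le> e * norm h" if "w \<in> Y" "dist w u < s" "h \<in> Y" for w h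
  proof -
    have "\<bar>D w h - D u h\<bar> \<le> K * norm (w - u) * norm h"
      using that assms r by (intro K) (auto simp: s_def dist_commute)
    also have "\<dots> \<le> (\<bar>K\<bar> + 1) * (e / (\<bar>K\<bar> + 1)) * norm h"
    proof (intro mult_right_mono)
      have "K * norm (w - u) \<le> (\<bar>K\<bar> + 1) * norm (w - u)" by (intro mult_right_mono) auto
      also have "\<dots> \<le> (\<bar>K\<bar> + 1) * (e / (\<bar>K\<bar> + 1))"
        using that by (intro mult_left_mono) (auto simp: s_def dist_norm)
      finally show "K * norm (w - u) \<le> (\<bar>K\<bar> + 1) * (e / (\<bar>K\<bar> + 1))" .
    qed auto
    finally show ?thesis by simp
  qed
  ultimately show ?thesis using that by blast
qed

lemma L_close:
  assumes "u \<in> U" "\<epsilon> > 0"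
  obtains d where "d > 0" "\<And>w v v'. w \<in> U \<Longrightarrow> v \<in> T u \<inter> cball 0 1 \<Longrightarrow> v' \<in> T w \<inter> cball 0 1
      \<Longrightarrow> dist w u < d \<Longrightarrow> dist v' v < d \<Longrightarrow> \<bar>L w v' - L u v\<bar> < \<epsilon>"
  using C1 assms unfolding C1_on_hypersurface_def by meson

lemma transversal:
  assumes "u \<in> U"
  obtains e where "e \<in> Y" "D u e = 1"
proof -
  obtain v where v: "v \<in> Y" "D u v \<noteq> 0" using regular assms by blast
  have "D u ((1 / D u v) *\<^sub>R v) = 1" using v linear_cmul[OF linear_D[OF U_subset_Y[OF assms]]] by simp
  moreover have "(1 / D u v) *\<^sub>R v \<in> Y" using v subspace_Y by (simp add: subspace_scale)
  ultimately show ?thesis using that by blast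
qed

lemma L_bounded:
  assumes "u \<in> U"
  shows "bdd_above ((\<lambda>v. \<bar>L u v\<bar>) ` (T u \<inter> cball 0 1))"
proof -
  obtain K where K: "\<And>x. norm (L u x) \<le> norm x * K" 
    using bounded_linear.bounded[OF bounded_linear_L[OF assms]] by blast
  have "\<bar>L u v\<bar> \<le> \<bar>K\<bar>" if "norm v \<le> 1" for v
  proof -
    have "\<bar>L u v\<bar> \<le> norm v * \<bar>K\<bar>"
      by (rule order_trans[OF K[of v, unfolded real_norm_def]]) (intro mult_left_mono, auto)
    also have "\<dots> \<le> 1 * \<bar>K\<bar>" using that by (intro mult_right_mono) auto
    finally show ?thesis by simp
  qed
  then show ?thesis by (auto simp: bdd_above_def intro!: exI[of _ "\<bar>K\<bar>"])
qed

lemma zero_in_T: "u \<in> U \<Longrightarrow> 0 \<in> T u"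
  using subspace_Y linear_0[OF linear_D] U_subset_Y by (auto simp: tangent_space_def subspace_0)

lemma L_le_N: "u \<in> U \<Longrightarrow> v \<in> T u \<Longrightarrow> norm v \<le> 1 \<Longrightarrow> \<bar>L u v\<bar> \<le> N u"
  unfolding tangential_deriv_norm_def by (rule cSUP_upper[OF _ L_bounded]) auto

lemma N_nonneg: "u \<in> U \<Longrightarrow> 0 \<le> N u"
  using L_le_N[OF _ zero_in_T] by (metis abs_ge_zero norm_zero order_trans zero_le_one)

lemma T_scale: "u \<in> U \<Longrightarrow> v \<in> T u \<Longrightarrow> c *\<^sub>R v \<in> T u"
  using linear_cmul[OF linear_D] U_subset_Y subspace_Y by (auto simp: tangent_space_def subspace_scale)

lemma critical_iff: "u \<in> U \<Longrightarrow> u \<in> critical_set Y \<psi> U \<Phi> \<longleftrightarrow> N u = 0"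
proof
  assume u: "u \<in> U" and c: "u \<in> critical_set Y \<psi> U \<Phi>"
  have "N u = (SUP v \<in> T u \<inter> cball 0 1. 0)"
    unfolding tangential_deriv_norm_def using c by (intro SUP_cong) (auto simp: critical_set_def)
  also have "\<dots> = 0" using zero_in_T[OF u] by (subst cSUP_const) auto
  finally show "N u = 0" .
next
  assume u: "u \<in> U" and N: "N u = 0"
  have "L u v = 0" if "v \<in> T u" for v
  proof (cases "v = 0")
    case True then show ?thesis using bounded_linear_L[OF u] by (simp add: linear_simps(3))
  next
    case False
    have "\<bar>L u ((1 / norm v) *\<^sub>R v)\<bar> \<le> N u" using False that by (intro L_le_N T_scale u) auto
    then show ?thesis using False N bounded_linear_L[OF u] by (simp add: linear_simps(5) divide_le_0_iff)
  qed
  then show "u \<in> critical_set Y \<psi> U \<Phi>" using u by (auto simp: critical_set_def)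
qed

text \<open>
  A tangent vector \<open>v'\<close> at a nearby point \<open>w\<close> is almost tangent at \<open>u\<close>: subtracting a small
  multiple of a transversal vector \<open>e\<close> and rescaling gives an admissible vector at \<open>u\<close>.
\<close>

lemma N_upper_semicontinuous:
  assumes u: "u \<in> U" and "\<epsilon> > 0"
  obtains r where "r > 0" "\<And>w. w \<in> U \<Longrightarrow> dist w u < r \<Longrightarrow> N w \<le> N u + \<epsilon>"
proof -
  obtain e where e: "e \<in> Y" "D u e = 1" using transversal[OF u] .
  obtain d where d: "d > 0" "\<And>w v v'. w \<in> U \<Longrightarrow> v \<in> T u \<inter> cball 0 1 \<Longrightarrow> v' \<in> T w \<inter> cball 0 1
      \<Longrightarrow> dist w u < d \<Longrightarrow> dist v' v < d \<Longrightarrow> \<bar>L w v' - L u v\<bar> < \<epsilon>"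
    using L_close[OF assms] by auto
  define \<eta> where "\<eta> = d / 4"
  have \<eta>: "\<eta> > 0" using d by (simp add: \<eta>_def)
  obtain r where r: "r > 0" "\<And>w h. w \<in> Y \<Longrightarrow> dist w u < r \<Longrightarrow> h \<in> Y \<Longrightarrow> \<bar>D w h - D u h\<bar> \<le> \<eta> / (norm e + 1) * norm h"
    using D_close[of u "\<eta> / (norm e + 1)"] U_subset_Y[OF u] \<eta>
    by (metis add_nonneg_pos divide_pos_pos norm_ge_zero zero_less_one)
  have "N w \<le> N u + \<epsilon>" if w: "w \<in> U" "dist w u < min r d" for w
    unfolding tangential_deriv_norm_def[of _ _ _ _ w]
  proof (rule cSUP_least)
    show "T w \<inter> cball 0 1 \<noteq> {}" using zero_in_T[OF w(1)] by auto
  next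
    fix v' assume v': "v' \<in> T w \<inter> cball 0 1"
    then have v'Y: "v' \<in> Y" "D w v' = 0" "norm v' \<le> 1" by (auto simp: tangent_space_def)
    define z where "z = v' - D u v' *\<^sub>R e"
    have "\<bar>D u v'\<bar> \<le> \<eta> / (norm e + 1) * norm v'"
      using r(2)[of w v'] w v'Y U_subset_Y by auto
    also have "\<dots> \<le> \<eta> / (norm e + 1) * 1" using v'Y \<eta> by (intro mult_left_mono) auto
    finally have a: "\<bar>D u v'\<bar> \<le> \<eta> / (norm e + 1)" by simp
    have "norm (z - v') = \<bar>D u v'\<bar> * norm e" by (simp add: z_def)
    also have "\<dots> \<le> \<eta> / (norm e + 1) * (norm e + 1)" using a \<eta> by (intro mult_mono) auto
    also have "\<dots> = \<eta>" using norm_ge_zero[of e] by (auto simp: divide_simps simp del: norm_ge_zero)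
    finally have zv: "norm (z - v') \<le> \<eta>" .
    have zT: "z \<in> T u" using e v'Y subspace_Y linear_D[OF U_subset_Y[OF u]]
      by (auto simp: tangent_space_def z_def linear_diff linear_cmul subspace_diff subspace_scale)
    have nz: "norm z \<le> 1 + \<eta>" using zv v'Y norm_triangle_sub[of z v'] by linarith
    define y where "y = (1 / (1 + \<eta>)) *\<^sub>R z"
    have y: "y \<in> T u \<inter> cball 0 1" using zT u nz \<eta> by (auto simp: y_def T_scale divide_simps)
    have "z = (1 + \<eta>) *\<^sub>R y" using \<eta> by (simp add: y_def)
    then have "z - y = \<eta> *\<^sub>R y" by (simp add: scaleR_add_left)
    then have "norm (z - y) \<le> \<eta>" using y \<eta> by (simp add: mult_left_le)
    then have "dist v' y < d" using zv norm_triangle_ineq[of "v' - z" "z - y"] d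
      by (simp add: dist_norm \<eta>_def norm_minus_commute)
    then have "\<bar>L w v' - L u y\<bar> < \<epsilon>" using d(2)[OF w(1) y v'] w by auto
    moreover have "\<bar>L u y\<bar> \<le> N u" using y by (intro L_le_N u) auto
    ultimately show "\<bar>L w v'\<bar> \<le> N u + \<epsilon>" by linarith
  qed
  then show ?thesis using that[of "min r d"] r(1) d(1) by auto
qed

text \<open>
  A family of curves in \<open>U\<close> through all points near \<open>u\<^sub>0\<close> whose velocities stay close to a given
  tangent vector \<open>v\<close>. The curve through \<open>u\<close> is \<open>t \<mapsto> u + t v + a e\<close>, where \<open>e\<close> is transversal
  to the hypersurface and \<open>a = a(u,t)\<close> is the only small solution of \<open>\<psi> (u + t v + a e) = 1\<close>.
\<close>

lemma local_curves:
  assumes u0: "u0 \<in> U" and v: "v \<in> T u0" and \<delta>: "\<delta> > 0"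
  obtains r \<gamma> where "r > 0"
    "continuous_on ((U \<inter> ball u0 r) \<times> {0..r}) (\<lambda>(u, t). \<gamma> u t)"
    "\<And>u t. u \<in> U \<inter> ball u0 r \<Longrightarrow> t \<in> {0..r} \<Longrightarrow>
       \<gamma> u t \<in> U \<and> norm (\<gamma> u t - u - t *\<^sub>R v) \<le> \<delta> * t \<and>
       (\<exists>\<gamma>' \<in> T (\<gamma> u t). norm (\<gamma>' - v) \<le> \<delta> \<and> (\<gamma> u has_vector_derivative \<gamma>') (at t within {0..r}))"
proof -
  have u0Y: "u0 \<in> Y" and u0P: "u0 \<in> P" using u0 by (auto simp: unit_level_def)
  have vY: "v \<in> Y" and Dv: "D u0 v = 0" using v by (auto simp: tangent_space_def)
  obtain e where e: "e \<in> Y" "D u0 e = 1" using transversal[OF u0] .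
  define \<kappa> where "\<kappa> = min (1/2) (\<delta> / (2 * (norm e + 1)))"
  have ne: "norm e + 1 > 0" using norm_ge_zero[of e] by linarith
  have \<kappa>: "\<kappa> > 0" "\<kappa> \<le> 1/2" using \<delta> ne unfolding \<kappa>_def by (simp, linarith)
  have \<kappa>\<delta>: "2 * \<kappa> * norm e \<le> \<delta>"
  proof -
    have "2 * \<kappa> * norm e \<le> 2 * (\<delta> / (2 * (norm e + 1))) * (norm e + 1)"
      using \<delta> ne \<kappa>(1) by (intro mult_mono) (auto simp: \<kappa>_def)
    also have "\<dots> = \<delta>" using ne by (simp add: divide_simps)
    finally show ?thesis .
  qed
  define \<epsilon> where "\<epsilon> = \<kappa> / (norm v + norm e + 1)"
  have nve: "norm v + norm e + 1 > 0" using norm_ge_zero[of e] norm_ge_zero[of v] by linarith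
  have \<epsilon>: "\<epsilon> > 0" using \<kappa> nve by (simp add: \<epsilon>_def)
  obtain R1 where R1: "R1 > 0" "\<And>w h. w \<in> Y \<Longrightarrow> dist w u0 < R1 \<Longrightarrow> h \<in> Y \<Longrightarrow> \<bar>D w h - D u0 h\<bar> \<le> \<epsilon> * norm h"
    using D_close[OF u0Y \<epsilon>] by metis
  obtain R2 where R2: "R2 > 0" "ball u0 R2 \<subseteq> P" using open_P u0P open_contains_ball by blast
  define R where "R = min R1 R2"
  have R: "R > 0" "ball u0 R \<subseteq> P" using R1 R2 by (auto simp: R_def)
  have small: "\<epsilon> * norm h \<le> \<kappa>" if "norm h \<le> norm v + norm e + 1" for h :: 'a
  proof -
    have "\<epsilon> * norm h \<le> \<epsilon> * (norm v + norm e + 1)" using that \<epsilon> by (intro mult_left_mono) auto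
    then show ?thesis using nve by (simp add: \<epsilon>_def)
  qed
  have De: "D w e \<ge> 1/2" and Dwv: "\<bar>D w v\<bar> \<le> \<kappa>" if "w \<in> Y" "dist w u0 < R" for w
    using R1(2)[of w e] R1(2)[of w v] small[of e] small[of v] e vY Dv that \<kappa>
    by (auto simp: R_def abs_le_iff)
  define C where "C = 1 + norm v + norm e"
  have C: "C > 0" using nve by (simp add: C_def)
  define r where "r = R / C"
  have r: "r > 0" "r * C = R" using R C by (auto simp: r_def)
  define p where "p = (\<lambda>u t a. u + t *\<^sub>R v + a *\<^sub>R e)"
  have pY: "p u t a \<in> Y" if "u \<in> Y" for u t a
    using that vY e subspace_Y by (auto simp: p_def intro!: subspace_add subspace_scale)
  have pR: "dist (p u t a) u0 < R" if "dist u u0 < r" "\<bar>t\<bar> \<le> r" "\<bar>a\<bar> \<le> r" for u t a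
  proof -
    have "norm (p u t a - u0) \<le> norm (u - u0) + \<bar>t\<bar> * norm v + \<bar>a\<bar> * norm e"
      unfolding p_def using norm_triangle_ineq[of "u - u0 + t *\<^sub>R v" "a *\<^sub>R e"]
        norm_triangle_ineq[of "u - u0" "t *\<^sub>R v"] by (simp add: algebra_simps)
    also have "\<dots> < r + r * norm v + r * norm e"
      using that by (intro add_less_le_mono mult_right_mono) (auto simp: dist_norm)
    also have "\<dots> = R" using r(2) by (simp add: C_def algebra_simps)
    finally show ?thesis by (simp add: dist_norm)
  qed
  have line: "((\<lambda>s. \<psi> (w + s *\<^sub>R h)) has_real_derivative D (w + s *\<^sub>R h) h) (at s)"
    if "w \<in> Y" "h \<in> Y" for w h s
  proof -
    have wY: "w + s *\<^sub>R h \<in> Y" for s using that subspace_Y by (auto intro!: subspace_add subspace_scale)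
    have "((\<lambda>s. w + s *\<^sub>R h) has_derivative (\<lambda>s. s *\<^sub>R h)) (at s)"
      by (auto intro!: derivative_eq_intros)
    moreover have "(\<psi> has_derivative D (w + s *\<^sub>R h)) (at (w + s *\<^sub>R h) within (\<lambda>s. w + s *\<^sub>R h) ` UNIV)"
      using has_derivative_\<psi>[OF wY] by (rule has_derivative_subset) (use wY in auto)
    ultimately have "((\<lambda>s. \<psi> (w + s *\<^sub>R h)) has_derivative (\<lambda>x. D (w + s *\<^sub>R h) (x *\<^sub>R h))) (at s)"
      using has_derivative_in_compose by blast
    moreover have "D (w + s *\<^sub>R h) (x *\<^sub>R h) = D (w + s *\<^sub>R h) h * x" for x
      using linear_cmul[OF linear_D[OF wY]] by simp
    ultimately show ?thesis by (simp add: has_field_derivative_def)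
  qed
  \<comment> \<open>the coefficient of \<open>e\<close> is controlled by \<open>\<psi>\<close>, since \<open>\<psi>'(e) \<ge> 1/2\<close> near \<open>u\<^sub>0\<close>\<close>
  have lip: "\<bar>b - a\<bar> \<le> 2 * \<bar>\<psi> (p u t b) - \<psi> (p u t a)\<bar>"
    if "u \<in> Y" "dist u u0 < r" "\<bar>t\<bar> \<le> r" "\<bar>a\<bar> \<le> r" "\<bar>b\<bar> \<le> r" for u t a b
  proof -
    have *: "b - a \<le> 2 * (\<psi> (p u t b) - \<psi> (p u t a))" if ab: "\<bar>a\<bar> \<le> r" "\<bar>b\<bar> \<le> r" "a < b" for a b
    proof -
      obtain z where z: "a < z" "z < b" "\<psi> (p u t b) - \<psi> (p u t a) = (b - a) * D (p u t z) e"
        using MVT2[OF \<open>a < b\<close>, of "\<lambda>a. \<psi> (p u t a)" "\<lambda>a. D (p u t a) e"] line[of "u + t *\<^sub>R v" e]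
          pY[OF \<open>u \<in> Y\<close>, of t 0] e unfolding p_def by auto
      have "D (p u t z) e \<ge> 1/2"
        using De pY pR \<open>u \<in> Y\<close> \<open>dist u u0 < r\<close> \<open>\<bar>t\<bar> \<le> r\<close> z ab by auto
      then have "(b - a) * (1/2) \<le> (b - a) * D (p u t z) e" using ab by (intro mult_left_mono) auto
      then show ?thesis using z by simp
    qed
    show ?thesis using *[of a b] *[of b a] that by (cases a b rule: linorder_cases) (auto simp: abs_if)
  qed
  have ex: "\<exists>a. \<bar>a\<bar> \<le> 2 * \<kappa> * t \<and> \<psi> (p u t a) = 1" if u: "u \<in> U" "dist u u0 < r" and t: "t \<in> {0..r}" for u t
  proof -
    have uY: "u \<in> Y" and u1: "\<psi> u = 1" using u by (auto simp: unit_level_def)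
    \<comment> \<open>as \<open>|\<psi>'(v)| \<le> \<kappa>\<close> near \<open>u\<^sub>0\<close>, the values of \<open>\<psi>\<close> for \<open>a = \<plusminus>2\<kappa>t\<close> lie on both sides of 1\<close>
    have mono: "0 \<le> c * (\<psi> (p u t (2 * \<kappa> * c * t)) - 1)" if c: "c = 1 \<or> c = -1" for c
    proof (cases "t = 0")
      case False
      with t have "t > 0" by simp
      define h where "h = v + (2 * \<kappa> * c) *\<^sub>R e"
      have hY: "h \<in> Y" using vY e subspace_Y by (auto simp: h_def intro!: subspace_add subspace_scale)
      obtain z where z: "0 < z" "z < t"
          "\<psi> (u + t *\<^sub>R h) - \<psi> (u + 0 *\<^sub>R h) = (t - 0) * D (u + z *\<^sub>R h) h"
        using MVT2[OF \<open>t > 0\<close>, of "\<lambda>s. \<psi> (u + s *\<^sub>R h)" "\<lambda>s. D (u + s *\<^sub>R h) h", OF line[OF uY hY]] by blast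
      define w where "w = u + z *\<^sub>R h"
      have w: "w = p u z (2 * \<kappa> * c * z)" by (simp add: w_def p_def h_def algebra_simps)
      have "2 * \<kappa> * z \<le> 1 * r" using \<kappa> z t by (intro mult_mono) auto
      then have "\<bar>2 * \<kappa> * c * z\<bar> \<le> r" using c \<kappa> z by (auto simp: abs_mult)
      then have wR: "w \<in> Y" "dist w u0 < R" unfolding w using pY uY z t u by (auto intro!: pR)
      have "D w h = D w v + 2 * \<kappa> * c * D w e"
        using linear_D[OF wR(1)] by (simp add: h_def linear_add linear_cmul)
      moreover have "\<kappa> * 1 \<le> \<kappa> * (2 * D w e)" using De[OF wR] \<kappa> by (intro mult_left_mono) auto
      ultimately have "c * D w h \<ge> 0"
        using Dwv[OF wR] c by (auto simp: abs_le_iff)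
      then have "0 \<le> t * (c * D w h)" using \<open>t > 0\<close> by simp
      moreover have "u + t *\<^sub>R h = p u t (2 * \<kappa> * c * t)"
        by (simp add: p_def h_def algebra_simps)
      ultimately show ?thesis using z(3) u1 by (simp add: w_def algebra_simps)
    qed (simp add: p_def u1)
    have cont: "continuous_on {- (2 * \<kappa> * t)..2 * \<kappa> * t} (\<lambda>a. \<psi> (p u t a))"
      by (rule continuous_on_compose2[OF continuous_on_\<psi>]) (use pY uY in \<open>auto simp: p_def intro!: continuous_intros\<close>)
    have "\<exists>a\<ge>- (2 * \<kappa> * t). a \<le> 2 * \<kappa> * t \<and> \<psi> (p u t a) = 1"
      by (rule IVT') (use mono[of 1] mono[of "-1"] cont \<kappa> t in auto)
    then show ?thesis by (auto simp: abs_le_iff)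
  qed
  define \<alpha> where "\<alpha> = (\<lambda>u t. SOME a. \<bar>a\<bar> \<le> 2 * \<kappa> * t \<and> \<psi> (p u t a) = 1)"
  have \<alpha>: "\<bar>\<alpha> u t\<bar> \<le> 2 * \<kappa> * t" "\<psi> (p u t (\<alpha> u t)) = 1" "\<bar>\<alpha> u t\<bar> \<le> r"
    if u: "u \<in> U" "dist u u0 < r" and t: "t \<in> {0..r}" for u t
  proof -
    show a: "\<bar>\<alpha> u t\<bar> \<le> 2 * \<kappa> * t" and "\<psi> (p u t (\<alpha> u t)) = 1"
      using someI_ex[OF ex[OF that]] by (auto simp: \<alpha>_def)
    have "2 * \<kappa> * t \<le> 1 * r" using \<kappa> t by (intro mult_mono) auto
    with a show "\<bar>\<alpha> u t\<bar> \<le> r" by simp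
  qed
  define \<gamma> where "\<gamma> = (\<lambda>u t. p u t (\<alpha> u t))"
  have \<gamma>U: "\<gamma> u t \<in> U" "dist (\<gamma> u t) u0 < R"
    if u: "u \<in> U" "dist u u0 < r" and t: "t \<in> {0..r}" for u t
  proof -
    show "dist (\<gamma> u t) u0 < R" using \<alpha>[OF that] that by (auto simp: \<gamma>_def intro!: pR)
    then show "\<gamma> u t \<in> U" using \<alpha>[OF that] pY U_subset_Y[OF u(1)] R(2)
      by (auto simp: \<gamma>_def unit_level_def dist_commute)
  qed
  let ?A = "(U \<inter> ball u0 r) \<times> {0..r}"
  have cont_\<alpha>: "continuous_on ?A (\<lambda>(u, t). \<alpha> u t)"
    unfolding continuous_on_def
  proof (rule ballI, clarify)
    fix u t assume u: "u \<in> unit_level Y \<psi>" "u \<in> P" "u \<in> ball u0 r" and t: "t \<in> {0..r}"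
    define q where "q = (\<lambda>(w, s). \<psi> (p w s (\<alpha> u t)))"
    have "continuous_on ?A q" unfolding q_def case_prod_unfold
      by (rule continuous_on_compose2[OF continuous_on_\<psi>])
        (use pY U_subset_Y in \<open>auto simp: p_def intro!: continuous_intros\<close>)
    then have "(q \<longlongrightarrow> q (u, t)) (at (u, t) within ?A)"
      using u t by (auto simp: continuous_on_def)
    moreover have "q (u, t) = 1" using \<alpha>[of u t] u t by (auto simp: q_def dist_commute)
    ultimately have "((\<lambda>z. 2 * \<bar>1 - q z\<bar>) \<longlongrightarrow> 2 * \<bar>1 - 1\<bar>) (at (u, t) within ?A)"
      by (intro tendsto_intros) auto
    then have lim: "((\<lambda>z. 2 * \<bar>1 - q z\<bar>) \<longlongrightarrow> 0) (at (u, t) within ?A)" by simp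
    have "((\<lambda>z. (case z of (u, t) \<Rightarrow> \<alpha> u t) - \<alpha> u t) \<longlongrightarrow> 0) (at (u, t) within ?A)"
    proof (rule Lim_null_comparison[OF _ lim], rule eventually_at_topological[THEN iffD2],
        intro exI[of _ UNIV] conjI ballI impI)
      fix z assume z: "z \<in> ?A"
      then obtain w s where ws: "z = (w, s)" "w \<in> U" "dist w u0 < r" "s \<in> {0..r}" by (auto simp: dist_commute)
      have "\<bar>\<alpha> w s - \<alpha> u t\<bar> \<le> 2 * \<bar>\<psi> (p w s (\<alpha> w s)) - \<psi> (p w s (\<alpha> u t))\<bar>"
        using \<alpha>[OF ws(2-4)] \<alpha>[of u t] u t ws U_subset_Y by (intro lip) (auto simp: dist_commute)
      then show "norm ((case z of (u, t) \<Rightarrow> \<alpha> u t) - \<alpha> u t) \<le> 2 * \<bar>1 - q z\<bar>"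
        using \<alpha>(2)[OF ws(2-4)] ws by (simp add: q_def)
    qed auto
    then show "((\<lambda>(u, t). \<alpha> u t) \<longlongrightarrow> \<alpha> u t) (at (u, t) within ?A)"
      by (simp add: LIM_zero_iff)
  qed
  have deriv: "\<exists>\<gamma>' \<in> T (\<gamma> u t). norm (\<gamma>' - v) \<le> \<delta> \<and> (\<gamma> u has_vector_derivative \<gamma>') (at t within {0..r})"
    if u: "u \<in> U" "dist u u0 < r" and t: "t \<in> {0..r}" for u t
  proof -
    define w where "w = \<gamma> u t"
    have wU: "w \<in> U" and wR: "dist w u0 < R" using \<gamma>U[OF that] by (auto simp: w_def)
    have wY: "w \<in> Y" using wU U_subset_Y by blast
    \<comment> \<open>the derivative of \<open>\<alpha> u\<close>, which makes \<open>v + k e\<close> tangent at \<open>w\<close>\<close>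
    define k where "k = - D w v / D w e"
    have Dp: "D w e \<ge> 1/2" "\<bar>D w v\<bar> \<le> \<kappa>" using De[OF wY wR] Dwv[OF wY wR] by auto
    have k: "\<bar>k\<bar> \<le> 2 * \<kappa>"
    proof -
      have "\<bar>k\<bar> = \<bar>D w v\<bar> / D w e" using Dp by (simp add: k_def)
      also have "\<dots> \<le> \<kappa> / (1/2)" using Dp \<kappa> by (intro frac_le) auto
      finally show ?thesis by simp
    qed
    have Lip: "\<bar>\<alpha> u s - \<alpha> u t\<bar> \<le> 2 * \<kappa> * \<bar>s - t\<bar>" if s: "s \<in> {0..r}" for s
    proof (cases "s = t")
      case False
      have a: "\<bar>\<alpha> u t\<bar> \<le> r" "\<psi> (p u t (\<alpha> u t)) = 1" using \<alpha>[OF u t] by auto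
      define y where "y = u + \<alpha> u t *\<^sub>R e"
      have yY: "y \<in> Y" using U_subset_Y[OF u(1)] e subspace_Y by (auto simp: y_def intro!: subspace_add subspace_scale)
      have py: "p u x (\<alpha> u t) = y + x *\<^sub>R v" for x by (simp add: p_def y_def algebra_simps)
      have "\<bar>\<psi> (y + s *\<^sub>R v) - \<psi> (y + t *\<^sub>R v)\<bar> \<le> \<kappa> * \<bar>s - t\<bar>"
      proof -
        have "norm (\<psi> (y + s *\<^sub>R v) - \<psi> (y + t *\<^sub>R v)) \<le> \<kappa> * norm (s - t)"
        proof (rule field_differentiable_bound[of "{0..r}" _ "\<lambda>x. D (y + x *\<^sub>R v) v"])
          fix x assume x: "x \<in> {0..r}"
          show "((\<lambda>x. \<psi> (y + x *\<^sub>R v)) has_field_derivative D (y + x *\<^sub>R v) v) (at x within {0..r})"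
            by (rule has_field_derivative_at_within[OF line]) (use yY vY in auto)
          show "norm (D (y + x *\<^sub>R v) v) \<le> \<kappa>"
            using Dwv[of "y + x *\<^sub>R v"] pY[OF U_subset_Y[OF u(1)], of x "\<alpha> u t"] pR[of u x "\<alpha> u t"] u x a by (auto simp: py)
        qed (use s t in auto)
        then show ?thesis by simp
      qed
      then have "\<bar>\<psi> (p u s (\<alpha> u s)) - \<psi> (p u s (\<alpha> u t))\<bar> \<le> \<kappa> * \<bar>s - t\<bar>"
        using \<alpha>(2)[OF u s] a by (simp add: py)
      then show ?thesis using lip[of u s "\<alpha> u t" "\<alpha> u s"] U_subset_Y[OF u(1)] u s a \<alpha>(3)[OF u s] by auto
    qed simp
    have "(\<alpha> u has_derivative (\<lambda>x. k * x)) (at t within {0..r})"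
      unfolding has_derivative_within_alt
    proof (intro conjI allI impI)
      show "bounded_linear ((*) k)" by (rule bounded_linear_mult_right)
      fix \<epsilon> :: real assume \<epsilon>: "\<epsilon> > 0"
      define \<eta> where "\<eta> = \<epsilon> / (2 * C)"
      have "\<eta> > 0" using \<epsilon> C by (simp add: \<eta>_def)
      then obtain d where d: "d > 0" "\<And>y. y \<in> Y \<Longrightarrow> norm (y - w) < d \<Longrightarrow>
          norm (\<psi> y - \<psi> w - D w (y - w)) \<le> \<eta> * norm (y - w)"
        using has_derivative_\<psi>[OF wY] unfolding has_derivative_within_alt by meson
      show "\<exists>d>0. \<forall>s\<in>{0..r}. norm (s - t) < d \<longrightarrow> norm (\<alpha> u s - \<alpha> u t - k * (s - t)) \<le> \<epsilon> * norm (s - t)"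
      proof (intro exI[of _ "d / C"] conjI ballI impI)
        show "d / C > 0" using d C by simp
        fix s assume s: "s \<in> {0..r}" and sd: "norm (s - t) < d / C"
        define b where "b = \<alpha> u s - \<alpha> u t"
        define h where "h = (s - t) *\<^sub>R v + b *\<^sub>R e"
        have wh: "\<gamma> u s = w + h" by (simp add: \<gamma>_def w_def h_def b_def p_def algebra_simps)
        have "\<bar>b\<bar> \<le> 1 * \<bar>s - t\<bar>" unfolding b_def
          by (rule order_trans[OF Lip[OF s]]) (use \<kappa> in \<open>intro mult_right_mono, auto\<close>)
        then have "norm h \<le> \<bar>s - t\<bar> * norm v + \<bar>s - t\<bar> * norm e"
          unfolding h_def by (intro norm_triangle_le add_mono) (auto intro!: mult_right_mono)
        also have "\<dots> \<le> C * \<bar>s - t\<bar>" by (simp add: C_def algebra_simps)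
        finally have nh: "norm h \<le> C * \<bar>s - t\<bar>" .
        then have hd: "norm h < d" using sd C by (simp add: field_simps)
        have "w + h \<in> Y" using \<gamma>U(1)[OF u s] U_subset_Y wh by metis
        then have "\<bar>\<psi> (w + h) - \<psi> w - D w h\<bar> \<le> \<eta> * norm h" using d(2)[of "w + h"] hd by simp
        moreover have "\<psi> (w + h) = 1" "\<psi> w = 1"
          using \<gamma>U(1)[OF u s] wU wh by (auto simp: unit_level_def)
        moreover have "D w h = (s - t) * D w v + b * D w e"
          using linear_D[OF wY] by (simp add: h_def linear_add linear_cmul)
        ultimately have "\<bar>(s - t) * D w v + b * D w e\<bar> \<le> \<eta> * (C * \<bar>s - t\<bar>)"
          using mult_left_mono[OF nh, of \<eta>] \<open>\<eta> > 0\<close> by linarith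
        moreover have "b - k * (s - t) = ((s - t) * D w v + b * D w e) / D w e"
          using Dp by (auto simp: k_def field_simps)
        ultimately have "\<bar>b - k * (s - t)\<bar> \<le> (\<eta> * (C * \<bar>s - t\<bar>)) / (1/2)"
          using Dp by (simp only: abs_divide) (intro frac_le, auto)
        also have "\<dots> = \<epsilon> * \<bar>s - t\<bar>" using C by (simp add: \<eta>_def)
        finally show "norm (\<alpha> u s - \<alpha> u t - k * (s - t)) \<le> \<epsilon> * norm (s - t)" by (simp add: b_def)
      qed
    qed
    then have "(\<alpha> u has_vector_derivative k) (at t within {0..r})"
      by (simp add: has_vector_derivative_def mult.commute)
    then have "(\<alpha> u has_real_derivative k) (at t within {0..r})"
      by (simp add: has_real_derivative_iff_has_vector_derivative)
    then have "(\<gamma> u has_vector_derivative (v + k *\<^sub>R e)) (at t within {0..r})"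
      unfolding \<gamma>_def p_def by (auto intro!: derivative_eq_intros)
    moreover have "D w (v + k *\<^sub>R e) = D w v + k * D w e"
      by (simp only: linear_add[OF linear_D[OF wY]] linear_cmul[OF linear_D[OF wY]] real_scaleR_def)
    then have "v + k *\<^sub>R e \<in> T w"
      using subspace_add[OF subspace_Y vY subspace_scale[OF subspace_Y e(1), of k]] Dp
      by (auto simp: tangent_space_def k_def)
    moreover have "norm (v + k *\<^sub>R e - v) \<le> \<delta>"
      using k \<kappa>\<delta> mult_right_mono[OF k norm_ge_zero[of e]] by simp
    ultimately show ?thesis unfolding w_def by blast
  qed
  show ?thesis
  proof (rule that[of r \<gamma>])
    show "continuous_on ?A (\<lambda>(u, t). \<gamma> u t)"
      using cont_\<alpha> unfolding \<gamma>_def p_def case_prod_unfold by (auto intro!: continuous_intros)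
    fix u t assume "u \<in> U \<inter> ball u0 r" and t: "t \<in> {0..r}"
    then have u: "u \<in> U" "dist u u0 < r" by (auto simp: dist_commute)
    have "\<bar>\<alpha> u t\<bar> * norm e \<le> (2 * \<kappa> * t) * norm e" using \<alpha>[OF u t] by (intro mult_right_mono) auto
    also have "\<dots> = (2 * \<kappa> * norm e) * t" by simp
    also have "\<dots> \<le> \<delta> * t" using \<kappa>\<delta> t by (intro mult_right_mono) auto
    finally have "norm (\<gamma> u t - u - t *\<^sub>R v) \<le> \<delta> * t" by (simp add: \<gamma>_def p_def)
    then show "\<gamma> u t \<in> U \<and> norm (\<gamma> u t - u - t *\<^sub>R v) \<le> \<delta> * t \<and>
       (\<exists>\<gamma>' \<in> T (\<gamma> u t). norm (\<gamma>' - v) \<le> \<delta> \<and> (\<gamma> u has_vector_derivative \<gamma>') (at t within {0..r}))"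
      using \<gamma>U[OF u t] deriv[OF u t] by blast
  qed (rule r(1))
qed

lemma steep_direction:
  assumes u: "u \<in> U" and N: "N u > 0"
  obtains v where "v \<in> T u" "norm v \<le> 1 / 2" "L u v < - 3 / 8 * N u"
proof -
  have "3 / 4 * N u < (SUP v \<in> T u \<inter> cball 0 1. \<bar>L u v\<bar>)"
    using N by (simp add: tangential_deriv_norm_def)
  moreover have "T u \<inter> cball 0 1 \<noteq> {}" using zero_in_T[OF u] by auto
  ultimately have "\<exists>v\<in>T u \<inter> cball 0 1. 3 / 4 * N u < \<bar>L u v\<bar>"
    using less_cSUP_iff[OF _ L_bounded[OF u]] by blast
  then obtain v where v: "v \<in> T u" "norm v \<le> 1" "3 / 4 * N u < \<bar>L u v\<bar>" by auto
  define c where "c = (if L u v > 0 then -1/2 else 1/2 :: real)"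
  have "L u (c *\<^sub>R v) = c * L u v" using bounded_linear_L[OF u] by (simp add: linear_simps(5))
  then have "L u (c *\<^sub>R v) < - 3 / 8 * N u" using v(3) by (auto simp: c_def abs_if split: if_splits)
  moreover have "c *\<^sub>R v \<in> T u" "norm (c *\<^sub>R v) \<le> 1 / 2" using v T_scale[OF u] by (auto simp: c_def)
  ultimately show ?thesis using that by blast
qed

text \<open>
  The curves of \<open>local_curves\<close> for a steep direction \<open>v\<close> deform \<open>U\<close> near \<open>u\<^sub>0\<close>,
  with \<open>\<kappa> = N u\<^sub>0 / 4\<close>. The function
  \<open>N'\<close> only has to be dominated by \<open>N u\<^sub>0\<close> near \<open>u\<^sub>0\<close>, because the symmetrized slope will be put
  in its place.
\<close>

lemma descent_near_noncritical:
  assumes u0: "u0 \<in> U" and N: "N u0 > 0"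
    and r2: "r2 > 0" "\<And>w. w \<in> U \<Longrightarrow> dist w u0 < r2 \<Longrightarrow> N' w \<le> 2 * N u0"
  shows "descent_near U \<Phi> N' u0"
proof -
  obtain v where v: "v \<in> T u0" "norm v \<le> 1 / 2" "L u0 v < - 3 / 8 * N u0"
    using steep_direction[OF u0 N] .
  obtain d where d: "d > 0" "\<And>w v v'. w \<in> U \<Longrightarrow> v \<in> T u0 \<inter> cball 0 1 \<Longrightarrow> v' \<in> T w \<inter> cball 0 1
      \<Longrightarrow> dist w u0 < d \<Longrightarrow> dist v' v < d \<Longrightarrow> \<bar>L w v' - L u0 v\<bar> < N u0 / 8"
    using L_close[OF u0, of "N u0 / 8"] N by auto
  define \<delta> where "\<delta> = min (1/2) (d/2)"
  have \<delta>: "\<delta> > 0" "\<delta> \<le> 1/2" "\<delta> < d" using d by (auto simp: \<delta>_def)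
  obtain r1 \<gamma> where r1: "r1 > 0"
    and \<gamma>c: "continuous_on ((U \<inter> ball u0 r1) \<times> {0..r1}) (\<lambda>(u, t). \<gamma> u t)"
    and \<gamma>: "\<And>u t. u \<in> U \<inter> ball u0 r1 \<Longrightarrow> t \<in> {0..r1} \<Longrightarrow>
       \<gamma> u t \<in> U \<and> norm (\<gamma> u t - u - t *\<^sub>R v) \<le> \<delta> * t \<and>
       (\<exists>\<gamma>' \<in> T (\<gamma> u t). norm (\<gamma>' - v) \<le> \<delta> \<and> (\<gamma> u has_vector_derivative \<gamma>') (at t within {0..r1}))"
    using local_curves[OF u0 v(1) \<delta>(1)] by blast
  define r where "r = min r1 (min r2 (d / 2))"
  have r: "r > 0" "r \<le> r1" "r \<le> r2" "r \<le> d / 2" using r1 r2 d by (auto simp: r_def)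
  have dist_\<gamma>: "dist (\<gamma> u t) u \<le> t" if "u \<in> U \<inter> ball u0 r1" "t \<in> {0..r1}" for u t
  proof -
    have "norm (\<gamma> u t - u) \<le> norm (\<gamma> u t - u - t *\<^sub>R v) + norm (t *\<^sub>R v)"
      by (rule order_trans[OF _ norm_triangle_ineq]) simp
    also have "\<dots> \<le> (1/2) * t + t * (1/2)"
    proof (intro add_mono)
      have "\<delta> * t \<le> (1/2) * t" using that \<delta> by (intro mult_right_mono) auto
      then show "norm (\<gamma> u t - u - t *\<^sub>R v) \<le> (1/2) * t" using \<gamma>[OF that] by linarith
      show "norm (t *\<^sub>R v) \<le> t * (1/2)" using that mult_left_mono[OF v(2), of t] by simp
    qed
    finally show ?thesis by (simp add: dist_norm)
  qed
  have descent: "\<Phi> (\<gamma> u t) \<le> \<Phi> u - N u0 / 4 * t" if u: "u \<in> U \<inter> ball u0 r" and t: "t \<in> {0..r}" for u t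
  proof -
    have u1: "u \<in> U \<inter> ball u0 r1" using u r by auto
    have t1: "s \<in> {0..r1}" if "s \<in> {0..t}" for s using that t r by auto
    have "\<gamma> u 0 = u" using dist_\<gamma>[OF u1, of 0] r1 by simp
    have "\<exists>y\<le>0. ((\<lambda>s. \<Phi> (\<gamma> u s) + N u0 / 4 * s) has_real_derivative y) (at s within {0..t})"
      if s: "s \<in> {0..t}" for s
    proof -
      obtain \<gamma>' where \<gamma>': "\<gamma>' \<in> T (\<gamma> u s)" "norm (\<gamma>' - v) \<le> \<delta>"
          "(\<gamma> u has_vector_derivative \<gamma>') (at s within {0..r1})"
        using \<gamma>[OF u1 t1[OF s]] by blast
      have \<gamma>U: "\<gamma> u s \<in> U" using \<gamma>[OF u1 t1[OF s]] by blast
      have "norm \<gamma>' \<le> 1" using \<gamma>'(2) v(2) \<delta>(2) norm_triangle_sub[of \<gamma>' v] by linarith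
      moreover have "dist (\<gamma> u s) u0 < d"
        using dist_\<gamma>[OF u1 t1[OF s]] dist_triangle[of "\<gamma> u s" u0 u] u s t r by (auto simp: dist_commute)
      ultimately have "\<bar>L (\<gamma> u s) \<gamma>' - L u0 v\<bar> < N u0 / 8"
        using v \<gamma>' \<delta> \<gamma>U by (intro d(2)) (auto simp: dist_norm)
      then have neg: "L (\<gamma> u s) \<gamma>' + N u0 / 4 \<le> 0" using v(3) by linarith
      have "(\<gamma> u has_derivative (\<lambda>x. x *\<^sub>R \<gamma>')) (at s within {0..t})"
        using \<gamma>'(3) t1 unfolding has_vector_derivative_def by (auto elim: has_derivative_subset)
      moreover have "(\<Phi> has_derivative L (\<gamma> u s)) (at (\<gamma> u s) within \<gamma> u ` {0..t})"
        using has_derivative_\<Phi>[OF \<gamma>U] by (rule has_derivative_subset) (use \<gamma>[OF u1 t1] in blast)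
      ultimately have "((\<lambda>s. \<Phi> (\<gamma> u s)) has_derivative (\<lambda>x. L (\<gamma> u s) (x *\<^sub>R \<gamma>'))) (at s within {0..t})"
        by (rule has_derivative_in_compose)
      then have "((\<lambda>s. \<Phi> (\<gamma> u s)) has_vector_derivative L (\<gamma> u s) \<gamma>') (at s within {0..t})"
        using bounded_linear_L[OF \<gamma>U] by (simp add: has_vector_derivative_def linear_simps(5))
      then have "((\<lambda>s. \<Phi> (\<gamma> u s)) has_real_derivative L (\<gamma> u s) \<gamma>') (at s within {0..t})"
        by (simp add: has_real_derivative_iff_has_vector_derivative)
      then have "((\<lambda>s. \<Phi> (\<gamma> u s) + N u0 / 4 * s) has_real_derivative (L (\<gamma> u s) \<gamma>' + N u0 / 4)) (at s within {0..t})"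
        by (auto intro!: derivative_eq_intros)
      then show ?thesis using neg by blast
    qed
    then have "\<Phi> (\<gamma> u t) + N u0 / 4 * t \<le> \<Phi> (\<gamma> u 0) + N u0 / 4 * 0"
      using t by (intro nonincreasing_if_deriv_nonpos[of t "\<lambda>s. \<Phi> (\<gamma> u s) + N u0 / 4 * s"]) auto
    then show ?thesis using \<open>\<gamma> u 0 = u\<close> by simp
  qed
  have "N' u \<le> 8 * (N u0 / 4)" if "u \<in> U \<inter> ball u0 r" for u
    using r2(2)[of u] r that by (auto simp: dist_commute)
  moreover have "\<gamma> u t \<in> U" "dist (\<gamma> u t) u \<le> t" if "u \<in> U \<inter> ball u0 r" "t \<in> {0..r}" for u t
    using \<gamma>[of u t] dist_\<gamma>[of u t] that r by auto
  moreover have "continuous_on ((U \<inter> ball u0 r) \<times> {0..r}) (\<lambda>(u, t). \<gamma> u t)"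
    using \<gamma>c by (rule continuous_on_subset) (use r in auto)
  ultimately have *: "continuous_on ((U \<inter> ball u0 r) \<times> {0..r}) (\<lambda>(u, t). \<gamma> u t) \<and>
      (\<forall>x\<in>U \<inter> ball u0 r. N' x \<le> 8 * (N u0 / 4) \<and>
         (\<forall>t\<in>{0..r}. \<gamma> x t \<in> U \<and> dist (\<gamma> x t) x \<le> t \<and> \<Phi> (\<gamma> x t) \<le> \<Phi> x - N u0 / 4 * t))"
    using descent by blast
  have "0 < N u0 / 4" using N by simp
  with * r(1) show ?thesis unfolding descent_near_def by blast
qed

end

section \<open>Odd descent maps\<close>

lemma continuous_on_if_locally_eq:
  fixes f :: "'a::metric_space \<Rightarrow> 'b::metric_space"
  assumes "\<And>x. x \<in> S \<Longrightarrow> \<exists>W g. open W \<and> x \<in> W \<and> continuous_on (S \<inter> W) g \<and> (\<forall>y\<in>S \<inter> W. f y = g y)"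
  shows "continuous_on S f"
  unfolding continuous_on_eq_continuous_within
proof
  fix x assume x: "x \<in> S"
  obtain W g where W: "open W" "x \<in> W" and g: "continuous_on (S \<inter> W) g" "\<forall>y\<in>S \<inter> W. f y = g y"
    using assms[OF x] by blast
  have "continuous_on (S \<inter> W) f" using g by (metis (no_types, lifting) continuous_on_cong)
  then have "continuous (at x within S \<inter> W) f" using x W by (simp add: continuous_on_eq_continuous_within)
  moreover have "at x within S = at x within (S \<inter> W)"
    using W by (intro at_within_nhd[of x W]) auto
  ultimately show "continuous (at x within S) f" by simp
qed

lemma infdist_uminus:
  fixes E :: "'a::real_normed_vector set"
  assumes "\<And>x. x \<in> E \<Longrightarrow> - x \<in> E"
  shows "infdist (- u) E = infdist u E"
proof -
  have "uminus ` E = E" using assms by force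
  then have "(\<lambda>a. dist (- u) a) ` E = (\<lambda>a. dist (- u) a) ` uminus ` E" by simp
  also have "\<dots> = (\<lambda>a. dist u a) ` E" by (simp add: image_image dist_minus)
  finally show ?thesis by (simp add: infdist_def)
qed

lemma infdist_lessD:
  assumes "E \<noteq> {}" "infdist u E < e"
  shows "\<exists>x\<in>E. dist u x < e"
  using assms cINF_less_iff[of E "dist u" e] by (auto simp: infdist_def)

text \<open>An odd descending deformation of the points of \<open>U\<close> near \<open>i\<close> and \<open>-i\<close>.\<close>

definition odd_deformation :: "'a::real_normed_vector set \<Rightarrow> ('a \<Rightarrow> real) \<Rightarrow> ('a \<Rightarrow> real) \<Rightarrow> 'a \<Rightarrow>
    real \<Rightarrow> ('a \<Rightarrow> real \<Rightarrow> 'a) \<Rightarrow> bool" where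
  "odd_deformation U \<Phi> N i r G \<longleftrightarrow> r > 0 \<and>
     continuous_on ((U \<inter> (ball i r \<union> ball (- i) r)) \<times> {0..r}) (\<lambda>(x, t). G x t) \<and>
     (\<forall>x\<in>U \<inter> (ball i r \<union> ball (- i) r). \<forall>t\<in>{0..r}. G x t \<in> U \<and> dist (G x t) x \<le> t \<and>
        \<Phi> (G x t) \<le> \<Phi> x - N x / 8 * dist (G x t) x \<and> (t > 0 \<longrightarrow> \<Phi> (G x t) < \<Phi> x) \<and>
        G (- x) t = - G x t)"

text \<open>The deformation at \<open>i\<close> is combined with its mirror image at \<open>-i\<close>.\<close>

lemma odd_descent_near:
  fixes U :: "'a::real_normed_vector set"
  assumes sym: "\<And>u. u \<in> U \<Longrightarrow> - u \<in> U" and "0 \<notin> U"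
    and \<Phi>: "\<And>u. u \<in> U \<Longrightarrow> \<Phi> (- u) = \<Phi> u" and N: "\<And>u. u \<in> U \<Longrightarrow> N (- u) = N u"
    and i: "i \<in> U" "descent_near U \<Phi> N i"
  shows "\<exists>r G. odd_deformation U \<Phi> N i r G"
proof -
  obtain r1 \<kappa> H where r1: "r1 > 0" and \<kappa>: "\<kappa> > 0"
    and Hc: "continuous_on ((U \<inter> ball i r1) \<times> {0..r1}) (\<lambda>(x, t). H x t)"
    and H: "\<And>x. x \<in> U \<inter> ball i r1 \<Longrightarrow> N x \<le> 8 * \<kappa>"
      "\<And>x t. x \<in> U \<inter> ball i r1 \<Longrightarrow> t \<in> {0..r1} \<Longrightarrow>
          H x t \<in> U \<and> dist (H x t) x \<le> t \<and> \<Phi> (H x t) \<le> \<Phi> x - \<kappa> * t"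
    using i(2) unfolding descent_near_def by blast
  have "i \<noteq> 0" using i \<open>0 \<notin> U\<close> by auto
  define r where "r = min r1 (norm i)"
  have r: "r > 0" "r \<le> r1" "r \<le> norm i" using r1 \<open>i \<noteq> 0\<close> by (auto simp: r_def)
  have neg: "- x \<in> ball i r \<longleftrightarrow> x \<in> ball (- i) r" for x
    by (metis dist_minus mem_ball minus_minus)
  have disj: "\<not> (x \<in> ball i r \<and> x \<in> ball (- i) r)" for x
  proof
    assume "x \<in> ball i r \<and> x \<in> ball (- i) r"
    then have "dist i (- i) < r + r" using dist_triangle_less_add[of i x r "- i" r] by (auto simp: dist_commute)
    moreover have "dist i (- i) = 2 * norm i" by (simp add: dist_norm flip: scaleR_2)
    ultimately show False using r by simp
  qed
  define G where "G = (\<lambda>x t. if x \<in> ball i r then H x t else - H (- x) t)"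
  let ?O = "U \<inter> (ball i r \<union> ball (- i) r)"
  have Gc: "continuous_on (?O \<times> {0..r}) (\<lambda>(x, t). G x t)"
  proof (rule continuous_on_if_locally_eq)
    fix z assume z: "z \<in> ?O \<times> {0..r}"
    show "\<exists>W g. open W \<and> z \<in> W \<and> continuous_on (?O \<times> {0..r} \<inter> W) g \<and>
        (\<forall>y\<in>?O \<times> {0..r} \<inter> W. (case y of (x, t) \<Rightarrow> G x t) = g y)"
    proof (cases "fst z \<in> ball i r")
      case True
      show ?thesis
      proof (intro exI conjI)
        show "open (ball i r \<times> (UNIV :: real set))" by (intro open_Times) auto
        show "continuous_on (?O \<times> {0..r} \<inter> ball i r \<times> UNIV) (\<lambda>(x, t). H x t)"
          using Hc by (rule continuous_on_subset) (use r in auto)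
      qed (use True z in \<open>auto simp: G_def\<close>)
    next
      case False
      show ?thesis
      proof (intro exI conjI)
        show "open (ball (- i) r \<times> (UNIV :: real set))" by (intro open_Times) auto
        have "continuous_on (?O \<times> {0..r} \<inter> ball (- i) r \<times> UNIV) (\<lambda>z. - (case (- fst z, snd z) of (x, t) \<Rightarrow> H x t))"
          by (intro continuous_on_minus continuous_on_compose2[OF Hc] continuous_intros)
            (use r(2) sym dist_minus[of "- i"] in auto)
        then show "continuous_on (?O \<times> {0..r} \<inter> ball (- i) r \<times> UNIV) (\<lambda>(x, t). - H (- x) t)"
          by (simp add: case_prod_unfold)
      qed (use False z disj in \<open>auto simp: G_def\<close>)
    qed
  qed
  have half: "H x t \<in> U \<and> dist (H x t) x \<le> t \<and>
        \<Phi> (H x t) \<le> \<Phi> x - N x / 8 * dist (H x t) x \<and> (t > 0 \<longrightarrow> \<Phi> (H x t) < \<Phi> x)"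
    if "x \<in> U" "x \<in> ball i r" "t \<in> {0..r}" for x t
  proof -
    have *: "H x t \<in> U" "dist (H x t) x \<le> t" "\<Phi> (H x t) \<le> \<Phi> x - \<kappa> * t" "N x \<le> 8 * \<kappa>"
      using H[of x] H(2)[of x t] that r by auto
    have "N x / 8 * dist (H x t) x \<le> \<kappa> * dist (H x t) x" using * by (intro mult_right_mono) auto
    also have "\<dots> \<le> \<kappa> * t" using * \<kappa> by (intro mult_left_mono) auto
    finally have "\<Phi> (H x t) \<le> \<Phi> x - N x / 8 * dist (H x t) x" using * by linarith
    moreover have "t > 0 \<longrightarrow> \<kappa> * t > 0" using \<kappa> by simp
    ultimately show ?thesis using * by auto
  qed
  have "G x t \<in> U \<and> dist (G x t) x \<le> t \<and> \<Phi> (G x t) \<le> \<Phi> x - N x / 8 * dist (G x t) x \<and>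
      (t > 0 \<longrightarrow> \<Phi> (G x t) < \<Phi> x) \<and> G (- x) t = - G x t"
    if x: "x \<in> ?O" and t: "t \<in> {0..r}" for x t
  proof (cases "x \<in> ball i r")
    case True
    then show ?thesis using half[of x t] x t disj neg[of "- x"] by (auto simp: G_def)
  next
    case False
    then have "- x \<in> ball i r" "- x \<in> U" using x neg sym by auto
    then show ?thesis using half[of "- x" t] x t False sym[of "H (- x) t"] \<Phi>[of "H (- x) t"] \<Phi>[of x] N[of x]
      dist_minus[of "H (- x) t" "- x"] by (auto simp: G_def)
  qed
  with Gc r(1) show ?thesis unfolding odd_deformation_def by blast
qed

text \<open>
  Odd self-maps of \<open>U\<close> with steps of length at most \<open>\<rho>\<close> along which \<open>\<Phi>\<close> decreases, and which
  together move every point with \<open>N u > 0\<close> strictly downwards.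
\<close>

definition odd_descent_maps :: "'a::real_normed_vector set \<Rightarrow> ('a \<Rightarrow> real) \<Rightarrow> ('a \<Rightarrow> real) \<Rightarrow> real \<Rightarrow>
    (nat \<Rightarrow> 'a \<Rightarrow> 'a) \<Rightarrow> bool" where
  "odd_descent_maps U \<Phi> N \<rho> \<eta> \<longleftrightarrow> (\<forall>n. continuous_on U (\<eta> n)) \<and>
     (\<forall>n. \<forall>u\<in>U. \<eta> n u \<in> U \<and> \<eta> n (- u) = - \<eta> n u \<and> dist (\<eta> n u) u \<le> \<rho> \<and>
        \<Phi> (\<eta> n u) \<le> \<Phi> u - N u / 8 * dist (\<eta> n u) u) \<and>
     (\<forall>u\<in>U. N u > 0 \<longrightarrow> (\<exists>n. \<Phi> (\<eta> n u) < \<Phi> u))"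

text \<open>
  As in Stone's theorem on paracompactness, the cover of \<open>{N > 0}\<close> by the domains \<open>B i\<close> of the
  local deformations is well-ordered, and \<open>E n i\<close> consists of the points that lie in \<open>B i\<close>
  together with a ball of radius \<open>1 / (n+1)\<close> and in no earlier set. For fixed \<open>n\<close> the sets
  \<open>E n i\<close> are uniformly separated, hence the deformations can be carried out simultaneously near
  all of them.
\<close>

lemma descent_maps:
  fixes U :: "'a::real_normed_vector set"
  assumes sym: "\<And>u. u \<in> U \<Longrightarrow> - u \<in> U" and "0 \<notin> U"
    and \<Phi>: "\<And>u. u \<in> U \<Longrightarrow> \<Phi> (- u) = \<Phi> u" and N: "\<And>u. u \<in> U \<Longrightarrow> N (- u) = N u"
    and descent: "\<And>u. u \<in> U \<Longrightarrow> N u > 0 \<Longrightarrow> descent_near U \<Phi> N u" and \<rho>: "\<rho> > 0"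
  shows "\<exists>\<eta>. odd_descent_maps U \<Phi> N \<rho> \<eta>"
proof -
  define C where "C = {u\<in>U. N u > 0}"
  have "\<forall>i\<in>C. \<exists>r G. odd_deformation U \<Phi> N i r G"
    using odd_descent_near[OF sym \<open>0 \<notin> U\<close> \<Phi> N _ descent] by (auto simp: C_def)
  then obtain r where "\<forall>i\<in>C. \<exists>G. odd_deformation U \<Phi> N i (r i) G" by (rule bchoice[THEN exE])
  then obtain G where G0: "\<forall>i\<in>C. odd_deformation U \<Phi> N i (r i) (G i)" by (rule bchoice[THEN exE])
  define B where "B = (\<lambda>i. ball i (r i) \<union> ball (- i) (r i))"
  have r: "r i > 0" and Gc: "continuous_on ((U \<inter> B i) \<times> {0..r i}) (\<lambda>(x, t). G i x t)" if "i \<in> C" for i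
    using G0 that by (auto simp: B_def odd_deformation_def)
  have G: "G i x t \<in> U" "dist (G i x t) x \<le> t" "\<Phi> (G i x t) \<le> \<Phi> x - N x / 8 * dist (G i x t) x"
    "t > 0 \<Longrightarrow> \<Phi> (G i x t) < \<Phi> x" "G i (- x) t = - G i x t"
    if "i \<in> C" "x \<in> U" "x \<in> B i" "t \<in> {0..r i}" for i x t
    using G0 that by (auto simp: B_def odd_deformation_def)
  have Bneg: "- x \<in> B i \<longleftrightarrow> x \<in> B i" for x i
    using dist_minus[of i "- x"] dist_minus[of i x] by (auto simp: B_def)
  have Bopen: "open (B i)" for i by (auto simp: B_def)
  obtain R :: "'a rel" where R: "well_order_on UNIV R" using well_order_on by blast
  have wf: "wf (R - Id)" and tot: "\<And>i j. i \<noteq> j \<Longrightarrow> (i, j) \<in> R \<or> (j, i) \<in> R"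
    using R by (auto simp: well_order_on_def linear_order_on_def total_on_def)
  define \<delta> where "\<delta> = (\<lambda>n. 1 / real (Suc n))"
  have \<delta>: "\<delta> n > 0" for n by (simp add: \<delta>_def)
  define E where "E = (\<lambda>n i. {x\<in>U. ball x (\<delta> n) \<inter> U \<subseteq> B i \<and> (\<forall>j\<in>C. (j, i) \<in> R - Id \<longrightarrow> x \<notin> B j)})"
  have EB: "y \<in> B i" if "x \<in> E n i" "y \<in> U" "dist x y < \<delta> n" for x y n i
    using that by (auto simp: E_def)
  have Eneg: "- x \<in> E n i" if x: "x \<in> E n i" for x n i
  proof -
    have "y \<in> B i" if "y \<in> ball (- x) (\<delta> n)" "y \<in> U" for y
      using EB[OF x sym[OF that(2)]] that dist_minus[of "- x" y] Bneg[of y i] by auto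
    then show ?thesis using x sym Bneg by (auto simp: E_def)
  qed
  have sep: "i = j" if "i \<in> C" "j \<in> C" "x \<in> E n i" "y \<in> E n j" "dist x y < \<delta> n" for i j x y n
  proof (rule ccontr)
    assume "i \<noteq> j"
    then consider "(i, j) \<in> R - Id" | "(j, i) \<in> R - Id" using tot by auto
    then show False
      using that EB[of x n i y] EB[of y n j x] by cases (auto simp: E_def dist_commute)
  qed
  have cover: "\<exists>i\<in>C. \<exists>n. u \<in> E n i" if u: "u \<in> C" for u
  proof -
    have "u \<in> {i\<in>C. u \<in> B i}" using u r by (auto simp: B_def)
    then obtain i where i: "i \<in> C" "u \<in> B i" and least: "\<And>j. (j, i) \<in> R - Id \<Longrightarrow> j \<notin> {i\<in>C. u \<in> B i}"
      using wfE_min[OF wf] by (metis (no_types, lifting) mem_Collect_eq)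
    obtain e where e: "e > 0" "ball u e \<subseteq> B i" using Bopen i open_contains_ball by blast
    obtain n where "\<delta> n < e" using reals_Archimedean[OF e(1)] by (auto simp: \<delta>_def inverse_eq_divide)
    then have "ball u (\<delta> n) \<subseteq> B i" using e by auto
    then have "u \<in> E n i" using u least by (auto simp: E_def C_def)
    then show ?thesis using i by blast
  qed
  define \<phi> where "\<phi> = (\<lambda>n i u. if E n i = {} then 0 else max 0 (min (min (r i) \<rho>) (\<delta> n / 4 - infdist u (E n i))))"
  have \<phi>_cont: "continuous_on S (\<phi> n i)" for n i S
    unfolding \<phi>_def by (cases "E n i = {}") (auto intro!: continuous_intros)
  have \<phi>_range: "\<phi> n i u \<in> {0..r i}" "\<phi> n i u \<le> \<rho>" if "i \<in> C" for n i u
    using r[OF that] \<rho> by (auto simp: \<phi>_def)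
  have \<phi>_neg: "\<phi> n i (- u) = \<phi> n i u" for n i u
    using infdist_uminus[of "E n i" u] Eneg by (auto simp: \<phi>_def)
  have near: "\<exists>x\<in>E n i. dist u x < \<delta> n / 4" if "\<phi> n i u > 0" for n i u
    using that infdist_lessD[of "E n i" u "\<delta> n / 4"] by (auto simp: \<phi>_def split: if_splits)
  have uniq: "i = j" if ij: "i \<in> C" "j \<in> C" "\<phi> n i u > 0" "\<phi> n j w > 0" "dist u w < \<delta> n / 2" for i j n u w
  proof -
    obtain x y where xy: "x \<in> E n i" "dist u x < \<delta> n / 4" "y \<in> E n j" "dist w y < \<delta> n / 4"
      using near ij by blast
    have "dist x y < \<delta> n"
      using dist_triangle[of x y u] dist_triangle[of u y w] xy ij(5) by (simp add: dist_commute)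
    then show ?thesis using sep ij xy by blast
  qed
  have pos_B: "u \<in> B i" if *: "\<phi> n i u > 0" "u \<in> U" for n i u
  proof -
    obtain x where x: "x \<in> E n i" "dist u x < \<delta> n / 4" using near[OF *(1)] by blast
    then show ?thesis using EB[OF x(1) *(2)] \<delta>[of n] by (auto simp: dist_commute)
  qed
  \<comment> \<open>the deformation near the \<open>n\<close>-th layer of a single set of the cover\<close>
  define s where "s = (\<lambda>n i u. if \<phi> n i u > 0 then G i u (\<phi> n i u) else u)"
  have s_cont: "continuous_on U (s n i)" if i: "i \<in> C" for n i
  proof (rule continuous_on_if_locally_eq)
    fix u assume u: "u \<in> U"
    show "\<exists>W g. open W \<and> u \<in> W \<and> continuous_on (U \<inter> W) g \<and> (\<forall>y\<in>U \<inter> W. s n i y = g y)"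
    proof (cases "u \<in> B i")
      case True
      have "continuous_on (U \<inter> B i) (\<lambda>y. case (y, \<phi> n i y) of (x, t) \<Rightarrow> G i x t)"
        by (intro continuous_on_compose2[OF Gc[OF i]] continuous_intros \<phi>_cont) (use \<phi>_range[OF i] in auto)
      moreover have "s n i y = G i y (\<phi> n i y)" if y: "y \<in> U \<inter> B i" for y
      proof (cases "\<phi> n i y > 0")
        case False
        then have "\<phi> n i y = 0" using \<phi>_range[OF i, of n y] by auto
        then show ?thesis using G(2)[of i y 0] y i r[OF i] by (auto simp: s_def)
      qed (simp add: s_def)
      ultimately show ?thesis using Bopen True by (intro exI[of _ "B i"] exI[of _ "\<lambda>y. G i y (\<phi> n i y)"]) auto
    next
      case False
      have "\<not> \<phi> n i y > 0" if y: "y \<in> ball u (\<delta> n / 2)" for y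
      proof
        assume "\<phi> n i y > 0"
        then obtain x where x: "x \<in> E n i" "dist y x < \<delta> n / 4" using near by blast
        then have "dist x u < \<delta> n" using y dist_triangle[of x u y] dist_commute[of x y] dist_commute[of u y] \<delta>[of n]
          by (simp del: divide_less_eq_numeral1 less_divide_eq_numeral1)
        then show False using EB[OF x(1) u] False by blast
      qed
      then show ?thesis using \<delta>[of n]
        by (intro exI[of _ "ball u (\<delta> n / 2)"] exI[of _ "\<lambda>y. y"]) (auto simp: s_def)
    qed
  qed
  define \<eta> where "\<eta> = (\<lambda>n u. if \<exists>i\<in>C. \<phi> n i u > 0 then s n (SOME i. i \<in> C \<and> \<phi> n i u > 0) u else u)"
  have \<eta>_eq: "\<eta> n u = s n i u" if "i \<in> C" "\<phi> n i u > 0" for n i u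
  proof -
    have "(SOME i. i \<in> C \<and> \<phi> n i u > 0) = i"
      using that \<delta>[of n] by (intro some_equality) (auto intro: uniq[of _ _ n u u])
    then show ?thesis using that by (auto simp: \<eta>_def)
  qed
  have \<eta>_id: "\<eta> n u = u" if "\<not> (\<exists>i\<in>C. \<phi> n i u > 0)" for n u
    using that unfolding \<eta>_def by simp
  have \<eta>: "\<eta> n u \<in> U \<and> \<eta> n (- u) = - \<eta> n u \<and> dist (\<eta> n u) u \<le> \<rho> \<and> \<Phi> (\<eta> n u) \<le> \<Phi> u - N u / 8 * dist (\<eta> n u) u"
    if u: "u \<in> U" for n u
  proof (cases "\<exists>i\<in>C. \<phi> n i u > 0")
    case True
    then obtain i where i: "i \<in> C" "\<phi> n i u > 0" by blast
    have *: "\<eta> n u = G i u (\<phi> n i u)" "\<eta> n (- u) = G i (- u) (\<phi> n i u)"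
      using \<eta>_eq[of i n u] \<eta>_eq[of i n "- u"] i by (auto simp: s_def \<phi>_neg)
    note g = G[OF i(1) u pos_B[OF i(2) u] \<phi>_range(1)[OF i(1)]]
    show ?thesis unfolding * using g(1,3) g(5) order_trans[OF g(2) \<phi>_range(2)[OF i(1)]] by blast
  next
    case False
    then show ?thesis using \<eta>_id[of n u] \<eta>_id[of n "- u"] u \<rho> by (auto simp: \<phi>_neg)
  qed
  have \<eta>_cont: "continuous_on U (\<eta> n)" for n
  proof (rule continuous_on_if_locally_eq)
    fix u assume u: "u \<in> U"
    let ?W = "ball u (\<delta> n / 4)"
    show "\<exists>W g. open W \<and> u \<in> W \<and> continuous_on (U \<inter> W) g \<and> (\<forall>y\<in>U \<inter> W. \<eta> n y = g y)"
    proof (cases "\<exists>i\<in>C. \<exists>w\<in>?W. \<phi> n i w > 0")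
      case True
      then obtain i w where i: "i \<in> C" "w \<in> ?W" "\<phi> n i w > 0" by blast
      have "\<eta> n y = s n i y" if y: "y \<in> ?W" for y
      proof (cases "\<exists>j\<in>C. \<phi> n j y > 0")
        case True
        then obtain j where j: "j \<in> C" "\<phi> n j y > 0" by blast
        have "dist w y < \<delta> n / 2" using dist_triangle[of w y u] i(2) y by (auto simp: dist_commute)
        then have "i = j" using uniq i j by blast
        then show ?thesis using \<eta>_eq j by blast
      next
        case False
        then show ?thesis using \<eta>_id[OF False] i by (auto simp: s_def)
      qed
      then show ?thesis using continuous_on_subset[OF s_cont[OF i(1)]] \<delta>[of n]
        by (intro exI[of _ ?W] exI[of _ "s n i"]) auto
    next
      case False
      then have "\<eta> n y = y" if "y \<in> ?W" for y using \<eta>_id[of n y] that by blast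
      then show ?thesis using \<delta>[of n] by (intro exI[of _ ?W] exI[of _ "\<lambda>y. y"]) auto
    qed
  qed
  have \<eta>_strict: "\<exists>n. \<Phi> (\<eta> n u) < \<Phi> u" if u: "u \<in> U" "N u > 0" for u
  proof -
    obtain i n where i: "i \<in> C" "u \<in> E n i" using cover[of u] u by (auto simp: C_def)
    then have "\<phi> n i u > 0" using r[OF i(1)] \<rho> \<delta>[of n] by (auto simp: \<phi>_def)
    then have "\<Phi> (\<eta> n u) < \<Phi> u" using \<eta>_eq[OF i(1)] G(4)[OF i(1) u(1) pos_B \<phi>_range(1)[OF i(1)]] u
      by (simp add: s_def)
    then show ?thesis by blast
  qed
  show ?thesis using \<eta>_cont \<eta> \<eta>_strict unfolding odd_descent_maps_def by blast
qed

section \<open>Trajectories, genus and critical values\<close>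

text \<open>
  The set \<open>A\<close> has Krasnoselskii genus at most \<open>n\<close>: there is an odd continuous map from \<open>A\<close> to
  \<open>\<real>\<^sup>n\<close> without zeros, here given by its components.
\<close>

definition genus_le :: "'a::real_normed_vector set \<Rightarrow> nat \<Rightarrow> bool" where
  "genus_le A n \<longleftrightarrow> (\<exists>f :: nat \<Rightarrow> 'a \<Rightarrow> real.
     (\<forall>i<n. continuous_on A (f i) \<and> (\<forall>x\<in>A. f i (- x) = - f i x)) \<and> (\<forall>x\<in>A. \<exists>i<n. f i x \<noteq> 0))"

text \<open>
  A chain is a sequence below the level \<open>\<beta>\<close> with \<open>N \<rightarrow> 0\<close> whose steps are smaller than \<open>\<mu>\<close> and
  bounded away from 0.
\<close>

definition no_chains :: "'a::metric_space set \<Rightarrow> ('a \<Rightarrow> real) \<Rightarrow> ('a \<Rightarrow> real) \<Rightarrow> real \<Rightarrow> real \<Rightarrow> bool" where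
  "no_chains U \<Phi> N \<beta> \<mu> \<longleftrightarrow> (\<forall>z e. e > 0 \<longrightarrow>
     (\<forall>n. z n \<in> U \<and> \<Phi> (z n) \<le> \<beta> \<and> e \<le> dist (z n) (z (Suc n)) \<and> dist (z n) (z (Suc n)) < \<mu>) \<longrightarrow>
     \<not> (\<lambda>n. N (z n)) \<longlonglongrightarrow> 0)"

lemma no_chains_mono: "no_chains U \<Phi> N \<beta>' \<mu> \<Longrightarrow> \<beta> \<le> \<beta>' \<Longrightarrow> no_chains U \<Phi> N \<beta> \<mu>"
  unfolding no_chains_def by (meson order_trans)

text \<open>
  A symmetric set \<open>U\<close> with an even function \<open>\<Phi>\<close>, an even slope \<open>N\<close>, and odd descending maps
  \<open>\<eta> n\<close>. Below the level \<open>\<beta>\<close> there are no chains, that is, no sequences with \<open>N \<rightarrow> 0\<close> whose steps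
  are smaller than \<open>\<mu>\<close> and bounded away from zero. The maps move points by at most \<open>\<mu>/8\<close>.
\<close>

locale descent_system =
  fixes U :: "'a::real_normed_vector set" and \<Phi> N :: "'a \<Rightarrow> real" and \<beta> \<mu> m :: real
    and \<eta> :: "nat \<Rightarrow> 'a \<Rightarrow> 'a"
  assumes sym: "u \<in> U \<Longrightarrow> - u \<in> U" and zero: "0 \<notin> U"
    and \<Phi>_even: "u \<in> U \<Longrightarrow> \<Phi> (- u) = \<Phi> u" and N_even: "u \<in> U \<Longrightarrow> N (- u) = N u"
    and N_nonneg: "u \<in> U \<Longrightarrow> 0 \<le> N u"
    and cont_\<Phi>: "continuous_on U \<Phi>" and bounded_below: "u \<in> U \<Longrightarrow> m \<le> \<Phi> u"
    and complete: "(\<And>n. z n \<in> U) \<Longrightarrow> (\<And>n. \<Phi> (z n) \<le> \<beta>) \<Longrightarrow> Cauchy z \<Longrightarrow> \<exists>l\<in>U. z \<longlonglongrightarrow> l"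
    and \<mu>: "\<mu> > 0"
    and no_chains: "no_chains U \<Phi> N \<beta> \<mu>"
    and descent_maps: "odd_descent_maps U \<Phi> N (\<mu> / 8) \<eta>"
begin

lemma \<eta>_cont: "continuous_on U (\<eta> n)"
  and \<eta>_in: "u \<in> U \<Longrightarrow> \<eta> n u \<in> U"
  and \<eta>_odd: "u \<in> U \<Longrightarrow> \<eta> n (- u) = - \<eta> n u"
  and \<eta>_dist: "u \<in> U \<Longrightarrow> dist (\<eta> n u) u \<le> \<mu> / 8"
  and \<eta>_descent: "u \<in> U \<Longrightarrow> \<Phi> (\<eta> n u) \<le> \<Phi> u - N u / 8 * dist (\<eta> n u) u"
  and \<eta>_strict: "u \<in> U \<Longrightarrow> N u > 0 \<Longrightarrow> \<exists>n. \<Phi> (\<eta> n u) < \<Phi> u"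
  using descent_maps unfolding odd_descent_maps_def by blast+

lemma no_chain: "e > 0 \<Longrightarrow> (\<And>n. z n \<in> U \<and> \<Phi> (z n) \<le> \<beta> \<and> e \<le> dist (z n) (z (Suc n)) \<and> dist (z n) (z (Suc n)) < \<mu>)
    \<Longrightarrow> \<not> (\<lambda>n. N (z n)) \<longlonglongrightarrow> 0"
  using no_chains unfolding no_chains_def by blast

text \<open>
  A descending sequence with small steps converges. Otherwise it oscillates, and on a stretch of
  a fixed length the slope must become small, because the total decrease of \<open>\<Phi>\<close> is finite. One
  such point from each stretch gives a chain with \<open>N \<rightarrow> 0\<close> whose steps do not tend to zero.
\<close>

lemma descending_Cauchy:
  assumes u: "\<And>k. u k \<in> U" "\<And>k. \<Phi> (u k) \<le> \<beta>" "\<And>k. dist (u (Suc k)) (u k) \<le> \<mu> / 8"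
    "\<And>k. \<Phi> (u (Suc k)) \<le> \<Phi> (u k) - N (u k) / 8 * dist (u (Suc k)) (u k)"
  shows "Cauchy u"
proof (rule ccontr)
  assume "\<not> Cauchy u"
  then obtain e0 where e0: "e0 > 0" "\<And>K. \<exists>k\<ge>K. \<exists>j\<ge>K. \<not> dist (u k) (u j) < e0"
    unfolding Cauchy_def by blast
  define e where "e = min (e0 / 2) (\<mu> / 4)"
  have e: "e > 0" "e \<le> e0 / 2" "e \<le> \<mu> / 4" using e0 \<mu> by (auto simp: e_def)
  have far: "\<exists>j\<ge>k. e \<le> dist (u k) (u j)" for k
  proof (rule ccontr)
    assume a: "\<not> ?thesis"
    obtain i j where "i \<ge> k" "j \<ge> k" "\<not> dist (u i) (u j) < e0" using e0(2) by blast
    moreover have "dist (u k) (u i) < e" "dist (u k) (u j) < e" using a calculation by force+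
    ultimately show False using dist_triangle[of "u i" "u j" "u k"] e by (simp add: dist_commute)
  qed
  have "decseq (\<lambda>k. \<Phi> (u k))"
    unfolding decseq_Suc_iff using u(4) N_nonneg[OF u(1)]
    by (smt (verit) mult_nonneg_nonneg zero_le_dist divide_nonneg_pos)
  then obtain a where lim: "(\<lambda>k. \<Phi> (u k)) \<longlonglongrightarrow> a" and a: "\<And>k. a \<le> \<Phi> (u k)"
    using decseq_convergent[of "\<lambda>k. \<Phi> (u k)" m] bounded_below u(1) by blast
  have mono: "\<Phi> (u l) \<le> \<Phi> (u k)" if "k \<le> l" for k l
    using \<open>decseq _\<close> that by (auto simp: decseq_def)
  have "\<exists>i>k. e / 2 \<le> dist (u k) (u i) \<and> dist (u k) (u i) < \<mu> \<and>
      N (u i) \<le> 16 * (\<Phi> (u k) - a + 1 / real (Suc k)) / e" for k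
  proof -
    define j where "j = (LEAST j. j \<ge> k \<and> e \<le> dist (u k) (u j))"
    have j: "j \<ge> k" "e \<le> dist (u k) (u j)"
      using LeastI_ex[OF far[of k, unfolded Bex_def]] by (auto simp: j_def)
    have jleast: "dist (u k) (u i) < e" if "k \<le> i" "i < j" for i
      using not_less_Least[of i "\<lambda>j. j \<ge> k \<and> e \<le> dist (u k) (u j)"] that by (auto simp: j_def)
    have "j > k" using j e by (cases "j = k") auto
    then obtain j' where j': "j = Suc j'" "k \<le> j'" by (cases j) auto
    have "dist (u k) (u j) < e + \<mu> / 8"
      using jleast[of j'] dist_triangle[of "u k" "u j" "u j'"] u(3)[of j'] j' by (simp add: dist_commute)
    define l where "l = (LEAST l. l \<ge> j \<and> e / 2 \<le> dist (u j) (u l))"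
    have "\<exists>l\<ge>j. e / 2 \<le> dist (u j) (u l)" using far[of j] e by force
    then have l: "l \<ge> j" "e / 2 \<le> dist (u j) (u l)"
      using LeastI_ex[of "\<lambda>l. l \<ge> j \<and> e / 2 \<le> dist (u j) (u l)"] by (auto simp: l_def)
    have lleast: "dist (u j) (u i) < e / 2" if "j \<le> i" "i < l" for i
      using not_less_Least[of i "\<lambda>l. l \<ge> j \<and> e / 2 \<le> dist (u j) (u l)"] that by (auto simp: l_def)
    define X where "X = 16 * (\<Phi> (u k) - a + 1 / real (Suc k)) / e"
    have "\<exists>i. j \<le> i \<and> i < l \<and> N (u i) \<le> X"
    proof (rule ccontr)
      assume neg: "\<not> ?thesis"
      have X0: "X \<ge> 0" using a[of k] e by (simp add: X_def)
      have "i \<le> l \<Longrightarrow> X / 8 * dist (u j) (u i) \<le> \<Phi> (u j) - \<Phi> (u i)" if "j \<le> i" for i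
        using that
      proof (induction rule: dec_induct)
        case (step i)
        have "X \<le> N (u i)" using neg step.hyps(1) step.prems by (metis Suc_le_lessD linear)
        then have "X / 8 * dist (u (Suc i)) (u i) \<le> N (u i) / 8 * dist (u (Suc i)) (u i)"
          by (intro mult_right_mono) auto
        moreover have "X / 8 * dist (u j) (u (Suc i)) \<le> X / 8 * (dist (u j) (u i) + dist (u (Suc i)) (u i))"
          using X0 dist_triangle[of "u j" "u (Suc i)" "u i"] by (intro mult_left_mono) (auto simp: dist_commute)
        ultimately show ?case using step u(4)[of i] by (simp add: distrib_left)
      qed simp
      then have "X / 8 * dist (u j) (u l) \<le> \<Phi> (u j) - \<Phi> (u l)" using l by blast
      moreover have "X / 8 * (e / 2) \<le> X / 8 * dist (u j) (u l)" using l X0 by (intro mult_left_mono) auto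
      moreover have "X / 8 * (e / 2) = \<Phi> (u k) - a + 1 / real (Suc k)" using e by (simp add: X_def)
      moreover have "1 / real (Suc k) > 0" by simp
      ultimately show False using mono[OF j(1)] a[of l] by linarith
    qed
    then obtain i where i: "j \<le> i" "i < l" "N (u i) \<le> X" by blast
    have "dist (u j) (u i) < e / 2" using lleast i by blast
    then have "e / 2 \<le> dist (u k) (u i)" "dist (u k) (u i) < \<mu>"
      using j(2) \<open>dist (u k) (u j) < e + \<mu> / 8\<close> e dist_triangle[of "u k" "u j" "u i"]
        dist_triangle[of "u k" "u i" "u j"] by (auto simp: dist_commute)
    moreover have "k < i" using i \<open>j > k\<close> by linarith
    ultimately show ?thesis using i(3) unfolding X_def by blast
  qed
  then obtain nxt where nxt: "\<And>k. k < nxt k" "\<And>k. e / 2 \<le> dist (u k) (u (nxt k))" "\<And>k. dist (u k) (u (nxt k)) < \<mu>"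
      "\<And>k. N (u (nxt k)) \<le> 16 * (\<Phi> (u k) - a + 1 / real (Suc k)) / e"
    by metis
  define i where "i = rec_nat 0 (\<lambda>_. nxt)"
  have i: "i (Suc n) = nxt (i n)" for n by (simp add: i_def)
  have "strict_mono i" using nxt(1) by (auto simp: strict_mono_Suc_iff i)
  have "(\<lambda>k. 16 * (\<Phi> (u k) - a + 1 / real (Suc k)) / e) \<longlonglongrightarrow> 16 * (a - a + 0) / e"
    using e by (intro tendsto_intros lim LIMSEQ_Suc[OF lim_1_over_n]) auto
  then have "((\<lambda>k. 16 * (\<Phi> (u k) - a + 1 / real (Suc k)) / e) \<circ> i) \<longlonglongrightarrow> 0"
    using LIMSEQ_subseq_LIMSEQ[OF _ \<open>strict_mono i\<close>] by force
  then have "(\<lambda>n. N (u (i (Suc n)))) \<longlonglongrightarrow> 0"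
    by (rule tendsto_sandwich[OF _ _ tendsto_const, rotated 2])
      (use nxt(4) N_nonneg u(1) i in auto)
  then have "(\<lambda>n. N (u (i n))) \<longlonglongrightarrow> 0" by (simp add: filterlim_sequentially_Suc[of "\<lambda>n. N (u (i n))"])
  moreover have "\<not> (\<lambda>n. N (u (i n))) \<longlonglongrightarrow> 0"
    by (rule no_chain[of "e / 2"]) (use e u nxt i in auto)
  ultimately show False by blast
qed

text \<open>
  The composition of the maps \<open>\<eta> n\<close>, in an order in which each of them occurs infinitely often.
\<close>

primrec h :: "nat \<Rightarrow> 'a \<Rightarrow> 'a" where
  "h 0 u = u"
| "h (Suc k) u = \<eta> (fst (prod_decode k)) (h k u)"

lemma h_in: "u \<in> U \<Longrightarrow> h k u \<in> U"
  by (induction k) (auto simp: \<eta>_in)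

lemma h_odd: "u \<in> U \<Longrightarrow> h k (- u) = - h k u"
  by (induction k) (auto simp: \<eta>_odd h_in)

lemma h_cont: "continuous_on U (h k)"
proof (induction k)
  case (Suc k)
  have "continuous_on U (\<lambda>u. \<eta> (fst (prod_decode k)) (h k u))"
    by (rule continuous_on_compose2[OF \<eta>_cont Suc]) (auto simp: h_in)
  then show ?case by simp
qed simp

lemma h_step: "u \<in> U \<Longrightarrow> dist (h (Suc k) u) (h k u) \<le> \<mu> / 8"
  using \<eta>_dist[OF h_in] by simp

lemma h_descent: "u \<in> U \<Longrightarrow> \<Phi> (h (Suc k) u) \<le> \<Phi> (h k u) - N (h k u) / 8 * dist (h (Suc k) u) (h k u)"
  using \<eta>_descent[OF h_in] by simp

lemma h_mono:
  assumes "u \<in> U" "k \<le> l"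
  shows "\<Phi> (h l u) \<le> \<Phi> (h k u)"
  using assms(2)
proof (induction rule: dec_induct)
  case (step l)
  have "0 \<le> N (h l u) / 8 * dist (h (Suc l) u) (h l u)" using N_nonneg h_in[OF assms(1)] by auto
  then show ?case using h_descent[OF assms(1), of l] step by linarith
qed simp

lemma h_le: "u \<in> U \<Longrightarrow> \<Phi> (h k u) \<le> \<Phi> u"
  using h_mono[of u 0 k] by simp

text \<open>The limit of the trajectory of \<open>u\<close>, meaningful only if the trajectory converges.\<close>

definition p :: "'a \<Rightarrow> 'a" where "p u = lim (\<lambda>k. h k u)"

text \<open>The critical points up to the level \<open>\<beta>\<close>.\<close>

definition crit :: "'a set" where "crit = {u\<in>U. N u = 0 \<and> \<Phi> u \<le> \<beta>}"

lemma h_limit: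
  assumes u: "u \<in> U" "\<Phi> u \<le> \<beta>"
  shows "(\<lambda>k. h k u) \<longlonglongrightarrow> p u" "p u \<in> U" "(\<lambda>k. \<Phi> (h k u)) \<longlonglongrightarrow> \<Phi> (p u)"
proof -
  have le: "\<Phi> (h k u) \<le> \<beta>" for k using h_le[OF u(1), of k] u(2) by linarith
  have "Cauchy (\<lambda>k. h k u)"
    by (rule descending_Cauchy) (use u h_in le h_step h_descent in auto)
  then obtain l where "l \<in> U" "(\<lambda>k. h k u) \<longlonglongrightarrow> l" using complete[of "\<lambda>k. h k u"] h_in[OF u(1)] le by blast
  then show *: "(\<lambda>k. h k u) \<longlonglongrightarrow> p u" "p u \<in> U" by (auto simp: p_def limI)
  show "(\<lambda>k. \<Phi> (h k u)) \<longlonglongrightarrow> \<Phi> (p u)"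
    using cont_\<Phi> * h_in[OF u(1)] by (auto simp: continuous_on_sequentially comp_def)
qed

lemma \<Phi>_limit_le:
  assumes "u \<in> U" "\<Phi> u \<le> \<beta>"
  shows "\<Phi> (p u) \<le> \<Phi> (h k u)"
  using LIMSEQ_le_const2[OF h_limit(3)[OF assms]] h_mono[OF assms(1)] by blast

text \<open>
  Were the limit not critical, some \<open>\<eta> n\<close> would move it, and by continuity also late points of
  the trajectory, strictly below its level; but \<open>\<eta> n\<close> is applied infinitely often.
\<close>

lemma limit_crit:
  assumes u: "u \<in> U" "\<Phi> u \<le> \<beta>"
  shows "p u \<in> crit"
proof -
  note l = h_limit[OF u]
  have "N (p u) = 0"
  proof (rule ccontr)
    assume "N (p u) \<noteq> 0"
    then obtain n where n: "\<Phi> (\<eta> n (p u)) < \<Phi> (p u)" using \<eta>_strict[OF l(2)] N_nonneg[OF l(2)] by force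
    have "continuous_on U (\<lambda>w. \<Phi> (\<eta> n w))" by (rule continuous_on_compose2[OF cont_\<Phi> \<eta>_cont]) (auto simp: \<eta>_in)
    then have "(\<lambda>k. \<Phi> (\<eta> n (h k u))) \<longlonglongrightarrow> \<Phi> (\<eta> n (p u))"
      using l h_in[OF u(1)] by (auto simp: continuous_on_sequentially comp_def)
    then have "\<forall>\<^sub>F k in sequentially. \<Phi> (\<eta> n (h k u)) < \<Phi> (p u)" using n by (rule order_tendstoD)
    then obtain k0 where k0: "\<And>k. k \<ge> k0 \<Longrightarrow> \<Phi> (\<eta> n (h k u)) < \<Phi> (p u)" by (auto simp: eventually_sequentially)
    define k where "k = prod_encode (n, k0)"
    have "\<Phi> (h (Suc k) u) < \<Phi> (p u)" using k0[of k] le_prod_encode_2[of k0 n] by (simp add: k_def)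
    then show False using \<Phi>_limit_le[OF u, of "Suc k"] by linarith
  qed
  then show ?thesis using l \<Phi>_limit_le[OF u, of 0] u(2) by (auto simp: crit_def)
qed

lemma limit_value: "u \<in> U \<Longrightarrow> \<Phi> u \<le> \<beta> \<Longrightarrow> \<Phi> u < b \<Longrightarrow> \<Phi> (p u) \<in> {v \<in> \<Phi> ` crit. v < b}"
  using limit_crit[of u] \<Phi>_limit_le[of u 0] by fastforce

lemma p_odd:
  assumes "u \<in> U" "\<Phi> u \<le> \<beta>"
  shows "p (- u) = - p u"
proof -
  have "(\<lambda>k. h k (- u)) \<longlonglongrightarrow> - p u" using tendsto_minus[OF h_limit(1)[OF assms]] h_odd[OF assms(1)] by simp
  then show ?thesis by (simp add: p_def limI)
qed

text \<open>
  Away from a critical point, but not too far from it, the slope is bounded below: otherwise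
  sequences that jump to and fro between the critical point and almost critical points would
  be chains.
\<close>

lemma slope_annulus:
  assumes q: "q \<in> crit" and e: "e > 0"
  obtains \<kappa> where "\<kappa> > 0" "\<And>z. z \<in> U \<Longrightarrow> \<Phi> z \<le> \<beta> \<Longrightarrow> e \<le> dist z q \<Longrightarrow> dist z q < \<mu> \<Longrightarrow> \<kappa> \<le> N z"
proof (rule ccontr)
  assume "\<not> thesis"
  then have "\<forall>n. \<exists>z. z \<in> U \<and> \<Phi> z \<le> \<beta> \<and> e \<le> dist z q \<and> dist z q < \<mu> \<and> N z < 1 / real (Suc n)"
    using that by (metis not_le of_nat_0_less_iff zero_less_Suc zero_less_divide_1_iff)
  then obtain z where z: "\<And>n. z n \<in> U" "\<And>n. \<Phi> (z n) \<le> \<beta>" "\<And>n. e \<le> dist (z n) q" "\<And>n. dist (z n) q < \<mu>"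
      "\<And>n. N (z n) < 1 / real (Suc n)" by metis
  define w where "w = (\<lambda>n. if even n then q else z n)"
  have "(\<lambda>n. N (w n)) \<longlonglongrightarrow> 0"
    by (rule tendsto_sandwich[OF _ _ tendsto_const LIMSEQ_Suc[OF lim_1_over_n]])
      (use z(1) q N_nonneg less_imp_le[OF z(5)] in \<open>auto simp: w_def crit_def\<close>)
  moreover have "\<not> (\<lambda>n. N (w n)) \<longlonglongrightarrow> 0"
    by (rule no_chain[OF e]) (use z q in \<open>auto simp: w_def crit_def dist_commute\<close>)
  ultimately show False by blast
qed

lemma crit_separated:
  assumes "q \<in> crit" "q' \<in> crit" "dist q q' < \<mu>"
  shows "q = q'"
proof (rule ccontr)
  assume "q \<noteq> q'"
  then obtain \<kappa> where "\<kappa> > 0" "\<And>z. z \<in> U \<Longrightarrow> \<Phi> z \<le> \<beta> \<Longrightarrow> dist q q' \<le> dist z q' \<Longrightarrow> dist z q' < \<mu> \<Longrightarrow> \<kappa> \<le> N z"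
    using slope_annulus[OF assms(2), of "dist q q'"] by auto
  from this(1) this(2)[of q] show False using assms by (auto simp: crit_def)
qed

text \<open>
  Let \<open>c\<close> be at least the level of \<open>p x\<close>. Trajectories from points near \<open>x\<close> come close to \<open>p x\<close> at a
  level just above \<open>c\<close>. If they never fall below \<open>c\<close>, the energy that is left to them does not suffice
  to cross an annulus around \<open>p x\<close>.
\<close>

lemma limit_locally_constant:
  assumes x: "x \<in> U" "\<Phi> x \<le> \<beta>" and c: "\<Phi> (p x) \<le> c"
    and y: "\<And>j. y j \<in> U" "\<And>j. \<Phi> (y j) \<le> \<beta>" "\<And>j k. c \<le> \<Phi> (h k (y j))" and lim: "y \<longlonglongrightarrow> x"
  shows "\<forall>\<^sub>F j in sequentially. p (y j) = p x"
proof -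
  define q where "q = p x"
  have q: "q \<in> crit" using limit_crit[OF x] by (simp add: q_def)
  obtain \<kappa> where \<kappa>: "\<kappa> > 0" "\<And>z. z \<in> U \<Longrightarrow> \<Phi> z \<le> \<beta> \<Longrightarrow> \<mu> / 8 \<le> dist z q \<Longrightarrow> dist z q < \<mu> \<Longrightarrow> \<kappa> \<le> N z"
    using slope_annulus[OF q, of "\<mu> / 8"] \<mu> by auto
  define \<epsilon> where "\<epsilon> = \<kappa> / 8 * (\<mu> / 8)"
  have \<epsilon>: "\<epsilon> > 0" using \<kappa> \<mu> by (simp add: \<epsilon>_def)
  have "\<forall>\<^sub>F k in sequentially. dist (h k x) q < \<mu> / 8"
    unfolding q_def by (rule tendstoD[OF h_limit(1)[OF x]]) (use \<mu> in simp)
  moreover have "\<forall>\<^sub>F k in sequentially. \<Phi> (h k x) < c + \<epsilon>"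
    using h_limit(3)[OF x] c \<epsilon> by (intro order_tendstoD(2)) (auto simp: q_def)
  ultimately have "\<forall>\<^sub>F k in sequentially. dist (h k x) q < \<mu> / 8 \<and> \<Phi> (h k x) < c + \<epsilon>" by (rule eventually_conj)
  then obtain k where k: "dist (h k x) q < \<mu> / 8" "\<Phi> (h k x) < c + \<epsilon>"
    by (auto simp: eventually_sequentially)
  have hk: "(\<lambda>j. h k (y j)) \<longlonglongrightarrow> h k x"
    using h_cont[of k] lim x(1) y(1) by (auto simp: continuous_on_sequentially comp_def)
  have "(\<lambda>j. \<Phi> (h k (y j))) \<longlonglongrightarrow> \<Phi> (h k x)"
    using cont_\<Phi> hk h_in x(1) y(1) by (auto simp: continuous_on_sequentially comp_def)
  then have "\<forall>\<^sub>F j in sequentially. \<Phi> (h k (y j)) < c + \<epsilon>" using k by (auto intro: order_tendstoD(2))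
  moreover have "\<forall>\<^sub>F j in sequentially. dist (h k (y j)) q < \<mu> / 8"
    using k(1) by (rule order_tendstoD(2)[OF tendsto_dist[OF hk tendsto_const]])
  ultimately show ?thesis
  proof eventually_elim
    case (elim j)
    define d where "d = (\<lambda>l. dist (h l (y j)) q)"
    \<comment> \<open>the energy bound holds as long as the trajectory stays in the ball of radius \<open>\<mu>/2\<close>, and keeps it there\<close>
    have "d l < \<mu> / 2 \<and> \<kappa> / 8 * (d l - \<mu> / 4) \<le> \<Phi> (h k (y j)) - \<Phi> (h l (y j))" if "k \<le> l" for l
      using that
    proof (induction rule: dec_induct)
      case base
      have "\<kappa> / 8 * (d k - \<mu> / 4) \<le> 0" using \<kappa> elim \<mu> by (intro mult_nonneg_nonpos) (auto simp: d_def)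
      then show ?case using elim \<mu> by (auto simp: d_def)
    next
      case (step l)
      have d: "d (Suc l) \<le> d l + dist (h (Suc l) (y j)) (h l (y j))"
        using dist_triangle[of "h (Suc l) (y j)" q "h l (y j)"] by (simp add: d_def)
      have main: "\<kappa> / 8 * (d (Suc l) - \<mu> / 4) \<le> \<Phi> (h k (y j)) - \<Phi> (h (Suc l) (y j))"
      proof (cases "d l < \<mu> / 8")
        case True
        then have "d (Suc l) - \<mu> / 4 \<le> 0" using d h_step[OF y(1), of l j] by simp
        then have "\<kappa> / 8 * (d (Suc l) - \<mu> / 4) \<le> 0" using \<kappa> by (intro mult_nonneg_nonpos) auto
        also have "\<dots> \<le> \<Phi> (h k (y j)) - \<Phi> (h (Suc l) (y j))" using h_mono[OF y(1), of k "Suc l"] step by simp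
        finally show ?thesis .
      next
        case False
        have "\<kappa> \<le> N (h l (y j))"
          using False step \<mu> h_in[OF y(1)] h_le[OF y(1), of l j] y(2)[of j] by (intro \<kappa>(2)) (auto simp: d_def)
        then have "\<kappa> / 8 * dist (h (Suc l) (y j)) (h l (y j)) \<le> N (h l (y j)) / 8 * dist (h (Suc l) (y j)) (h l (y j))"
          by (intro mult_right_mono) auto
        moreover have "\<kappa> / 8 * (d (Suc l) - \<mu> / 4) \<le> \<kappa> / 8 * ((d l - \<mu> / 4) + dist (h (Suc l) (y j)) (h l (y j)))"
          using \<kappa> d by (intro mult_left_mono) auto
        ultimately show ?thesis using h_descent[OF y(1), of l j] step by (simp add: distrib_left del: h.simps)
      qed
      then have "\<kappa> / 8 * (d (Suc l) - \<mu> / 4) < \<kappa> / 8 * (\<mu> / 8)"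
        using elim y(3)[where k = "Suc l" and j = j] by (simp add: \<epsilon>_def del: h.simps)
      then have "d (Suc l) - \<mu> / 4 < \<mu> / 8" using \<kappa> by (subst (asm) mult_less_cancel_left_pos) auto
      then show ?case using main \<mu> by auto
    qed
    then have "\<forall>l\<ge>k. dist (h l (y j)) q \<le> \<mu> / 2" by (auto simp: d_def intro: less_imp_le)
    then have "dist (p (y j)) q \<le> \<mu> / 2"
      by (intro LIMSEQ_le_const2[OF tendsto_dist[OF h_limit(1)[OF y(1,2)] tendsto_const]]) blast
    then show "p (y j) = p x"
      using crit_separated[OF limit_crit[OF y(1,2)] q] \<mu> by (simp add: q_def)
  qed
qed

text \<open>
  The genus is bounded by the number of critical values. By induction on the number of critical
  values below \<open>b\<close>, the largest of which is \<open>c\<close>: the points of \<open>A\<close> that do not come below \<open>c\<close>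
  converge to critical points of level \<open>c\<close>. These are isolated, so their limits depend locally
  constantly on the point, which gives one odd function \<open>f\<close> without zeros on this part of \<open>A\<close>.
  The set \<open>{|f| \<le> \<delta>}\<close> is carried below \<open>c\<close> in finitely many steps.
\<close>

lemma genus_le_card_critical_values:
  assumes fin: "finite (\<Phi> ` crit)"
  shows "compact A \<Longrightarrow> A \<subseteq> U \<Longrightarrow> (\<And>x. x \<in> A \<Longrightarrow> - x \<in> A) \<Longrightarrow> (\<And>x. x \<in> A \<Longrightarrow> \<Phi> x \<le> \<beta> \<and> \<Phi> x < b)
     \<Longrightarrow> card {v \<in> \<Phi> ` crit. v < b} \<le> n \<Longrightarrow> genus_le A n"
proof (induction n arbitrary: A b)
  case (0 A b)
  have "{v \<in> \<Phi> ` crit. v < b} = {}" using 0(5) fin by simp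
  then have "A = {}" using limit_value 0(2,4) by blast
  then show ?case by (simp add: genus_le_def)
next
  case (Suc n A b)
  have AU: "x \<in> U" "\<Phi> x \<le> \<beta>" "\<Phi> x < b" "- x \<in> A" if "x \<in> A" for x using that Suc.prems by auto
  define V where "V = {v \<in> \<Phi> ` crit. v < b}"
  have finV: "finite V" using fin by (simp add: V_def)
  show ?case
  proof (cases "V = {}")
    case True
    then have "A = {}" using limit_value[OF AU(1-3)] unfolding V_def by blast
    then show ?thesis by (simp add: genus_le_def)
  next
    case False
    define c where "c = Max V"
    have c: "c \<in> V" "\<And>v. v \<in> V \<Longrightarrow> v \<le> c" using finV False by (auto simp: c_def)
    have "{v \<in> \<Phi> ` crit. v < c} \<subseteq> V - {c}" using c by (auto simp: V_def)
    then have "card {v \<in> \<Phi> ` crit. v < c} \<le> card (V - {c})" using finV by (intro card_mono) auto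
    also have "\<dots> \<le> n" using Suc.prems(5) c finV by (simp add: V_def[symmetric])
    finally have cardc: "card {v \<in> \<Phi> ` crit. v < c} \<le> n" .
    define B where "B = {x\<in>A. \<forall>k. c \<le> \<Phi> (h k x)}"
    have pB: "\<Phi> (p x) = c" "p x \<in> crit" if "x \<in> B" for x
    proof -
      have x: "x \<in> A" and ge: "\<And>k. c \<le> \<Phi> (h k x)" using that by (auto simp: B_def)
      show "p x \<in> crit" using limit_crit AU x by blast
      have "c \<le> \<Phi> (p x)" using LIMSEQ_le_const[OF h_limit(3)] AU x ge by blast
      moreover have "\<Phi> (p x) < b" using \<Phi>_limit_le[of x 0] AU[OF x] by auto
      ultimately show "\<Phi> (p x) = c" using c(2)[of "\<Phi> (p x)"] \<open>p x \<in> crit\<close> by (auto simp: V_def intro: antisym)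
    qed
    have Blim: "x \<in> B" if x: "x \<in> A" and y: "\<And>j. y j \<in> A" "y \<longlonglongrightarrow> x" "\<And>k. \<forall>\<^sub>F j in sequentially. c \<le> \<Phi> (h k (y j))" for x y
    proof -
      have "c \<le> \<Phi> (h k x)" for k
      proof -
        have "continuous_on U (\<lambda>w. \<Phi> (h k w))"
          by (rule continuous_on_compose2[OF cont_\<Phi> h_cont]) (auto simp: h_in)
        then have "(\<lambda>j. \<Phi> (h k (y j))) \<longlonglongrightarrow> \<Phi> (h k x)"
          using y AU x by (auto simp: continuous_on_sequentially comp_def)
        then show ?thesis using y(3) by (intro tendsto_lowerbound) auto
      qed
      then show ?thesis using x by (auto simp: B_def)
    qed
    have closed_B: "closed {x\<in>B. p x \<in> Q}" for Q
      unfolding closed_sequential_limits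
    proof (intro allI impI, elim conjE)
      fix y x assume y: "\<forall>n. y n \<in> {x\<in>B. p x \<in> Q}" and lim: "y \<longlonglongrightarrow> x"
      have yA: "y n \<in> A" for n using y by (auto simp: B_def)
      then have xA: "x \<in> A" using compact_imp_closed[OF Suc.prems(1)] lim by (auto simp: closed_sequential_limits)
      have "x \<in> B" by (rule Blim[OF xA yA lim]) (use y in \<open>auto simp: B_def\<close>)
      have "\<forall>\<^sub>F j in sequentially. p (y j) = p x"
        by (rule limit_locally_constant[of _ c]) (use AU yA xA lim pB[OF \<open>x \<in> B\<close>] y in \<open>auto simp: B_def\<close>)
      then obtain j where "p (y j) = p x" by (auto simp: eventually_sequentially)
      then show "x \<in> {x\<in>B. p x \<in> Q}" using \<open>x \<in> B\<close> y[rule_format, of j] by simp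
    qed
    have BA: "x \<in> A" "x \<in> U" "\<Phi> x \<le> \<beta>" if "x \<in> B" for x using that AU by (auto simp: B_def)
    have Bneg: "- x \<in> B" "p (- x) = - p x" if x: "x \<in> B" for x
      using x AU p_odd[of x] h_in[of x] by (auto simp: B_def h_odd \<Phi>_even)
    \<comment> \<open>a choice of one point from each pair \<open>{q, -q}\<close>\<close>
    define Q where "Q = {q :: 'a. q = (SOME q'. q' \<in> {q, - q})}"
    have Q: "- q \<in> Q \<longleftrightarrow> q \<notin> Q" if "q \<noteq> 0" for q
    proof -
      have "{- q, - (- q)} = {q, - q}" by auto
      then have "(SOME q'. q' \<in> {- q, - (- q)}) = (SOME q'. q' \<in> {q, - q})" by (simp only:)
      moreover have "(SOME q'. q' \<in> {q, - q}) \<in> {q, - q}" by (rule someI[of _ q]) simp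
      moreover have "q \<noteq> - q"
      proof
        assume "q = - q"
        then have "2 *\<^sub>R q = 0" by (simp add: scaleR_2 eq_neg_iff_add_eq_0)
        then show False using that by simp
      qed
      ultimately show ?thesis unfolding Q_def mem_Collect_eq by (metis insertE singletonD)
    qed
    have pnz: "p x \<noteq> 0" if "x \<in> B" for x using pB[OF that] zero by (auto simp: crit_def)
    define Bp where "Bp = {x\<in>B. p x \<in> Q}"
    define Bm where "Bm = {x\<in>B. p x \<in> - Q}"
    have cl: "closed Bp" "closed Bm" unfolding Bp_def Bm_def by (rule closed_B)+
    have Bm_iff: "- x \<in> Bm \<longleftrightarrow> x \<in> Bp" for x
      using Bneg[of x] Bneg[of "- x"] Q[of "p x"] pnz[of x] by (auto simp: Bp_def Bm_def)
    have Bm_eq: "Bm = uminus ` Bp" using Bm_iff by (auto simp: image_iff) (metis minus_minus)+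
    have inf_neg: "infdist (- x) Bm = infdist x Bp" for x
      unfolding infdist_def Bm_eq by (simp add: image_image dist_minus)
    define f where "f = (\<lambda>x. infdist x Bm - infdist x Bp)"
    have f_odd: "f (- x) = - f x" for x using inf_neg[of x] inf_neg[of "- x"] by (simp add: f_def)
    have f_cont: "continuous_on S f" for S unfolding f_def by (intro continuous_intros)
    have fB: "f x \<noteq> 0" if "x \<in> B" for x
    proof -
      have *: "f x > 0" if "x \<in> Bp" for x
      proof -
        have "x \<notin> Bm" using that by (auto simp: Bp_def Bm_def)
        moreover have "Bm \<noteq> {}" using that Bm_iff by blast
        ultimately have "infdist x Bm > 0" using cl(2) by (metis infdist_nonneg in_closed_iff_infdist_zero order_le_less)
        then show ?thesis using that by (simp add: f_def)
      qed
      have "x \<in> Bp \<or> - x \<in> Bp" using that Bneg[OF that] Q[OF pnz[OF that]] by (auto simp: Bp_def)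
      then show ?thesis using *[of x] *[of "- x"] f_odd[of x] by auto
    qed
    obtain \<delta> K where \<delta>: "\<delta> > 0" and K: "\<And>x. x \<in> A \<Longrightarrow> \<bar>f x\<bar> \<le> \<delta> \<Longrightarrow> \<Phi> (h K x) < c"
    proof (rule ccontr)
      assume neg: "\<not> thesis"
      have "\<exists>x\<in>A. \<bar>f x\<bar> \<le> 1 / real (Suc n) \<and> c \<le> \<Phi> (h n x)" for n
        using neg that[of "1 / real (Suc n)" n] by (metis not_le of_nat_0_less_iff zero_less_Suc zero_less_divide_1_iff)
      then obtain y where y: "\<And>n. y n \<in> A" "\<And>n. \<bar>f (y n)\<bar> \<le> 1 / real (Suc n)" "\<And>n. c \<le> \<Phi> (h n (y n))" by metis
      obtain x r where x: "x \<in> A" and r: "strict_mono (r :: nat \<Rightarrow> nat)" and lim: "(y \<circ> r) \<longlonglongrightarrow> x"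
        using Suc.prems(1) y(1) unfolding compact_def by blast
      have ff: "(\<lambda>n. f (y n)) \<longlonglongrightarrow> 0"
        by (rule Lim_null_comparison[OF _ LIMSEQ_Suc[OF lim_1_over_n]]) (use y(2) in auto)
      have "(\<lambda>n. f ((y \<circ> r) n)) \<longlonglongrightarrow> f x"
        using f_cont[of UNIV] lim by (auto simp: continuous_on_sequentially comp_def)
      moreover have "(\<lambda>n. f ((y \<circ> r) n)) \<longlonglongrightarrow> 0" using LIMSEQ_subseq_LIMSEQ[OF ff r] by (simp add: comp_def)
      ultimately have "f x = 0" by (rule LIMSEQ_unique)
      moreover have "x \<in> B"
      proof (rule Blim[OF x _ lim])
        fix k
        have "c \<le> \<Phi> (h k ((y \<circ> r) j))" if "k \<le> j" for j
        proof -
          have "k \<le> r j" using that seq_suble[OF r, of j] by linarith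
          then show ?thesis using h_mono[of "y (r j)" k "r j"] y AU by (auto intro: order_trans)
        qed
        then show "\<forall>\<^sub>F j in sequentially. c \<le> \<Phi> (h k ((y \<circ> r) j))"
          by (auto simp: eventually_sequentially)
      qed (use y in auto)
      ultimately show False using fB by blast
    qed
    define W where "W = {x\<in>A. \<bar>f x\<bar> \<le> \<delta>}"
    have absf: "continuous_on A (\<lambda>x. \<bar>f x\<bar>)" by (intro continuous_intros f_cont)
    have W_eq: "W = A \<inter> (\<lambda>x. \<bar>f x\<bar>) -` {..\<delta>}" by (auto simp: W_def)
    have "closed A" using compact_imp_closed Suc.prems(1) by blast
    have clW: "closed W" unfolding W_eq by (rule continuous_closed_preimage[OF absf \<open>closed A\<close>]) auto
    have cpW: "compact W" using Suc.prems(1) clW by (metis W_eq compact_Int_closed inf.left_idem)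
    have clW': "closed {x\<in>A. \<delta> \<le> \<bar>f x\<bar>}"
      using continuous_closed_preimage[OF absf \<open>closed A\<close>, of "{\<delta>..}"] by (simp add: vimage_def Int_def)
    have "genus_le (h K ` W) n"
    proof (rule Suc.IH[OF _ _ _ _ cardc])
      have "continuous_on W (h K)" by (rule continuous_on_subset[OF h_cont]) (use AU in \<open>auto simp: W_def\<close>)
      then show "compact (h K ` W)" using cpW by (rule compact_continuous_image)
      show "h K ` W \<subseteq> U" using AU h_in by (auto simp: W_def)
      show "- x \<in> h K ` W" if x: "x \<in> h K ` W" for x
      proof -
        obtain w where w: "w \<in> W" "x = h K w" using x by blast
        then have "- w \<in> W" "- x = h K (- w)" using AU f_odd h_odd by (auto simp: W_def)
        then show ?thesis by blast
      qed
      show "\<Phi> x \<le> \<beta> \<and> \<Phi> x < c" if x: "x \<in> h K ` W" for x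
      proof -
        obtain w where w: "w \<in> A" "\<bar>f w\<bar> \<le> \<delta>" "x = h K w" using x by (auto simp: W_def)
        then show ?thesis using K[OF w(1,2)] h_le[of w K] AU[OF w(1)] by simp
      qed
    qed
    then obtain g :: "nat \<Rightarrow> 'a \<Rightarrow> real" where g: "\<And>i. i < n \<Longrightarrow> continuous_on (h K ` W) (g i)"
        "\<And>i x. i < n \<Longrightarrow> x \<in> W \<Longrightarrow> g i (- h K x) = - g i (h K x)" "\<And>x. x \<in> W \<Longrightarrow> \<exists>i<n. g i (h K x) \<noteq> (0::real)"
      unfolding genus_le_def ball_simps by blast
    \<comment> \<open>\<open>f\<close> and the functions from the lower level, cut off outside \<open>{|f| \<le> \<delta>}\<close>\<close>
    define F where "F = (\<lambda>i. case i of 0 \<Rightarrow> f | Suc i \<Rightarrow> (\<lambda>x. if \<bar>f x\<bar> \<le> \<delta> then (\<delta> - \<bar>f x\<bar>) * g i (h K x) else 0))"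
    have "continuous_on A (F i)" if "i < Suc n" for i
    proof (cases i)
      case (Suc j)
      have "continuous_on (W \<union> {x\<in>A. \<delta> \<le> \<bar>f x\<bar>}) (\<lambda>x. if \<bar>f x\<bar> \<le> \<delta> then (\<delta> - \<bar>f x\<bar>) * g j (h K x) else 0)"
      proof (rule continuous_on_cases[OF clW clW'])
        have "continuous_on W (\<lambda>x. g j (h K x))"
          by (rule continuous_on_compose2[OF g(1)], use that Suc in simp,
              rule continuous_on_subset[OF h_cont]) (use AU in \<open>auto simp: W_def\<close>)
        then show "continuous_on W (\<lambda>x. (\<delta> - \<bar>f x\<bar>) * g j (h K x))" by (intro continuous_intros f_cont)
      qed (auto simp: W_def)
      moreover have "W \<union> {x\<in>A. \<delta> \<le> \<bar>f x\<bar>} = A" by (auto simp: W_def)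
      ultimately show ?thesis by (simp add: F_def Suc)
    qed (simp add: F_def f_cont)
    moreover have "F i (- x) = - F i x" if "i < Suc n" "x \<in> A" for i x
    proof (cases i)
      case (Suc j)
      then show ?thesis using g(2)[of j x] that h_odd[of x K] AU by (auto simp: F_def f_odd W_def)
    qed (simp add: F_def f_odd)
    moreover have "\<exists>i<Suc n. F i x \<noteq> 0" if x: "x \<in> A" for x
    proof (cases "f x = 0")
      case True
      then have "x \<in> W" using x \<delta> by (auto simp: W_def)
      then obtain i where "i < n" "g i (h K x) \<noteq> 0" using g(3) by blast
      then show ?thesis using True \<delta> by (intro exI[of _ "Suc i"]) (auto simp: F_def)
    next
      case False
      then show ?thesis by (intro exI[of _ 0]) (auto simp: F_def)
    qed
    ultimately show ?thesis unfolding genus_le_def by blast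
  qed
qed

end

section \<open>The Borsuk--Ulam theorem\<close>

lemma continuous_map_in: "continuous_map X Y f \<Longrightarrow> x \<in> topspace X \<Longrightarrow> f x \<in> topspace Y"
  by (auto simp: continuous_map_def)

text \<open>The unit sphere of \<open>\<real>\<^sup>n\<^sup>+\<^sup>1\<close>, and the distance of the first \<open>n + 1\<close> coordinates in the sum norm.\<close>

abbreviation Sph :: "nat \<Rightarrow> (nat \<Rightarrow> real) set" where
  "Sph n \<equiv> topspace (nsphere n)"

abbreviation l1 :: "nat \<Rightarrow> (nat \<Rightarrow> real) \<Rightarrow> (nat \<Rightarrow> real) \<Rightarrow> real" where
  "l1 n x y \<equiv> (\<Sum>i\<le>n. \<bar>x i - y i\<bar>)"

lemma in_nsphere: "x \<in> Sph n \<longleftrightarrow> (\<Sum>i\<le>n. (x i)\<^sup>2) = 1 \<and> (\<forall>i>n. x i = 0)"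
  by (simp add: nsphere)

lemma nsphere_eq_top_of_set: "nsphere n = top_of_set (Sph n)"
  by (simp add: nsphere euclidean_product_topology)

lemma nsphere_abs_le_1:
  assumes "x \<in> Sph n"
  shows "\<bar>x i\<bar> \<le> 1"
proof (cases "i \<le> n")
  case True
  then have "(x i)\<^sup>2 \<le> (\<Sum>i\<le>n. (x i)\<^sup>2)" by (intro member_le_sum) auto
  then show ?thesis using assms by (simp add: in_nsphere abs_square_le_1)
next
  case False
  then show ?thesis using assms by (simp add: in_nsphere)
qed

lemma neg_in_nsphere: "x \<in> Sph n \<Longrightarrow> (\<lambda>i. - x i) \<in> Sph n"
  by (simp add: in_nsphere)

lemma nsphere_subset_Suc: "x \<in> Sph n \<Longrightarrow> x \<in> Sph (Suc n)"
  by (simp add: in_nsphere)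

lemma large_coordinate:
  assumes "x \<in> Sph n"
  shows "\<exists>i\<le>n. 1 / real (Suc n) \<le> \<bar>x i\<bar>"
proof (rule ccontr)
  assume "\<not> ?thesis"
  then have "\<bar>x i\<bar> < 1 / real (Suc n)" if "i \<le> n" for i using that by auto
  moreover have "(x i)\<^sup>2 \<le> \<bar>x i\<bar>" for i
    using mult_left_mono[OF nsphere_abs_le_1[OF assms, of i], of "\<bar>x i\<bar>"] by (simp add: power2_eq_square)
  ultimately have "(x i)\<^sup>2 < 1 / real (Suc n)" if "i \<le> n" for i
    using that by (meson le_less_trans)
  then have "(\<Sum>i\<le>n. (x i)\<^sup>2) < (\<Sum>i\<le>n. 1 / real (Suc n))" by (intro sum_strict_mono) auto
  then show False using assms by (simp add: in_nsphere)
qed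

lemma compact_nsphere: "compact (Sph n)"
proof -
  have "compact (PiE UNIV (\<lambda>_::nat. {-1..1::real}))"
    using compactin_PiE[of "\<lambda>_::nat. euclideanreal" UNIV "\<lambda>_. {-1..1}"]
    by (simp add: euclidean_product_topology)
  moreover have "closed (Sph n)"
  proof -
    have "Sph n = {x. (\<Sum>i\<le>n. (x i)\<^sup>2) = 1} \<inter> (\<Inter>i\<in>{n<..}. {x. x i = 0})"
      by (auto simp: in_nsphere)
    moreover have "closed {x :: nat \<Rightarrow> real. (\<Sum>i\<le>n. (x i)\<^sup>2) = 1}"
      by (intro closed_Collect_eq continuous_intros) auto
    moreover have "closed {x :: nat \<Rightarrow> real. x i = 0}" for i
      by (intro closed_Collect_eq continuous_intros) auto
    ultimately show ?thesis by (auto intro!: closed_Int closed_INT)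
  qed
  moreover have "Sph n \<subseteq> PiE UNIV (\<lambda>_. {-1..1})"
    using nsphere_abs_le_1 by (fastforce simp: abs_le_iff)
  ultimately show ?thesis by (metis compact_Int_closed inf.absorb_iff2 inf_commute)
qed

lemma continuous_map_nsphere_real:
  "continuous_map (nsphere n) euclideanreal f \<longleftrightarrow> continuous_on (Sph n) f"
  by (metis continuous_map_iff_continuous nsphere_eq_top_of_set)

text \<open>Radial projection to \<open>nsphere n\<close> of the first \<open>n + 1\<close> coordinates.\<close>

definition to_sphere :: "nat \<Rightarrow> (nat \<Rightarrow> real) \<Rightarrow> nat \<Rightarrow> real" where
  "to_sphere n y = (\<lambda>i. if i \<le> n then y i / sqrt (\<Sum>j\<le>n. (y j)\<^sup>2) else 0)"

lemma sum_squares_pos: "\<exists>i\<le>n. y i \<noteq> 0 \<Longrightarrow> 0 < (\<Sum>j\<le>(n::nat). (y j :: real)\<^sup>2)"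
  by (metis atMost_iff finite_atMost sum_pos2 zero_le_power2 zero_less_power2)

lemma to_sphere_in_nsphere:
  assumes "\<exists>i\<le>n. y i \<noteq> 0"
  shows "to_sphere n y \<in> Sph n"
proof -
  have "(\<Sum>i\<le>n. (to_sphere n y i)\<^sup>2) = (\<Sum>i\<le>n. (y i)\<^sup>2 / (\<Sum>j\<le>n. (y j)\<^sup>2))"
    by (intro sum.cong) (auto simp: to_sphere_def power_divide sum_nonneg)
  also have "\<dots> = 1" using sum_squares_pos[OF assms] by (simp flip: sum_divide_distrib)
  finally show ?thesis by (simp add: in_nsphere to_sphere_def)
qed

lemma to_sphere_id: "x \<in> Sph n \<Longrightarrow> to_sphere n x = x"
  by (auto simp: to_sphere_def in_nsphere fun_eq_iff)

lemma to_sphere_neg: "to_sphere n (\<lambda>i. - y i) = (\<lambda>i. - to_sphere n y i)"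
  by (auto simp: to_sphere_def)

lemma continuous_map_to_sphere:
  assumes "\<And>i. i \<le> n \<Longrightarrow> continuous_map X euclideanreal (\<lambda>x. F x i)"
    and "\<And>x. x \<in> topspace X \<Longrightarrow> \<exists>i\<le>n. F x i \<noteq> 0"
  shows "continuous_map X (nsphere n) (\<lambda>x. to_sphere n (F x))"
  unfolding nsphere continuous_map_in_subtopology
proof
  have "continuous_map X euclideanreal (\<lambda>x. to_sphere n (F x) i)" for i
  proof (cases "i \<le> n")
    case True
    have "continuous_map X euclideanreal (\<lambda>x. F x i / sqrt (\<Sum>j\<le>n. (F x j)\<^sup>2))"
      by (intro continuous_map_real_divide continuous_map_sqrt continuous_map_sum continuous_map_real_pow assms True)
        (use sum_squares_pos[OF assms(2)] in \<open>force+\<close>)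
    then show ?thesis using True by (simp add: to_sphere_def)
  qed (simp add: to_sphere_def)
  then show "continuous_map X (powertop_real UNIV) (\<lambda>x. to_sphere n (F x))"
    by (simp add: continuous_map_componentwise_UNIV)
  show "(\<lambda>x. to_sphere n (F x)) \<in> topspace X \<rightarrow> {x. (\<Sum>i\<le>n. (x i)\<^sup>2) = 1 \<and> (\<forall>i>n. x i = 0)}"
    using to_sphere_in_nsphere[OF assms(2)] by (auto simp: in_nsphere)
qed

lemma continuous_map_nsphere_component:
  "continuous_map X (nsphere n) f \<Longrightarrow> continuous_map X euclideanreal (\<lambda>x. f x i)"
  using continuous_map_compose[OF _ continuous_map_nsphere_projection, of X n f i] by (simp add: comp_def)

text \<open>Maps into the sphere are homotopic if the segments between their values miss the origin.\<close>

lemma homotopic_to_sphere: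
  assumes f: "continuous_map X (nsphere n) f"
    and F: "\<And>i. i \<le> n \<Longrightarrow> continuous_map X euclideanreal (\<lambda>x. F x i)"
    and nz: "\<And>x t. x \<in> topspace X \<Longrightarrow> 0 \<le> t \<Longrightarrow> t \<le> 1 \<Longrightarrow> \<exists>i\<le>n. (1 - t) * f x i + t * F x i \<noteq> 0"
  shows "homotopic_with (\<lambda>_. True) X (nsphere n) f (\<lambda>x. to_sphere n (F x))"
proof -
  let ?I = "prod_topology (top_of_set {0..1::real}) X"
  have t: "continuous_map ?I euclideanreal fst"
    using continuous_map_fst continuous_map_into_fulltopology by blast
  have "continuous_map ?I (nsphere n) (\<lambda>z. to_sphere n (\<lambda>i. (1 - fst z) * f (snd z) i + fst z * F (snd z) i))"
  proof (rule continuous_map_to_sphere)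
    fix i assume "i \<le> n"
    have "continuous_map ?I euclideanreal (\<lambda>z. f (snd z) i)" "continuous_map ?I euclideanreal (\<lambda>z. F (snd z) i)"
      using continuous_map_compose[OF continuous_map_snd continuous_map_nsphere_component[OF f, of i]]
        continuous_map_compose[OF continuous_map_snd F[OF \<open>i \<le> n\<close>]] by (simp_all add: comp_def)
    then show "continuous_map ?I euclideanreal (\<lambda>z. (1 - fst z) * f (snd z) i + fst z * F (snd z) i)"
      using t by (intro continuous_intros) auto
  qed (use nz in auto)
  then have "homotopic_with (\<lambda>_. True) X (nsphere n)
      (\<lambda>x. to_sphere n (\<lambda>i. (1 - 0) * f x i + 0 * F x i)) (\<lambda>x. to_sphere n (\<lambda>i. (1 - 1) * f x i + 1 * F x i))"
    unfolding homotopic_with_def by (intro exI[of _ "\<lambda>z. to_sphere n (\<lambda>i. (1 - fst z) * f (snd z) i + fst z * F (snd z) i)"]) auto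
  then have *: "homotopic_with (\<lambda>_. True) X (nsphere n) (\<lambda>x. to_sphere n (f x)) (\<lambda>x. to_sphere n (F x))" by simp
  have "f x \<in> Sph n" if "x \<in> topspace X" for x using continuous_map_in[OF f that] .
  then show ?thesis
    by (intro homotopic_with_eq[OF *]) (auto simp: to_sphere_id)
qed

text \<open>
  The sphere has dimension \<open>n\<close>, in the sense that a \<open>1/K\<close>-separated set has \<open>O(K\<^sup>n)\<close> points.
\<close>

lemma nsphere_packing:
  "\<exists>C :: nat. \<forall>K T. K \<ge> 1 \<longrightarrow> T \<subseteq> Sph n \<longrightarrow>
    (\<forall>x\<in>T. \<forall>y\<in>T. x \<noteq> y \<longrightarrow> 1 / real K \<le> l1 n x y) \<longrightarrow> card T \<le> C * K ^ n"
proof -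
  define M where "M = n * (n + 2) + 1"
  have "card T \<le> (2 * (n + 1) * (3 * M) ^ n) * K ^ n"
    if K: "K \<ge> 1" and T: "T \<subseteq> Sph n"
      and sep: "\<forall>x\<in>T. \<forall>y\<in>T. x \<noteq> y \<longrightarrow> 1 / real K \<le> l1 n x y" for K T
  proof -
    define N where "N = M * K"
    have N: "N \<ge> 1" using K by (simp add: N_def M_def)
    define J where "J = (\<lambda>x :: nat \<Rightarrow> real. SOME j. j \<le> n \<and> 1 / real (Suc n) \<le> \<bar>x j\<bar>)"
    have J: "J x \<le> n" "1 / real (Suc n) \<le> \<bar>x (J x)\<bar>" if "x \<in> T" for x
      using someI_ex[OF large_coordinate[of x n]] that T by (auto simp: J_def)
    \<comment> \<open>the grid cell of \<open>x\<close>, with only the sign of a coordinate that is bounded away from 0\<close>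
    define cell where "cell = (\<lambda>x. (J x, x (J x) > 0, restrict (\<lambda>i. \<lfloor>real N * x i\<rfloor>) ({..n} - {J x})))"
    have "inj_on cell T"
    proof (rule inj_onI, rule ccontr)
      fix x y assume xy: "x \<in> T" "y \<in> T" "cell x = cell y" "x \<noteq> y"
      define j where "j = J x"
      have j: "j \<le> n" "J y = j" "x j > 0 \<longleftrightarrow> y j > 0" "1 / real (Suc n) \<le> \<bar>x j\<bar>" "1 / real (Suc n) \<le> \<bar>y j\<bar>"
        using xy J[of x] J[of y] by (auto simp: cell_def j_def)
      have fl: "\<lfloor>real N * x i\<rfloor> = \<lfloor>real N * y i\<rfloor>" if i: "i \<in> {..n} - {j}" for i
      proof -
        have "restrict (\<lambda>i. \<lfloor>real N * x i\<rfloor>) ({..n} - {j}) i = restrict (\<lambda>i. \<lfloor>real N * y i\<rfloor>) ({..n} - {j}) i"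
          using xy(3) j(2) by (auto simp: cell_def j_def)
        then show ?thesis using i by simp
      qed
      have cl: "\<bar>x i - y i\<bar> \<le> 1 / N" if i: "i \<in> {..n} - {j}" for i
      proof -
        have "\<bar>real N * x i - real N * y i\<bar> < 1" using fl[OF i] by linarith
        then have "real N * \<bar>x i - y i\<bar> \<le> 1" by (simp add: abs_mult flip: right_diff_distrib)
        then show ?thesis using N by (simp add: field_simps)
      qed
      have xs: "x \<in> Sph n" "y \<in> Sph n" using xy T by auto
      have split: "(\<Sum>i\<le>n. g i) = g j + (\<Sum>i\<in>{..n} - {j}. g i)" for g :: "nat \<Rightarrow> real"
        using j(1) by (intro sum.remove) auto
      have "(x j)\<^sup>2 - (y j)\<^sup>2 = (\<Sum>i\<in>{..n} - {j}. (y i)\<^sup>2 - (x i)\<^sup>2)"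
        using xs split[of "\<lambda>i. (x i)\<^sup>2"] split[of "\<lambda>i. (y i)\<^sup>2"] by (simp add: in_nsphere sum_subtractf)
      then have "\<bar>(x j)\<^sup>2 - (y j)\<^sup>2\<bar> \<le> (\<Sum>i\<in>{..n} - {j}. \<bar>(y i)\<^sup>2 - (x i)\<^sup>2\<bar>)" by (metis sum_abs)
      also have "\<dots> \<le> (\<Sum>i\<in>{..n} - {j}. 2 / N)"
      proof (intro sum_mono)
        fix i assume i: "i \<in> {..n} - {j}"
        have "\<bar>(y i)\<^sup>2 - (x i)\<^sup>2\<bar> = \<bar>x i - y i\<bar> * \<bar>x i + y i\<bar>"
          by (simp add: abs_mult[symmetric] power2_eq_square algebra_simps abs_minus_commute)
        also have "\<dots> \<le> (1 / N) * 2"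
          using cl[OF i] nsphere_abs_le_1[OF xs(1), of i] nsphere_abs_le_1[OF xs(2), of i] by (intro mult_mono) auto
        finally show "\<bar>(y i)\<^sup>2 - (x i)\<^sup>2\<bar> \<le> 2 / N" by simp
      qed
      also have "\<dots> = 2 * n / N" using j(1) by simp
      finally have sq: "\<bar>(x j)\<^sup>2 - (y j)\<^sup>2\<bar> \<le> 2 * n / N" .
      have "2 / real (Suc n) \<le> \<bar>x j + y j\<bar>" using j(3-5) by (auto simp: abs_if split: if_splits)
      then have "\<bar>x j - y j\<bar> * (2 / real (Suc n)) \<le> \<bar>x j - y j\<bar> * \<bar>x j + y j\<bar>" by (intro mult_left_mono) auto
      also have "\<dots> = \<bar>(x j)\<^sup>2 - (y j)\<^sup>2\<bar>" by (simp add: abs_mult[symmetric] power2_eq_square algebra_simps)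
      finally have "\<bar>x j - y j\<bar> * (2 / real (Suc n)) \<le> 2 * n / N" using sq by linarith
      then have "\<bar>x j - y j\<bar> * 2 \<le> 2 * n / N * real (Suc n)" by (simp add: pos_divide_le_eq)
      also have "2 * n / N * real (Suc n) = 2 * (n * Suc n / N)" by (simp add: algebra_simps)
      finally have "\<bar>x j - y j\<bar> * 2 \<le> 2 * (n * Suc n / N)" .
      then have xj: "\<bar>x j - y j\<bar> \<le> n * Suc n / N"
        by (simp only: mult.commute[of _ "2::real"] mult_le_cancel_left_pos zero_less_numeral)
      have "l1 n x y = \<bar>x j - y j\<bar> + (\<Sum>i\<in>{..n} - {j}. \<bar>x i - y i\<bar>)" by (rule split)
      also have "\<dots> \<le> n * Suc n / N + (\<Sum>i\<in>{..n} - {j}. 1 / N)" using xj cl by (intro add_mono sum_mono) auto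
      also have "\<dots> = real (n * (n + 2)) / N" using j(1) by (simp add: add_divide_distrib[symmetric] algebra_simps)
      also have "\<dots> < real M / N" using N by (intro divide_strict_right_mono) (auto simp: M_def)
      also have "\<dots> = 1 / K"
      proof -
        have "M \<noteq> 0" by (simp add: M_def)
        then have "real M \<noteq> 0" by simp
        then show ?thesis by (simp add: N_def)
      qed
      finally show False using sep[rule_format, OF xy(1,2,4)] by linarith
    qed
    moreover have "cell ` T \<subseteq> (\<Union>j\<le>n. {j} \<times> (UNIV :: bool set) \<times> PiE ({..n} - {j}) (\<lambda>_. {- int N..int N}))" (is "_ \<subseteq> ?R")
    proof
      fix z assume "z \<in> cell ` T"
      then obtain x where x: "x \<in> T" "z = cell x" by blast
      have "\<lfloor>real N * x i\<rfloor> \<in> {- int N..int N}" for i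
      proof -
        have "\<bar>x i\<bar> \<le> 1" using nsphere_abs_le_1 x T by blast
        then have "real N * \<bar>x i\<bar> \<le> real N * 1" by (intro mult_left_mono) auto
        then have "\<bar>real N * x i\<bar> \<le> real N" by (simp add: abs_mult)
        then have "- real N \<le> real N * x i" "real N * x i \<le> real N" by linarith+
        then have "- int N \<le> \<lfloor>real N * x i\<rfloor>" "\<lfloor>real N * x i\<rfloor> \<le> int N"
          by (simp_all add: le_floor_iff floor_le_iff)
        then show ?thesis by simp
      qed
      then have "restrict (\<lambda>i. \<lfloor>real N * x i\<rfloor>) ({..n} - {J x}) \<in> PiE ({..n} - {J x}) (\<lambda>_. {- int N..int N})"
        by (rule restrict_PiE_iff[THEN iffD2, OF ballI])
      then show "z \<in> ?R" using J(1)[OF x(1)] unfolding x(2) cell_def by blast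
    qed
    moreover have "finite ?R"
    proof (rule finite_UN_I)
      fix j
      have "finite (PiE ({..n} - {j}) (\<lambda>_. {- int N..int N}))" by (rule finite_PiE) auto
      then show "finite ({j} \<times> (UNIV :: bool set) \<times> PiE ({..n} - {j}) (\<lambda>_. {- int N..int N}))"
        by (rule finite_cartesian_product[OF _ finite_cartesian_product, rotated 2]) auto
    qed simp
    ultimately have "card T \<le> card ?R" using card_image[of cell T] card_mono[of ?R "cell ` T"] by linarith
    also have "\<dots> \<le> (\<Sum>j\<le>n. card ({j} \<times> (UNIV :: bool set) \<times> PiE ({..n} - {j}) (\<lambda>_. {- int N..int N})))"
      by (rule card_UN_le) auto
    also have "\<dots> = (\<Sum>j\<le>n. 2 * (2 * N + 1) ^ n)"
    proof (intro sum.cong)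
      fix j assume "j \<in> {..n}"
      have "nat (int N - - int N + 1) = 2 * N + 1" by simp
      then show "card ({j} \<times> (UNIV :: bool set) \<times> PiE ({..n} - {j}) (\<lambda>_. {- int N..int N})) = 2 * (2 * N + 1) ^ n"
        using \<open>j \<in> {..n}\<close> by (simp add: card_cartesian_product card_PiE)
    qed simp
    also have "\<dots> = 2 * (n + 1) * (2 * N + 1) ^ n" by simp
    also have "\<dots> \<le> 2 * (n + 1) * (3 * M * K) ^ n" using N by (intro mult_left_mono power_mono) (auto simp: N_def)
    also have "\<dots> = (2 * (n + 1) * (3 * M) ^ n) * K ^ n" by (simp only: power_mult_distrib mult.assoc)
    finally show ?thesis .
  qed
  then show ?thesis by (intro exI[of _ "2 * (n + 1) * (3 * M) ^ n"] allI impI)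
qed

text \<open>
  A Lipschitz image of the \<open>n\<close>-sphere in \<open>\<real>\<^sup>n\<^sup>+\<^sup>2\<close> misses a line through the origin, since it
  meets too few of the \<open>(K+1)\<^sup>n\<^sup>+\<^sup>1\<close> lines through the grid points \<open>(k\<^sub>0/K, \<dots>, k\<^sub>n/K, 1)\<close>.
\<close>

lemma Lipschitz_image_misses_line:
  fixes q :: "(nat \<Rightarrow> real) \<Rightarrow> nat \<Rightarrow> real"
  assumes Lip: "\<And>x y i. x \<in> Sph n \<Longrightarrow> y \<in> Sph n \<Longrightarrow> i \<le> Suc n \<Longrightarrow> \<bar>q x i - q y i\<bar> \<le> L * l1 n x y"
    and c: "c > 0" "\<And>x. x \<in> Sph n \<Longrightarrow> \<exists>i\<le>Suc n. c \<le> \<bar>q x i\<bar>"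
  shows "\<exists>b. \<forall>x\<in>Sph n. \<exists>i\<le>n. q x i \<noteq> q x (Suc n) * b i"
proof -
  obtain C :: nat where C: "\<forall>K T. K \<ge> 1 \<longrightarrow> T \<subseteq> Sph n \<longrightarrow>
    (\<forall>x\<in>T. \<forall>y\<in>T. x \<noteq> y \<longrightarrow> 1 / real K \<le> l1 n x y) \<longrightarrow> card T \<le> C * K ^ n"
    using nsphere_packing[of n] by (elim exE)
  obtain m :: nat where m: "2 * \<bar>L\<bar> / c < m" using reals_Archimedean2 by blast
  have m0: "m > 0" using m c by (cases m) (auto simp: divide_less_0_iff not_less)
  define K where "K = C * m ^ n + 1"
  have K0: "K > 0" by (simp add: K_def)
  define b where "b = (\<lambda>(k :: nat \<Rightarrow> nat) i. real (k i) / K)"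
  define \<B> where "\<B> = PiE {..n} (\<lambda>_. {0..K})"
  have b01: "\<bar>b k i\<bar> \<le> 1" if "k \<in> \<B>" "i \<le> n" for k i
    using PiE_mem[OF that(1)[unfolded \<B>_def], of i] that(2) K0 by (simp add: b_def)
  have "\<exists>k\<in>\<B>. \<forall>x\<in>Sph n. \<exists>i\<le>n. q x i \<noteq> q x (Suc n) * b k i"
  proof (rule ccontr)
    assume "\<not> ?thesis"
    then have "\<forall>k\<in>\<B>. \<exists>x. x \<in> Sph n \<and> (\<forall>i\<le>n. q x i = q x (Suc n) * b k i)" by blast
    from bchoice[OF this] obtain x where x: "\<And>k. k \<in> \<B> \<Longrightarrow> x k \<in> Sph n"
      "\<And>k i. k \<in> \<B> \<Longrightarrow> i \<le> n \<Longrightarrow> q (x k) i = q (x k) (Suc n) * b k i" by blast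
    have q0: "c \<le> \<bar>q (x k) (Suc n)\<bar>" if k: "k \<in> \<B>" for k
    proof -
      obtain i where i: "i \<le> Suc n" "c \<le> \<bar>q (x k) i\<bar>" using c(2) x(1) k by blast
      show ?thesis
      proof (cases "i = Suc n")
        case False
        then have "i \<le> n" using i by simp
        have "\<bar>q (x k) i\<bar> = \<bar>q (x k) (Suc n)\<bar> * \<bar>b k i\<bar>" by (simp only: x(2)[OF k \<open>i \<le> n\<close>] abs_mult)
        also have "\<dots> \<le> \<bar>q (x k) (Suc n)\<bar> * 1" using b01[OF k \<open>i \<le> n\<close>] by (intro mult_left_mono) auto
        finally show ?thesis using i by simp
      qed (use i in simp)
    qed
    have sep: "1 / real (K * m) \<le> l1 n (x k) (x l)" if kl: "k \<in> \<B>" "l \<in> \<B>" "k \<noteq> l" for k l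
    proof -
      have "\<exists>i\<in>{..n}. k i \<noteq> l i" using PiE_ext[OF kl(1,2)[unfolded \<B>_def]] kl(3) by blast
      then obtain i where i: "i \<le> n" "k i \<noteq> l i" by blast
      define d where "d = l1 n (x k) (x l)"
      have d0: "d \<ge> 0" by (simp add: d_def sum_nonneg)
      have "1 \<le> \<bar>real (k i) - real (l i)\<bar>" using i(2) by linarith
      then have "1 / K \<le> \<bar>real (k i) - real (l i)\<bar> / K" by (simp add: divide_right_mono)
      also have "\<dots> = \<bar>b k i - b l i\<bar>" using i by (simp add: b_def abs_divide flip: diff_divide_distrib)
      finally have bb: "1 / K \<le> \<bar>b k i - b l i\<bar>" .
      define u v where "u = q (x k)" and "v = q (x l)"
      have uv: "u i = u (Suc n) * b k i" "v i = v (Suc n) * b l i" "c \<le> \<bar>u (Suc n)\<bar>"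
        unfolding u_def v_def using x(2)[OF kl(1) i(1)] x(2)[OF kl(2) i(1)] q0[OF kl(1)] by simp_all
      have lip: "\<bar>u i - v i\<bar> \<le> \<bar>L\<bar> * d" "\<bar>u (Suc n) - v (Suc n)\<bar> \<le> \<bar>L\<bar> * d"
      proof -
        have "\<bar>u i - v i\<bar> \<le> L * d" "\<bar>u (Suc n) - v (Suc n)\<bar> \<le> L * d"
          unfolding u_def v_def d_def by (rule Lip[OF x(1)[OF kl(1)] x(1)[OF kl(2)]], use i in simp)+
        moreover have "L * d \<le> \<bar>L\<bar> * d" using d0 by (intro mult_right_mono) auto
        ultimately show "\<bar>u i - v i\<bar> \<le> \<bar>L\<bar> * d" "\<bar>u (Suc n) - v (Suc n)\<bar> \<le> \<bar>L\<bar> * d" by linarith+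
      qed
      have "u (Suc n) * (b k i - b l i) = (u i - v i) - (u (Suc n) - v (Suc n)) * b l i" using uv by (simp add: algebra_simps)
      then have "\<bar>u (Suc n)\<bar> * \<bar>b k i - b l i\<bar> \<le> \<bar>u i - v i\<bar> + \<bar>u (Suc n) - v (Suc n)\<bar> * \<bar>b l i\<bar>"
        by (simp only: abs_triangle_ineq4 flip: abs_mult)
      also have "\<dots> \<le> \<bar>L\<bar> * d + (\<bar>L\<bar> * d) * 1"
        using lip b01[OF kl(2) i(1)] d0 by (intro add_mono mult_mono) auto
      finally have "\<bar>u (Suc n)\<bar> * \<bar>b k i - b l i\<bar> \<le> 2 * \<bar>L\<bar> * d" by (simp add: mult.commute)
      moreover have "c * (1 / K) \<le> \<bar>u (Suc n)\<bar> * \<bar>b k i - b l i\<bar>" using bb uv(3) c by (intro mult_mono) auto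
      ultimately have "c * (1 / K) \<le> 2 * \<bar>L\<bar> * d" by (rule order_trans[rotated])
      then have "1 / K \<le> (2 * \<bar>L\<bar> / c) * d" using c by (simp add: pos_le_divide_eq mult.commute)
      also have "\<dots> \<le> m * d" using m d0 by (intro mult_right_mono) auto
      finally have "1 / K / m \<le> m * d / m" by (rule divide_right_mono) simp
      then show ?thesis using m0 by (simp add: d_def[symmetric])
    qed
    have "inj_on x \<B>"
    proof (rule inj_onI, rule ccontr)
      fix k l assume kl: "k \<in> \<B>" "l \<in> \<B>" "x k = x l" "k \<noteq> l"
      have "K * m > 0" using m0 by (simp add: K_def)
      then have "0 < 1 / real (K * m)" by (simp only: zero_less_divide_1_iff of_nat_0_less_iff)
      then show False using sep[OF kl(1,2,4)] kl(3) by simp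
    qed
    then have "card \<B> = card (x ` \<B>)" by (simp add: card_image)
    also have "\<dots> \<le> C * (K * m) ^ n"
    proof (rule C[rule_format])
      show "K * m \<ge> 1" using m0 K0 by simp
      show "x ` \<B> \<subseteq> Sph n" using x(1) by blast
      show "1 / real (K * m) \<le> l1 n y z" if yz: "y \<in> x ` \<B>" "z \<in> x ` \<B>" "y \<noteq> z" for y z
      proof -
        obtain k l where "k \<in> \<B>" "l \<in> \<B>" "y = x k" "z = x l" using yz by blast
        then show ?thesis using sep[of k l] yz(3) by blast
      qed
    qed
    finally have "(K + 1) ^ Suc n \<le> C * (K * m) ^ n" by (simp add: \<B>_def card_PiE)
    also have "\<dots> = (C * m ^ n) * K ^ n" by (simp add: power_mult_distrib)
    also have "\<dots> < (K + 1) * (K + 1) ^ n"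
      by (intro mult_less_le_imp_less power_mono) (auto simp: K_def)
    finally show False by simp
  qed
  then show ?thesis by blast
qed

text \<open>Stone--Weierstrass for the Lipschitz functions on the sphere.\<close>

lemma Lipschitz_approximation:
  assumes "continuous_on (Sph n) f" "\<epsilon> > 0"
  shows "\<exists>g. (\<forall>x\<in>Sph n. \<bar>f x - g x\<bar> < \<epsilon>) \<and> continuous_on (Sph n) g \<and>
    (\<exists>L. \<forall>x\<in>Sph n. \<forall>y\<in>Sph n. \<bar>g x - g y\<bar> \<le> L * l1 n x y)"
proof -
  let ?S = "Sph n"
  define d where "d = (\<lambda>x y :: nat \<Rightarrow> real. \<Sum>i\<le>n. \<bar>x i - y i\<bar>)"
  define lip where "lip = (\<lambda>g. \<exists>L B. (\<forall>x\<in>?S. \<bar>g x\<bar> \<le> B) \<and> (\<forall>x\<in>?S. \<forall>y\<in>?S. \<bar>g x - g y\<bar> \<le> L * d x y))"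
  have d0: "d x y \<ge> 0" for x y by (simp add: d_def sum_nonneg)
  have cont: "continuous_on ?S g" if g: "lip g" for g
    unfolding continuous_on_def
  proof
    fix y assume y: "y \<in> ?S"
    obtain L where L: "\<And>x. x \<in> ?S \<Longrightarrow> \<bar>g x - g y\<bar> \<le> L * d x y" using g y by (auto simp: lip_def)
    have "continuous_on ?S (\<lambda>x. L * d x y)" unfolding d_def
      by (intro continuous_intros continuous_on_product_then_coordinatewise[OF continuous_on_id])
    then have "((\<lambda>x. L * d x y) \<longlongrightarrow> L * d y y) (at y within ?S)" using y by (simp add: continuous_on_def)
    then have lim: "((\<lambda>x. L * d x y) \<longlongrightarrow> 0) (at y within ?S)" by (simp add: d_def)
    have "((\<lambda>x. g x - g y) \<longlongrightarrow> 0) (at y within ?S)"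
      by (rule Lim_null_comparison[OF _ lim]) (use L in \<open>auto simp: eventually_at_filter\<close>)
    then show "(g \<longlongrightarrow> g y) (at y within ?S)" by (simp add: LIM_zero_iff)
  qed
  have "\<exists>g. lip g \<and> (\<forall>x \<in> ?S. \<bar>f x - g x\<bar> < \<epsilon>)"
  proof (rule Stone_Weierstrass_HOL[OF compact_nsphere _ cont _ _ _ assms])
    show "lip (\<lambda>x. c)" for c unfolding lip_def
      by (rule exI[of _ 0], rule exI[of _ "\<bar>c\<bar>"]) auto
    fix g1 g2 :: "(nat \<Rightarrow> real) \<Rightarrow> real" assume "lip g1 \<and> lip g2"
    then obtain L1 B1 L2 B2 where
      1: "\<And>x. x \<in> ?S \<Longrightarrow> \<bar>g1 x\<bar> \<le> B1" "\<And>x y. x \<in> ?S \<Longrightarrow> y \<in> ?S \<Longrightarrow> \<bar>g1 x - g1 y\<bar> \<le> L1 * d x y" and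
      2: "\<And>x. x \<in> ?S \<Longrightarrow> \<bar>g2 x\<bar> \<le> B2" "\<And>x y. x \<in> ?S \<Longrightarrow> y \<in> ?S \<Longrightarrow> \<bar>g2 x - g2 y\<bar> \<le> L2 * d x y"
      unfolding lip_def by metis
    show "lip (\<lambda>x. g1 x + g2 x)"
      unfolding lip_def
    proof (rule exI[of _ "L1 + L2"], rule exI[of _ "B1 + B2"], intro conjI ballI)
      fix x y assume "x \<in> ?S" "y \<in> ?S"
      then show "\<bar>g1 x + g2 x - (g1 y + g2 y)\<bar> \<le> (L1 + L2) * d x y"
        using 1(2)[of x y] 2(2)[of x y] by (simp add: distrib_right abs_le_iff)
    next
      fix x assume "x \<in> ?S"
      then show "\<bar>g1 x + g2 x\<bar> \<le> B1 + B2" using 1(1)[of x] 2(1)[of x] by linarith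
    qed
    show "lip (\<lambda>x. g1 x * g2 x)"
      unfolding lip_def
    proof (rule exI[of _ "L1 * B2 + B1 * L2"], rule exI[of _ "B1 * B2"], intro conjI ballI)
      fix x assume x: "x \<in> ?S"
      then show "\<bar>g1 x * g2 x\<bar> \<le> B1 * B2" using 1(1)[of x] 2(1)[of x] by (auto simp: abs_mult intro!: mult_mono)
      fix y assume y: "y \<in> ?S"
      have "g1 x * g2 x - g1 y * g2 y = (g1 x - g1 y) * g2 x + g1 y * (g2 x - g2 y)" by (simp add: algebra_simps)
      then have "\<bar>g1 x * g2 x - g1 y * g2 y\<bar> \<le> \<bar>g1 x - g1 y\<bar> * \<bar>g2 x\<bar> + \<bar>g1 y\<bar> * \<bar>g2 x - g2 y\<bar>"
        by (simp only: abs_triangle_ineq flip: abs_mult)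
      also have "\<dots> \<le> (L1 * d x y) * B2 + B1 * (L2 * d x y)"
      proof (intro add_mono mult_mono)
        show "0 \<le> L1 * d x y" using 1(2)[OF x y] by linarith
        show "0 \<le> B1" using 1(1)[OF x] by linarith
      qed (use 1 2 x y in auto)
      finally show "\<bar>g1 x * g2 x - g1 y * g2 y\<bar> \<le> (L1 * B2 + B1 * L2) * d x y" by (simp add: algebra_simps)
    qed
  next
    fix x y :: "nat \<Rightarrow> real" assume xy: "x \<in> ?S \<and> y \<in> ?S \<and> x \<noteq> y"
    then obtain i where i: "x i \<noteq> y i" by auto
    then have "i \<le> n" using xy by (metis in_nsphere not_le)
    have "lip (\<lambda>x. x i)"
      unfolding lip_def
    proof (rule exI[of _ 1], rule exI[of _ 1], intro conjI ballI)
      fix x y :: "nat \<Rightarrow> real"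
      have "\<bar>x i - y i\<bar> \<le> d x y" unfolding d_def using \<open>i \<le> n\<close> by (intro member_le_sum) auto
      then show "\<bar>x i - y i\<bar> \<le> 1 * d x y" by simp
    qed (use nsphere_abs_le_1 in auto)
    then show "\<exists>f. lip f \<and> f x \<noteq> f y" using i by blast
  qed
  then obtain g where "lip g" "\<forall>x \<in> ?S. \<bar>f x - g x\<bar> < \<epsilon>" by blast
  then show ?thesis using cont[OF \<open>lip g\<close>] unfolding lip_def d_def by blast
qed

text \<open>
  Odd self-maps of spheres have odd degree. By the Lipschitz approximation, an odd map of the
  \<open>(n+1)\<close>-sphere can be deformed so that the image of the equator avoids a line through the
  origin, which a shear makes the axis through the poles. Then the equator can be pushed into
  itself, and the parity of the degree is that of the restriction to the equator.
\<close>

theorem odd_degree_odd_map: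
  assumes "continuous_map (nsphere n) (nsphere n) f"
    and "\<And>x. x \<in> Sph n \<Longrightarrow> f (\<lambda>i. - x i) = (\<lambda>i. - f x i)"
  shows "odd (Brouwer_degree2 n f)"
  using assms
proof (induction n arbitrary: f)
  case (0 f)
  have f_in: "f x \<in> Sph 0" if "x \<in> Sph 0" for x using continuous_map_in[OF 0(1) that] .
  have pm: "y = x \<or> y = (\<lambda>i. - x i)" if xy: "x \<in> Sph 0" "y \<in> Sph 0" for x y
  proof -
    have "(x 0)\<^sup>2 = (y 0)\<^sup>2" "\<And>i. i > 0 \<Longrightarrow> x i = 0 \<and> y i = 0" using xy by (auto simp: in_nsphere)
    then have "y 0 = x 0 \<or> y 0 = - x 0" "\<And>i. i > 0 \<Longrightarrow> x i = 0 \<and> y i = 0" by (auto simp: power2_eq_iff)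
    then show ?thesis by (metis (no_types, lifting) ext gr0I minus_zero)
  qed
  have "f (f x) = x" if x: "x \<in> Sph 0" for x
    using pm[OF x f_in[OF x]] 0(2)[OF x] by auto
  then have "homeomorphic_maps (nsphere 0) (nsphere 0) f f" using 0(1) by (simp add: homeomorphic_maps_def)
  then have "\<bar>Brouwer_degree2 0 f\<bar> = 1" by (rule Brouwer_degree2_homeomorphic_maps)
  then show ?case by (metis dvd_abs_iff odd_one)
next
  case (Suc n f)
  let ?m = "Suc n"
  let ?S = "Sph ?m"
  have f_in: "f x \<in> ?S" if "x \<in> ?S" for x using continuous_map_in[OF Suc.prems(1) that] .
  \<comment> \<open>an odd Lipschitz approximation \<open>q\<close> of \<open>f\<close>\<close>
  define \<epsilon> where "\<epsilon> = 1 / (2 * real (Suc ?m))"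
  have \<epsilon>: "\<epsilon> > 0" by (simp add: \<epsilon>_def)
  have "continuous_on ?S (\<lambda>x. f x i)" for i
    using continuous_map_nsphere_component[OF Suc.prems(1)] by (simp add: continuous_map_nsphere_real)
  then have "\<forall>i. \<exists>g. (\<forall>x\<in>?S. \<bar>f x i - g x\<bar> < \<epsilon>) \<and> continuous_on ?S g \<and>
      (\<exists>L. \<forall>x\<in>?S. \<forall>y\<in>?S. \<bar>g x - g y\<bar> \<le> L * l1 ?m x y)"
    using Lipschitz_approximation[OF _ \<epsilon>] by (intro allI) blast
  from choice[OF this] obtain g where g0: "\<forall>i. (\<forall>x\<in>?S. \<bar>f x i - g i x\<bar> < \<epsilon>) \<and> continuous_on ?S (g i) \<and>
      (\<exists>L. \<forall>x\<in>?S. \<forall>y\<in>?S. \<bar>g i x - g i y\<bar> \<le> L * l1 ?m x y)" by (elim exE)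
  then have "\<forall>i. \<exists>L. \<forall>x\<in>?S. \<forall>y\<in>?S. \<bar>g i x - g i y\<bar> \<le> L * l1 ?m x y" by blast
  from choice[OF this] obtain L where
    L: "\<forall>i. \<forall>x\<in>?S. \<forall>y\<in>?S. \<bar>g i x - g i y\<bar> \<le> L i * l1 ?m x y" by (elim exE)
  have g: "\<bar>f x i - g i x\<bar> < \<epsilon>" "y \<in> ?S \<Longrightarrow> \<bar>g i x - g i y\<bar> \<le> L i * l1 ?m x y"
      "continuous_on ?S (g i)" if "x \<in> ?S" for i x y
    using g0 L that by blast+
  define q where "q = (\<lambda>x i. (g i x - g i (\<lambda>j. - x j)) / 2)"
  have q_odd: "q (\<lambda>j. - x j) i = - q x i" for x i unfolding q_def by (simp only: minus_minus minus_divide_left minus_diff_eq)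
  have q_close: "\<bar>f x i - q x i\<bar> < \<epsilon>" if x: "x \<in> ?S" for x i
  proof -
    have "f (\<lambda>j. - x j) i = - f x i" using Suc.prems(2)[OF x] by simp
    moreover have "\<bar>c - (a - b) / 2\<bar> < \<epsilon>" if "\<bar>c - a\<bar> < \<epsilon>" "\<bar>- c - b\<bar> < \<epsilon>" for a b c :: real
      using that by (simp add: abs_less_iff field_simps)
    ultimately show ?thesis using g(1)[OF x, of i] g(1)[OF neg_in_nsphere[OF x], of i] unfolding q_def by metis
  qed
  have q_cont: "continuous_map (nsphere ?m) euclideanreal (\<lambda>x. q x i)" for i
  proof -
    have neg: "continuous_on ?S (\<lambda>x. \<lambda>j. - x j :: real)"
      by (intro continuous_on_coordinatewise_then_product continuous_on_minus
          continuous_on_product_then_coordinatewise[OF continuous_on_id])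
    have "continuous_on ?S (\<lambda>x. g i (\<lambda>j. - x j))"
      by (rule continuous_on_compose2[OF _ neg, where t = ?S]) (use neg_in_nsphere g0 in auto)
    then show ?thesis unfolding continuous_map_nsphere_real q_def using g0 by (intro continuous_intros) auto
  qed
  have q_nz: "\<exists>i\<le>?m. \<epsilon> \<le> \<bar>q x i\<bar> \<and> (\<forall>t. 0 \<le> t \<longrightarrow> t \<le> 1 \<longrightarrow> (1 - t) * f x i + t * q x i \<noteq> 0)" if x: "x \<in> ?S" for x
  proof -
    obtain i where i: "i \<le> ?m" "1 / real (Suc ?m) \<le> \<bar>f x i\<bar>" using large_coordinate[OF f_in[OF x]] by blast
    have e2: "1 / real (Suc ?m) = 2 * \<epsilon>" unfolding \<epsilon>_def by (simp del: of_nat_Suc)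
    have "(1 - t) * f x i + t * q x i \<noteq> 0" if t: "0 \<le> t" "t \<le> 1" for t
    proof -
      have "(1 - t) * f x i + t * q x i = f x i - t * (f x i - q x i)" by (simp add: algebra_simps)
      moreover have "\<bar>t * (f x i - q x i)\<bar> \<le> 1 * \<bar>f x i - q x i\<bar>"
        unfolding abs_mult using t by (intro mult_right_mono) auto
      ultimately show ?thesis using q_close[OF x, of i] i(2) e2 \<epsilon> by (cases "(1 - t) * f x i + t * q x i = 0") auto
    qed
    moreover have "\<epsilon> \<le> \<bar>q x i\<bar>" using q_close[OF x, of i] i(2) e2 by linarith
    ultimately show ?thesis using i(1) by blast
  qed
  define f1 where "f1 = (\<lambda>x. to_sphere ?m (q x))"
  have f1_cont: "continuous_map (nsphere ?m) (nsphere ?m) f1"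
    unfolding f1_def by (rule continuous_map_to_sphere) (use q_cont q_nz \<epsilon> in \<open>force+\<close>)
  have "homotopic_with (\<lambda>_. True) (nsphere ?m) (nsphere ?m) f f1"
    unfolding f1_def by (rule homotopic_to_sphere[OF Suc.prems(1)]) (use q_cont q_nz in blast)+
  then have deg1: "Brouwer_degree2 ?m f = Brouwer_degree2 ?m f1" by (rule Brouwer_degree2_homotopic)
  \<comment> \<open>the line through \<open>(b, 1)\<close> is missed by \<open>q\<close> on the equator\<close>
  define B where "B = Max (L ` {..?m})"
  have "\<exists>b. \<forall>x\<in>Sph n. \<exists>i\<le>n. q x i \<noteq> q x ?m * b i"
  proof (rule Lipschitz_image_misses_line[of n q B \<epsilon>])
    fix x y i assume x: "x \<in> Sph n" and y: "y \<in> Sph n" and i: "i \<le> ?m"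
    have xy: "x \<in> ?S" "y \<in> ?S" using x y nsphere_subset_Suc by blast+
    define d where "d = l1 ?m x y"
    have d: "d = l1 n x y" using x y by (simp add: d_def in_nsphere)
    have "\<bar>g i x - g i y\<bar> \<le> L i * d" using g(2)[OF xy] by (simp add: d_def)
    moreover have "\<bar>g i (\<lambda>j. - x j) - g i (\<lambda>j. - y j)\<bar> \<le> L i * d"
      using g(2)[OF neg_in_nsphere[OF xy(1)] neg_in_nsphere[OF xy(2)], of i] by (simp add: d_def abs_minus_commute)
    moreover have "\<bar>(a - b) / 2 - (a' - b') / 2\<bar> \<le> e" if "\<bar>a - a'\<bar> \<le> e" "\<bar>b - b'\<bar> \<le> e" for a b a' b' e :: real
      using that by (simp add: abs_le_iff field_simps)
    ultimately have "\<bar>q x i - q y i\<bar> \<le> L i * d" unfolding q_def by blast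
    also have "\<dots> \<le> B * d" using i by (intro mult_right_mono) (auto simp: B_def d_def sum_nonneg)
    finally show "\<bar>q x i - q y i\<bar> \<le> B * l1 n x y" by (simp add: d)
  next
    show "\<exists>i\<le>?m. \<epsilon> \<le> \<bar>q x i\<bar>" if "x \<in> Sph n" for x using q_nz nsphere_subset_Suc that by blast
  qed (use \<epsilon> in auto)
  then obtain b where b: "\<And>x. x \<in> Sph n \<Longrightarrow> \<exists>i\<le>n. q x i \<noteq> q x ?m * b i" by blast
  \<comment> \<open>shear this line to the axis, and push the equator into itself\<close>
  define F where "F = (\<lambda>x i. if i = ?m then \<bar>x ?m\<bar> * q x ?m else q x i - q x ?m * b i)"
  define f3 where "f3 = (\<lambda>x. to_sphere ?m (F x))"
  have F_cont: "continuous_map (nsphere ?m) euclideanreal (\<lambda>x. F x i)" for i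
    unfolding F_def using q_cont continuous_map_nsphere_projection
    by (cases "i = ?m") (auto intro!: continuous_intros)
  have F_nz: "\<exists>i\<le>?m. (1 - t) * f1 x i + t * F x i \<noteq> 0" if x: "x \<in> ?S" and t: "0 \<le> t" "t \<le> 1" for x t
  proof -
    define s where "s = 1 / sqrt (\<Sum>j\<le>?m. (q x j)\<^sup>2)"
    obtain i0 where i0: "i0 \<le> ?m" "q x i0 \<noteq> 0" using q_nz[OF x] \<epsilon> by force
    then have s: "s > 0" using sum_squares_pos[of ?m "q x"] unfolding s_def
      by (metis real_sqrt_gt_zero zero_less_divide_1_iff)
    have f1: "f1 x i = s * q x i" if "i \<le> ?m" for i using that by (simp add: f1_def to_sphere_def s_def)
    have st: "(1 - t) * s + t * r > 0" if "r > 0" for r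
      using that t s by (cases "t = 1") (auto intro!: add_pos_nonneg)
    show ?thesis
    proof (cases "q x ?m = 0")
      case True
      then have "i0 \<noteq> ?m" using i0 by metis
      then have "(1 - t) * f1 x i0 + t * F x i0 = ((1 - t) * s + t * 1) * q x i0"
        using i0 True by (simp add: F_def f1 algebra_simps)
      then show ?thesis using st[of 1] i0 by (intro exI[of _ i0]) auto
    next
      case False
      have m: "(1 - t) * f1 x ?m + t * F x ?m = ((1 - t) * s + t * \<bar>x ?m\<bar>) * q x ?m"
        by (simp add: F_def f1 algebra_simps)
      show ?thesis
      proof (cases "x ?m = 0 \<and> t = 1")
        case True
        then have "x \<in> Sph n" using topspace_nsphere_minus1[OF x] by simp
        then obtain i where "i \<le> n" "q x i \<noteq> q x ?m * b i" using b by blast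
        then show ?thesis using True by (intro exI[of _ i]) (simp add: F_def)
      next
        case not_both: False
        have "(1 - t) * s + t * \<bar>x ?m\<bar> > 0"
          using not_both t s st[of "\<bar>x ?m\<bar>"] by (cases "x ?m = 0") auto
        then show ?thesis using m False by (intro exI[of _ ?m]) simp
      qed
    qed
  qed
  have f3_cont: "continuous_map (nsphere ?m) (nsphere ?m) f3"
    unfolding f3_def by (rule continuous_map_to_sphere) (use F_cont F_nz[of _ 1] in auto)
  have f3_odd: "f3 (\<lambda>i. - x i) = (\<lambda>i. - f3 x i)" for x
  proof -
    have "F (\<lambda>i. - x i) = (\<lambda>i. - F x i)" by (auto simp: F_def q_odd algebra_simps)
    then show ?thesis by (simp add: f3_def to_sphere_neg)
  qed
  have "homotopic_with (\<lambda>_. True) (nsphere ?m) (nsphere ?m) f1 f3"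
    unfolding f3_def by (rule homotopic_to_sphere[OF f1_cont]) (use F_cont F_nz in blast)+
  then have deg3: "Brouwer_degree2 ?m f1 = Brouwer_degree2 ?m f3" by (rule Brouwer_degree2_homotopic)
  have equator: "f3 x \<in> Sph n" if x: "x \<in> Sph n" for x
  proof -
    have "f3 x \<in> ?S" using continuous_map_in[OF f3_cont nsphere_subset_Suc[OF x]] .
    moreover have "f3 x ?m = 0" using x by (simp add: f3_def to_sphere_def F_def in_nsphere)
    ultimately show ?thesis using topspace_nsphere_minus1 by fastforce
  qed
  have "continuous_map (nsphere n) (nsphere n) f3"
  proof -
    have "continuous_map (nsphere n) (nsphere ?m) f3"
      unfolding subtopology_nsphere_equator[of n, symmetric] by (rule continuous_map_from_subtopology[OF f3_cont])
    then have "continuous_map (nsphere n) (subtopology (nsphere ?m) {x. x ?m = 0}) f3"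
      using equator by (auto simp: continuous_map_in_subtopology in_nsphere)
    then show ?thesis by (simp add: subtopology_nsphere_equator)
  qed
  then have "odd (Brouwer_degree2 n f3)" using f3_odd by (intro Suc.IH) auto
  moreover have "even (Brouwer_degree2 ?m f3 - Brouwer_degree2 (?m - Suc 0) f3)"
    by (rule Borsuk_odd_mapping_degree_step[OF f3_cont]) (use f3_odd equator in auto)
  ultimately show ?case using deg1 deg3 by simp
qed

text \<open>
  A counterexample would give an odd map from the \<open>(m+1)\<close>-sphere to the \<open>m\<close>-sphere. Its
  restriction to the equator has odd degree, but extends to a hemisphere.
\<close>

theorem Borsuk_Ulam:
  assumes cont: "\<And>i. i < n \<Longrightarrow> continuous_map (nsphere n) euclideanreal (f i)"
    and odd: "\<And>i x. i < n \<Longrightarrow> x \<in> Sph n \<Longrightarrow> f i (\<lambda>j. - x j) = - f i x"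
  shows "\<exists>x\<in>Sph n. \<forall>i<n. f i x = 0"
proof (cases n)
  case 0
  then show ?thesis using in_topspace_nsphere[of n] by blast
next
  case (Suc m)
  show ?thesis
  proof (rule ccontr)
    assume neg: "\<not> ?thesis"
    define g where "g = (\<lambda>x. to_sphere m (\<lambda>i. f i x))"
    have g: "continuous_map (nsphere (Suc m)) (nsphere m) g"
      unfolding g_def by (rule continuous_map_to_sphere) (use cont neg Suc in \<open>auto simp: less_Suc_eq_le\<close>)
    have g': "continuous_map (nsphere m) (nsphere m) g"
      using continuous_map_from_subtopology[OF g, of "{x. x (Suc m) = 0}"] by (simp add: subtopology_nsphere_equator)
    have "odd (Brouwer_degree2 m g)"
    proof (rule odd_degree_odd_map[OF g'])
      fix x assume "x \<in> Sph m"
      then have x: "x \<in> Sph n" using nsphere_subset_Suc Suc by blast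
      have "f i (\<lambda>j. - x j) = - f i x" if "i \<le> m" for i using odd x Suc that by simp
      then have "to_sphere m (\<lambda>i. f i (\<lambda>j. - x j)) = to_sphere m (\<lambda>i. - f i x)"
        by (auto simp: to_sphere_def fun_eq_iff intro!: sum.cong)
      then show "g (\<lambda>i. - x i) = (\<lambda>i. - g x i)" by (simp add: g_def to_sphere_neg)
    qed
    moreover have "Brouwer_degree2 m g = 0"
    proof -
      let ?H = "subtopology (nsphere (Suc m)) {x. x (Suc m) \<ge> 0}"
      have "contractible_space ?H" by (rule contractible_space_upper_hemisphere) simp
      moreover have "continuous_map (nsphere m) ?H id"
        unfolding continuous_map_in_subtopology
        by (auto simp flip: subtopology_nsphere_equator[of m] intro: continuous_map_from_subtopology)
      moreover have "continuous_map ?H (nsphere m) g" by (rule continuous_map_from_subtopology[OF g])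
      ultimately obtain c where "homotopic_with (\<lambda>_. True) (nsphere m) (nsphere m) (g \<circ> id) (\<lambda>x. c)"
        using nullhomotopic_through_contractible_space by metis
      then show ?thesis using Brouwer_degree2_nullhomotopic by simp
    qed
    ultimately show False by simp
  qed
qed

section \<open>Almost critical points and multiplicity of critical values\<close>

text \<open>Ekeland's variational principle.\<close>

lemma Ekeland:
  fixes U :: "'a::metric_space set"
  assumes u0: "u0 \<in> U" and \<epsilon>: "\<epsilon> > 0" and cont: "continuous_on U \<Phi>"
    and below: "\<And>u. u \<in> U \<Longrightarrow> m \<le> \<Phi> u"
    and complete: "\<And>z. (\<And>n. z n \<in> U) \<Longrightarrow> (\<And>n. \<Phi> (z n) \<le> \<Phi> u0) \<Longrightarrow> Cauchy z \<Longrightarrow> \<exists>l\<in>U. z \<longlonglongrightarrow> l"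
  obtains u where "u \<in> U" "\<Phi> u \<le> \<Phi> u0" "\<And>w. w \<in> U \<Longrightarrow> w \<noteq> u \<Longrightarrow> \<Phi> u - \<epsilon> * dist w u < \<Phi> w"
proof -
  define S where "S = (\<lambda>u. {w\<in>U. \<Phi> w \<le> \<Phi> u - \<epsilon> * dist w u})"
  have self: "u \<in> S u" if "u \<in> U" for u using that by (simp add: S_def)
  have S_trans: "w \<in> S u" if "v \<in> S u" "w \<in> S v" for u v w
  proof -
    have "\<epsilon> * dist w u \<le> \<epsilon> * (dist w v + dist v u)" using \<epsilon> by (intro mult_left_mono dist_triangle) auto
    then show ?thesis using that by (auto simp: S_def distrib_left)
  qed
  have "\<exists>w\<in>S u. \<forall>v\<in>S u. \<Phi> w \<le> \<Phi> v + 1 / real (Suc n)" if u: "u \<in> U" for u n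
  proof -
    have ne: "\<Phi> ` S u \<noteq> {}" and bd: "bdd_below (\<Phi> ` S u)"
      using self[OF u] below by (auto simp: S_def bdd_below_def)
    have "Inf (\<Phi> ` S u) < Inf (\<Phi> ` S u) + 1 / real (Suc n)" by simp
    from cInf_less_iff[OF ne bd, THEN iffD1, OF this]
    obtain w where w: "w \<in> S u" "\<Phi> w < Inf (\<Phi> ` S u) + 1 / real (Suc n)" by blast
    have "\<Phi> w \<le> \<Phi> v + 1 / real (Suc n)" if "v \<in> S u" for v
      using cInf_lower[OF imageI[OF that] bd] w(2) by linarith
    then show ?thesis using w(1) by blast
  qed
  then have "\<forall>n. \<forall>u\<in>U. \<exists>w. w \<in> S u \<and> (\<forall>v\<in>S u. \<Phi> w \<le> \<Phi> v + 1 / real (Suc n))" by blast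
  then obtain nxt where nxt: "\<And>n u. u \<in> U \<Longrightarrow> nxt n u \<in> S u"
      "\<And>n u v. u \<in> U \<Longrightarrow> v \<in> S u \<Longrightarrow> \<Phi> (nxt n u) \<le> \<Phi> v + 1 / real (Suc n)"
    by metis
  define z where "z = rec_nat u0 nxt"
  have z0: "z 0 = u0" and zS: "z (Suc n) = nxt n (z n)" for n by (simp_all add: z_def)
  have zU: "z n \<in> U" for n
    by (induction n) (use u0 nxt(1) in \<open>auto simp: z0 zS S_def\<close>)
  have step: "z (Suc n) \<in> S (z n)" for n using nxt(1)[OF zU] by (simp add: zS)
  have zz: "z k \<in> S (z n)" if "n \<le> k" for n k
    using that by (induction rule: dec_induct) (use self zU S_trans step in blast)+
  have dec: "\<Phi> (z k) \<le> \<Phi> (z n)" "\<epsilon> * dist (z k) (z n) \<le> \<Phi> (z n) - \<Phi> (z k)" if "n \<le> k" for n k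
  proof -
    show "\<epsilon> * dist (z k) (z n) \<le> \<Phi> (z n) - \<Phi> (z k)" using zz[OF that] by (auto simp: S_def)
    moreover have "0 \<le> \<epsilon> * dist (z k) (z n)" using \<epsilon> by simp
    ultimately show "\<Phi> (z k) \<le> \<Phi> (z n)" by linarith
  qed
  have "decseq (\<lambda>n. \<Phi> (z n))" using dec(1) by (simp add: decseq_def)
  then obtain a where a: "(\<lambda>n. \<Phi> (z n)) \<longlonglongrightarrow> a" "\<And>n. a \<le> \<Phi> (z n)"
    using decseq_convergent[of "\<lambda>n. \<Phi> (z n)" m] below zU by blast
  have "Cauchy z"
    unfolding Cauchy_altdef
  proof (intro allI impI)
    fix e :: real assume "e > 0"
    then have "\<forall>\<^sub>F n in sequentially. \<Phi> (z n) < a + \<epsilon> * e" using \<epsilon> by (intro order_tendstoD(2)[OF a(1)]) simp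
    then obtain M where M: "\<Phi> (z M) < a + \<epsilon> * e" "\<And>n. n \<ge> M \<Longrightarrow> \<Phi> (z n) < a + \<epsilon> * e" by (auto simp: eventually_sequentially)
    have "dist (z n) (z k) < e" if "n \<ge> M" "k > n" for n k
    proof -
      have "\<epsilon> * dist (z k) (z n) < \<epsilon> * e" using dec(2)[of n k] M(2)[OF that(1)] a(2)[of k] that by simp
      then show ?thesis using \<epsilon> by (simp add: dist_commute)
    qed
    then show "\<exists>M. \<forall>m\<ge>M. \<forall>n>m. dist (z m) (z n) < e" by blast
  qed
  then obtain l where l: "l \<in> U" "z \<longlonglongrightarrow> l" using complete[of z] zU dec(1)[of 0] z0 by auto
  have \<Phi>l: "(\<lambda>n. \<Phi> (z n)) \<longlonglongrightarrow> \<Phi> l"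
    using cont l zU by (auto simp: continuous_on_sequentially comp_def)
  have lS: "l \<in> S (z n)" for n
  proof -
    have "(\<lambda>k. \<epsilon> * dist (z k) (z n)) \<longlonglongrightarrow> \<epsilon> * dist l (z n)" by (intro tendsto_intros l)
    moreover have "(\<lambda>k. \<Phi> (z n) - \<Phi> (z k)) \<longlonglongrightarrow> \<Phi> (z n) - \<Phi> l" by (intro tendsto_intros \<Phi>l)
    ultimately have "\<epsilon> * dist l (z n) \<le> \<Phi> (z n) - \<Phi> l"
      by (rule LIMSEQ_le) (use dec(2) in blast)
    then show ?thesis using l by (simp add: S_def)
  qed
  show ?thesis
  proof (rule that[OF l(1)])
    show "\<Phi> l \<le> \<Phi> u0"
    proof -
      have "0 \<le> \<epsilon> * dist l (z 0)" using \<epsilon> by simp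
      then show ?thesis using lS[of 0] by (simp add: S_def z0)
    qed
    fix w assume w: "w \<in> U" "w \<noteq> l"
    show "\<Phi> l - \<epsilon> * dist w l < \<Phi> w"
    proof (rule ccontr)
      assume "\<not> ?thesis"
      then have wS: "w \<in> S l" using w by (simp add: S_def)
      have "\<Phi> (z (Suc n)) \<le> \<Phi> w + 1 / real (Suc n)" for n
        unfolding zS by (rule nxt(2)[OF zU S_trans[OF lS wS]])
      moreover have "(\<lambda>n. \<Phi> w + 1 / real (Suc n)) \<longlonglongrightarrow> \<Phi> w + 0"
        by (intro tendsto_intros LIMSEQ_Suc[OF lim_1_over_n])
      ultimately have "\<Phi> l \<le> \<Phi> w + 0" using LIMSEQ_le[OF LIMSEQ_Suc[OF \<Phi>l]] by blast
      moreover have "0 < \<epsilon> * dist w l" using \<epsilon> w by simp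
      ultimately show False using wS by (simp add: S_def)
    qed
  qed
qed

context hypersurface_functional
begin

text \<open>
  At a point given by Ekeland's principle no direction is steeper than \<open>8\<epsilon>\<close>, since otherwise the
  local deformation would lead to a point that the principle excludes.
\<close>

lemma almost_critical_minimizer:
  assumes u0: "u0 \<in> U" and \<epsilon>: "\<epsilon> > 0" and below: "\<And>u. u \<in> U \<Longrightarrow> m \<le> \<Phi> u"
    and complete: "\<And>z. (\<And>n. z n \<in> U) \<Longrightarrow> (\<And>n. \<Phi> (z n) \<le> \<Phi> u0) \<Longrightarrow> Cauchy z \<Longrightarrow> \<exists>l\<in>U. z \<longlonglongrightarrow> l"
  obtains u where "u \<in> U" "\<Phi> u \<le> \<Phi> u0" "N u \<le> 8 * \<epsilon>"
proof -
  obtain u where u: "u \<in> U" "\<Phi> u \<le> \<Phi> u0" and ek: "\<And>w. w \<in> U \<Longrightarrow> w \<noteq> u \<Longrightarrow> \<Phi> u - \<epsilon> * dist w u < \<Phi> w"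
    using Ekeland[OF u0 \<epsilon> continuous_on_\<Phi> below complete] by blast
  have "N u \<le> 8 * \<epsilon>"
  proof (cases "N u > 0")
    case True
    obtain r0 where r0: "r0 > 0" "\<And>w. w \<in> U \<Longrightarrow> dist w u < r0 \<Longrightarrow> N w \<le> N u + N u"
      using N_upper_semicontinuous[OF u(1) True] by blast
    have "descent_near U \<Phi> N u" by (rule descent_near_noncritical[OF u(1) True r0(1)]) (use r0(2) in simp)
    then obtain r \<kappa> H where r: "r > 0" and \<kappa>: "\<kappa> > 0"
      and H: "\<forall>x\<in>U \<inter> ball u r. N x \<le> 8 * \<kappa> \<and>
          (\<forall>t\<in>{0..r}. H x t \<in> U \<and> dist (H x t) x \<le> t \<and> \<Phi> (H x t) \<le> \<Phi> x - \<kappa> * t)"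
      unfolding descent_near_def by blast
    define w where "w = H u r"
    have w: "N u \<le> 8 * \<kappa>" "w \<in> U" "dist w u \<le> r" "\<Phi> w \<le> \<Phi> u - \<kappa> * r" using H u r by (auto simp: w_def)
    have "\<kappa> * r > 0" using \<kappa> r by simp
    then have "w \<noteq> u" using w by auto
    have "\<kappa> * dist w u \<le> \<kappa> * r" using w \<kappa> by (intro mult_left_mono) auto
    then have "\<kappa> * dist w u < \<epsilon> * dist w u" using ek[OF w(2) \<open>w \<noteq> u\<close>] w(4) by linarith
    then have "\<kappa> < \<epsilon>" using \<open>w \<noteq> u\<close> by simp
    then show ?thesis using w(1) by linarith
  qed (use \<epsilon> in linarith)
  then show ?thesis using that u by blast
qed

text \<open>
  The slope is made even by taking the larger of its values at \<open>u\<close> and \<open>-u\<close>, which saves a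
  proof that the two values agree.
\<close>

lemma descent_near_symmetrized:
  assumes sym: "\<And>u. u \<in> U \<Longrightarrow> - u \<in> U" and \<Phi>_even: "\<And>u. u \<in> U \<Longrightarrow> \<Phi> (- u) = \<Phi> u"
    and u: "u \<in> U" and pos: "max (N u) (N (- u)) > 0"
  shows "descent_near U \<Phi> (\<lambda>u. max (N u) (N (- u))) u"
proof -
  have *: "descent_near U \<Phi> (\<lambda>u. max (N u) (N (- u))) u"
    if u: "u \<in> U" "N u > 0" "N (- u) \<le> N u" for u
  proof -
    obtain r1 where r1: "r1 > 0" "\<And>w. w \<in> U \<Longrightarrow> dist w u < r1 \<Longrightarrow> N w \<le> N u + N u"
      using N_upper_semicontinuous[OF u(1,2)] by blast
    obtain r2 where r2: "r2 > 0" "\<And>w. w \<in> U \<Longrightarrow> dist w (- u) < r2 \<Longrightarrow> N w \<le> N (- u) + N u"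
      using N_upper_semicontinuous[OF sym[OF u(1)] u(2)] by blast
    show ?thesis
    proof (rule descent_near_noncritical[OF u(1,2), of "min r1 r2"])
      fix w assume w: "w \<in> U" "dist w u < min r1 r2"
      have "N w \<le> N u + N u" using r1(2)[OF w(1)] w(2) by simp
      moreover have "N (- w) \<le> N (- u) + N u" using r2(2)[OF sym[OF w(1)]] w(2) by (simp add: dist_minus)
      ultimately show "max (N w) (N (- w)) \<le> 2 * N u" using u(3) by simp
    qed (use r1 r2 in simp)
  qed
  show ?thesis
  proof (cases "N (- u) \<le> N u")
    case True
    then show ?thesis using *[OF u] pos by simp
  next
    case False
    then have "descent_near U \<Phi> (\<lambda>u. max (N u) (N (- u))) (- u)" using *[OF sym[OF u]] pos by simp
    then obtain r \<kappa> H where r: "r > 0" and \<kappa>: "\<kappa> > 0"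
      and Hc: "continuous_on ((U \<inter> ball (- u) r) \<times> {0..r}) (\<lambda>(x, t). H x t)"
      and H: "\<And>x. x \<in> U \<inter> ball (- u) r \<Longrightarrow> max (N x) (N (- x)) \<le> 8 * \<kappa>"
        "\<And>x t. x \<in> U \<inter> ball (- u) r \<Longrightarrow> t \<in> {0..r} \<Longrightarrow> H x t \<in> U \<and> dist (H x t) x \<le> t \<and> \<Phi> (H x t) \<le> \<Phi> x - \<kappa> * t"
      unfolding descent_near_def by blast
    have neg: "- x \<in> U \<inter> ball (- u) r" if "x \<in> U \<inter> ball u r" for x
      using that sym by (auto simp: dist_minus)
    have c: "continuous_on ((U \<inter> ball u r) \<times> {0..r}) (\<lambda>(x, t). - H (- x) t)"
    proof -
      have "continuous_on ((U \<inter> ball u r) \<times> {0..r}) (\<lambda>z. - (case (- fst z, snd z) of (x, t) \<Rightarrow> H x t))"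
        by (intro continuous_on_minus continuous_on_compose2[OF Hc] continuous_intros) (use neg in auto)
      then show ?thesis by (simp add: case_prod_unfold)
    qed
    have d: "max (N x) (N (- x)) \<le> 8 * \<kappa> \<and> (\<forall>t\<in>{0..r}. - H (- x) t \<in> U \<and> dist (- H (- x) t) x \<le> t \<and>
        \<Phi> (- H (- x) t) \<le> \<Phi> x - \<kappa> * t)" if x: "x \<in> U \<inter> ball u r" for x
    proof (intro conjI ballI)
      show "max (N x) (N (- x)) \<le> 8 * \<kappa>" using H(1)[OF neg[OF x]] by (simp add: max.commute)
      fix t assume t: "t \<in> {0..r}"
      note h = H(2)[OF neg[OF x] t]
      show "- H (- x) t \<in> U" using h sym by blast
      show "dist (- H (- x) t) x \<le> t" using h dist_minus[of "H (- x) t" "- x"] by simp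
      show "\<Phi> (- H (- x) t) \<le> \<Phi> x - \<kappa> * t" using h \<Phi>_even x by simp
    qed
    show ?thesis
      unfolding descent_near_def using r \<kappa> c d by blast
  qed
qed

text \<open>
  The contradiction behind the multiplicity results: finitely many critical values bound the
  genus of all compact symmetric subsets of \<open>U\<close>, but \<open>U\<close> contains odd images of all spheres.
\<close>

lemma infinitely_many_critical_values:
  assumes sym: "\<And>u. u \<in> U \<Longrightarrow> - u \<in> U" and "0 \<notin> U" and \<Phi>_even: "\<And>u. u \<in> U \<Longrightarrow> \<Phi> (- u) = \<Phi> u"
    and below: "\<And>u. u \<in> U \<Longrightarrow> m \<le> \<Phi> u"
    and complete: "\<And>\<beta> z. (\<And>n. z n \<in> U) \<Longrightarrow> (\<And>n. \<Phi> (z n) \<le> \<beta>) \<Longrightarrow> Cauchy z \<Longrightarrow> \<exists>l\<in>U. z \<longlonglongrightarrow> l"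
    and chain: "\<And>\<beta>. \<exists>\<mu>>0. no_chains U \<Phi> N \<beta> \<mu>"
    and spheres: "\<And>k. \<exists>\<sigma>. continuous_on (Sph k) \<sigma> \<and> \<sigma> ` Sph k \<subseteq> U \<and>
      (\<forall>x\<in>Sph k. \<sigma> (\<lambda>i. - x i) = - \<sigma> x)"
  shows "infinite (\<Phi> ` {u\<in>U. N u = 0})"
proof
  let ?K = "{u\<in>U. N u = 0}"
  assume fin: "finite (\<Phi> ` ?K)"
  define k where "k = card (\<Phi> ` ?K)"
  let ?S = "Sph k"
  obtain \<sigma> where \<sigma>: "continuous_on ?S \<sigma>" "\<And>x. x \<in> ?S \<Longrightarrow> \<sigma> x \<in> U" "\<And>x. x \<in> ?S \<Longrightarrow> \<sigma> (\<lambda>i. - x i) = - \<sigma> x"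
    using spheres[of k] by blast
  define A where "A = \<sigma> ` ?S"
  have A: "compact A" "A \<subseteq> U" "\<And>x. x \<in> A \<Longrightarrow> - x \<in> A"
  proof -
    show "compact A" unfolding A_def using \<sigma>(1) compact_nsphere by (rule compact_continuous_image)
    show "A \<subseteq> U" using \<sigma>(2) by (auto simp: A_def)
    show "- x \<in> A" if "x \<in> A" for x using that \<sigma>(3) neg_in_nsphere by (force simp: A_def)
  qed
  have "compact (\<Phi> ` A)" using continuous_on_subset[OF continuous_on_\<Phi> A(2)] A(1) by (rule compact_continuous_image)
  then obtain \<beta> where \<beta>: "\<And>x. x \<in> A \<Longrightarrow> \<Phi> x \<le> \<beta>"
    using compact_imp_bounded bounded_imp_bdd_above unfolding bdd_above_def by (metis imageI)
  obtain \<mu> where \<mu>: "\<mu> > 0" and no_chain: "no_chains U \<Phi> N \<beta> \<mu>" using chain[of \<beta>] by blast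
  define N2 where "N2 = (\<lambda>u. max (N u) (N (- u)))"
  have N2: "N2 (- u) = N2 u" "N u \<le> N2 u" for u by (auto simp: N2_def max.commute)
  have N0: "0 \<le> N u" if "u \<in> U" for u using N_nonneg[OF that] .
  have descent: "descent_near U \<Phi> N2 u" if "u \<in> U" "N2 u > 0" for u
    using descent_near_symmetrized[OF sym \<Phi>_even] that unfolding N2_def by blast
  have "\<mu> / 8 > 0" using \<mu> by simp
  from descent_maps[OF sym \<open>0 \<notin> U\<close> \<Phi>_even N2(1) descent this]
  obtain \<eta> where \<eta>: "odd_descent_maps U \<Phi> N2 (\<mu> / 8) \<eta>" by blast
  interpret descent_system U \<Phi> N2 \<beta> \<mu> m \<eta>
  proof
    have "(\<lambda>n. N (z n)) \<longlonglongrightarrow> 0" if "(\<lambda>n. N2 (z n)) \<longlonglongrightarrow> 0" "\<forall>n. z n \<in> U" for z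
      by (rule tendsto_sandwich[OF _ _ tendsto_const that(1)]) (use N2(2) N0 that(2) in auto)
    then show "no_chains U \<Phi> N2 \<beta> \<mu>" using no_chain unfolding no_chains_def by blast
  next
    show "0 \<le> N2 u" if "u \<in> U" for u using N0[OF that] N2(2)[of u] by linarith
    show "\<exists>l\<in>U. z \<longlonglongrightarrow> l" if "\<And>n. z n \<in> U" "\<And>n. \<Phi> (z n) \<le> \<beta>" "Cauchy z" for z
      using that by (rule complete)
  qed (use sym \<open>0 \<notin> U\<close> \<Phi>_even N2 continuous_on_\<Phi> below \<mu> \<eta> in auto)
  have N2_zero: "N u = 0" if "u \<in> U" "N2 u = 0" for u using N2(2)[of u] N0[OF that(1)] that(2) by linarith
  have sub: "\<Phi> ` crit \<subseteq> \<Phi> ` ?K" using N2_zero by (auto simp: crit_def)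
  have "genus_le A k"
  proof (rule genus_le_card_critical_values[of A "\<beta> + 1"])
    show "finite (\<Phi> ` crit)" using fin sub by (rule finite_subset[rotated])
    show "card {v \<in> \<Phi> ` crit. v < \<beta> + 1} \<le> k"
      unfolding k_def using sub by (intro card_mono fin) auto
    show "\<Phi> x \<le> \<beta> \<and> \<Phi> x < \<beta> + 1" if "x \<in> A" for x using \<beta>[OF that] by simp
  qed (use A in auto)
  then obtain f :: "nat \<Rightarrow> 'a \<Rightarrow> real" where f: "\<And>i. i < k \<Longrightarrow> continuous_on A (f i)" "\<And>i x. i < k \<Longrightarrow> x \<in> A \<Longrightarrow> f i (- x) = - f i x"
      "\<And>x. x \<in> A \<Longrightarrow> \<exists>i<k. f i x \<noteq> 0"
    unfolding genus_le_def by blast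
  have "\<exists>x\<in>?S. \<forall>i<k. f i (\<sigma> x) = 0"
  proof (rule Borsuk_Ulam)
    fix i assume i: "i < k"
    show "continuous_map (nsphere k) euclideanreal (\<lambda>x. f i (\<sigma> x))"
      unfolding continuous_map_nsphere_real
      by (rule continuous_on_compose2[OF f(1)[OF i] \<sigma>(1)]) (auto simp: A_def)
    show "f i (\<sigma> (\<lambda>j. - x j)) = - f i (\<sigma> x)" if "x \<in> ?S" for x
      using \<sigma>(3)[OF that] f(2)[OF i] that by (simp add: A_def)
  qed
  then show False using f(3) by (auto simp: A_def)
qed

end

section \<open>Critical points in \<open>M\<close>\<close>

theorem theorem2p2:
  fixes G :: "('g, 'm) monoid_scheme"
    and act :: "'g \<Rightarrow> 'a::banach \<Rightarrow> 'a"
    and J :: "'a \<Rightarrow> real"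
    and M :: "'a set"
    and Y :: "'a set"
    and \<psi> :: "'a \<Rightarrow> real"
    and P :: "'a set"
    and mP :: "'a \<Rightarrow> 'a"
  assumes "reflexive_space TYPE('a)"
    and "isometric_action G act"
    and "C1_functional J"
    and "closed M" and "M \<noteq> {}" and "0 \<notin> M"
    and "subspace Y" and "closed Y" and "invariant_set G act Y"
    and "C11_on_subspace Y \<psi>" and "invariant_fun_on G act Y \<psi>"
    and "\<forall>u\<in>unit_level Y \<psi>. \<exists>v\<in>Y. deriv_within Y \<psi> u v \<noteq> 0"
    and "condition_A1 G act J"
    and "condition_A2 G act J M"
    and "condition_A3 G act J M Y \<psi> P mP"
  shows
    "(condition_M_i G act J Y \<psi> P mP (INF u\<in>M. J u) \<longrightarrow>
        (\<exists>u\<in>M. critical_point J u \<and> J u = (INF u\<in>M. J u)))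
     \<and>
     ((\<forall>\<beta>\<ge>(INF u\<in>M. J u). condition_M_i G act J Y \<psi> P mP \<beta> \<and> condition_M_ii G act J Y \<psi> P mP \<beta>)
        \<and> condition_S J M Y \<psi> P mP \<longrightarrow>
        (\<exists>u :: nat \<Rightarrow> 'a. (\<forall>n. u n \<in> M \<and> critical_point J (u n)) \<and>
           (\<forall>n m. n \<noteq> m \<longrightarrow> orbit G act (u n) \<inter> orbit G act (u m) = {})))
     \<and>
     (carrier G = {\<one>\<^bsub>G\<^esub>} \<and> condition_S J M Y \<psi> P mP \<and>
        (\<forall>\<beta>\<ge>(INF u\<in>M. J u). \<forall>u. PS_seq Y \<psi> (unit_level Y \<psi> \<inter> P) (J \<circ> mP) \<beta> u \<longrightarrow>
           (\<exists>l\<in>unit_level Y \<psi> \<inter> P. critical_point J (mP l) \<and>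
              (\<exists>r. strict_mono (r :: nat \<Rightarrow> nat) \<and> (u \<circ> r) \<longlonglongrightarrow> l))) \<longrightarrow>
        infinite {u\<in>M. critical_point J u})"
proof -
  let ?S = "top_of_set (unit_level Y \<psi>)"
  define U where "U = unit_level Y \<psi> \<inter> P"
  define \<Phi> where "\<Phi> = J \<circ> mP"
  define c where "c = (INF u\<in>M. J u)"
  note A3 = assms(15)[unfolded condition_A3_def Let_def, folded U_def \<Phi>_def]
  have open_P: "open P" and P0: "0 \<notin> P" and PG: "invariant_set G act P"
    and mP_M: "\<And>u. u \<in> P \<Longrightarrow> mP u \<in> M" and mP_cont: "continuous_on P mP"
    and mP_equi: "\<And>g u. g \<in> carrier G \<Longrightarrow> u \<in> P \<Longrightarrow> mP (act g u) = act g (mP u)"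
    and mP_id: "\<And>u. u \<in> M \<Longrightarrow> mP u = u"
    and "\<exists>k. homeomorphism U M mP k" and C1: "C1_on_hypersurface Y \<psi> U \<Phi>"
    using A3 by auto
  then obtain m' where m': "homeomorphism U M mP m'" by blast
  have blowup: "\<And>u l. (\<And>n. u n \<in> U) \<Longrightarrow> u \<longlonglongrightarrow> l \<Longrightarrow> l \<in> ?S frontier_of U \<Longrightarrow>
           filterlim (\<lambda>n. \<Phi> (u n)) at_top sequentially"
    using A3 by blast
  have m'U: "m' w \<in> U" "mP (m' w) = w" if "w \<in> M" for w
    using m' that by (auto simp: homeomorphism_def)
  have m'm: "m' (mP u) = u" if "u \<in> U" for u using m' that by (auto simp: homeomorphism_def)
  have UP: "u \<in> P" "u \<in> unit_level Y \<psi>" if "u \<in> U" for u using that by (auto simp: U_def)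
  interpret hyp: hypersurface_functional Y \<psi> P \<Phi>
    by unfold_locales (use assms open_P C1 in \<open>auto simp: U_def\<close>)
  let ?N = "tangential_deriv_norm Y \<psi> U \<Phi>"
  note critical_iff = hyp.critical_iff[folded U_def] and N_nonneg = hyp.N_nonneg[folded U_def]
    and almost_crit = hyp.almost_critical_minimizer[folded U_def]
    and inf_values = hyp.infinitely_many_critical_values[folded U_def]
  have bdd: "bdd_below (J ` M)" and MG: "invariant_set G act M" using assms(14) by (auto simp: condition_A2_def)
  have c_le: "c \<le> J w" if "w \<in> M" for w unfolding c_def using bdd that by (rule cINF_lower)
  have \<Phi>_ge: "c \<le> \<Phi> u" if "u \<in> U" for u using c_le[OF mP_M] that by (simp add: \<Phi>_def U_def)
  \<comment> \<open>sublevel sets of \<open>\<Phi>\<close> are complete, since \<open>\<Phi>\<close> blows up at the boundary of \<open>U\<close>\<close>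
  have complete: "\<exists>l\<in>U. z \<longlonglongrightarrow> l" if z: "\<And>n. z n \<in> U" "\<And>n. \<Phi> (z n) \<le> \<beta>" "Cauchy z" for z \<beta>
  proof -
    obtain l where l: "z \<longlonglongrightarrow> l" using z(3) Cauchy_convergent convergent_def by blast
    have zY: "z n \<in> Y" for n using UP[OF z(1)[of n]] by (simp add: unit_level_def)
    then have "l \<in> Y" using \<open>closed Y\<close> l by (auto simp: closed_sequential_limits)
    then have "(\<lambda>n. \<psi> (z n)) \<longlonglongrightarrow> \<psi> l"
      using hyp.continuous_on_\<psi> l zY by (auto simp: continuous_on_sequentially comp_def)
    moreover have "\<psi> (z n) = 1" for n using UP[OF z(1)[of n]] by (simp add: unit_level_def)
    ultimately have "\<psi> l = 1" by (simp add: LIMSEQ_const_iff)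
    with \<open>l \<in> Y\<close> have lS: "l \<in> unit_level Y \<psi>" by (simp add: unit_level_def)
    have "l \<in> U"
    proof (rule ccontr)
      assume "l \<notin> U"
      have "l \<in> ?S closure_of U"
        unfolding in_closure_of
      proof (intro conjI allI impI)
        fix T assume T: "l \<in> T \<and> openin ?S T"
        then obtain V where V: "open V" "T = unit_level Y \<psi> \<inter> V" by (auto simp: openin_open)
        then have "\<forall>\<^sub>F n in sequentially. z n \<in> V" using l T topological_tendstoD by blast
        then obtain n where "z n \<in> V" by (auto simp: eventually_sequentially)
        then show "\<exists>y. y \<in> U \<and> y \<in> T" using V z(1)[of n] UP by blast
      qed (use lS in auto)
      moreover have "l \<notin> ?S interior_of U"
        using \<open>l \<notin> U\<close> subsetD[OF interior_of_subset] by (rule contrapos_nn)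
      ultimately have "filterlim (\<lambda>n. \<Phi> (z n)) at_top sequentially"
        using blowup[OF z(1) l] by (simp add: frontier_of_def)
      then have "\<forall>\<^sub>F n in sequentially. \<beta> + 1 \<le> \<Phi> (z n)" by (simp add: filterlim_at_top)
      then obtain n where "\<beta> + 1 \<le> \<Phi> (z n)" by (auto simp: eventually_sequentially)
      then show False using z(2)[of n] by linarith
    qed
    then show ?thesis using l by blast
  qed
  \<comment> \<open>by these constant sequences the Palais--Smale conditions apply to each critical point of \<open>\<Phi>\<close>\<close>
  have const_PS: "PS_seq Y \<psi> U \<Phi> (\<Phi> u) (\<lambda>_. u)" if "u \<in> critical_set Y \<psi> U \<Phi>" for u
  proof -
    have "u \<in> U" using that by (simp add: critical_set_def)
    then show ?thesis using critical_iff[of u] that by (simp add: PS_seq_def)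
  qed
  have crit_eq: "critical_set Y \<psi> U \<Phi> = {u\<in>U. ?N u = 0}"
    using critical_iff by (auto simp: critical_set_def)

  have a: "\<exists>u\<in>M. critical_point J u \<and> J u = c" if Mi: "condition_M_i G act J Y \<psi> P mP c"
  proof -
    have "\<exists>u\<in>U. \<Phi> u \<le> c + 1 / real (Suc n) \<and> ?N u \<le> 8 * (1 / real (Suc n))" for n
    proof -
      have "c < c + 1 / real (Suc n)" by simp
      then obtain w where w: "w \<in> M" "J w < c + 1 / real (Suc n)"
        using cINF_less_iff[OF \<open>M \<noteq> {}\<close> bdd] unfolding c_def by blast
      have "m' w \<in> U" "\<Phi> (m' w) < c + 1 / real (Suc n)" using m'U[OF w(1)] w(2) by (auto simp: \<Phi>_def)
      moreover obtain u where "u \<in> U" "\<Phi> u \<le> \<Phi> (m' w)" "?N u \<le> 8 * (1 / real (Suc n))"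
        by (rule almost_crit[OF \<open>m' w \<in> U\<close>, of "1 / real (Suc n)" c])
          (use \<Phi>_ge complete[of _ "\<Phi> (m' w)"] in auto)
      ultimately show ?thesis by force
    qed
    then obtain z where z: "\<And>n. z n \<in> U" "\<And>n. \<Phi> (z n) \<le> c + 1 / real (Suc n)" "\<And>n. ?N (z n) \<le> 8 * (1 / real (Suc n))"
      by metis
    have up: "(\<lambda>n. c + 1 / real (Suc n)) \<longlonglongrightarrow> c"
      using tendsto_add[OF tendsto_const LIMSEQ_Suc[OF lim_1_over_n], of c] by simp
    have "(\<lambda>n. \<Phi> (z n)) \<longlonglongrightarrow> c"
      by (rule tendsto_sandwich[OF _ _ tendsto_const up]) (use \<Phi>_ge z in auto)
    moreover have "(\<lambda>n. 8 * (1 / real (Suc n))) \<longlonglongrightarrow> 0"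
      using tendsto_mult[OF tendsto_const LIMSEQ_Suc[OF lim_1_over_n], of 8] by simp
    then have "(\<lambda>n. ?N (z n)) \<longlonglongrightarrow> 0"
      by (rule tendsto_sandwich[OF _ _ tendsto_const, rotated 2])
        (use N_nonneg z in \<open>auto intro!: always_eventually simp del: of_nat_Suc\<close>)
    ultimately have "PS_seq Y \<psi> U \<Phi> c z" using z by (simp add: PS_seq_def)
    then obtain l where l: "l \<in> P" "critical_point J (mP l)" "J (mP l) \<le> c"
      using Mi unfolding condition_M_i_def U_def[symmetric] \<Phi>_def[symmetric] by blast
    then show ?thesis using c_le[OF mP_M[OF l(1)]] mP_M[OF l(1)] by (intro bexI[of _ "mP l"]) auto
  qed

  have core: "infinite (\<Phi> ` critical_set Y \<psi> U \<Phi>)"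
    if S: "condition_S J M Y \<psi> P mP"
      and chain: "\<And>\<beta>. \<beta> \<ge> c \<Longrightarrow> \<exists>\<mu>>0. no_chains U \<Phi> ?N \<beta> \<mu>"
  proof -
    have J_even: "\<And>u. J (- u) = J u" and mP_odd: "\<And>u. u \<in> P \<Longrightarrow> - u \<in> P \<and> mP (- u) = - mP u"
      and U_sym: "uminus ` U = U"
      and \<tau>: "\<And>k. k \<ge> 1 \<Longrightarrow> \<exists>\<tau>. continuous_map (nsphere (k - 1)) (top_of_set P) \<tau> \<and>
           (\<forall>x\<in>topspace (nsphere (k - 1)). \<tau> (\<lambda>i. - x i) = - \<tau> x)"
      using S unfolding condition_S_def Let_def U_def by blast+
    have neg: "- u \<in> U" if "u \<in> U" for u using U_sym that by blast
    have "infinite (\<Phi> ` {u\<in>U. ?N u = 0})"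
    proof (rule inf_values)
      show "- u \<in> U" if "u \<in> U" for u using neg that .
      show "0 \<notin> U" using P0 by (simp add: U_def)
      show "\<Phi> (- u) = \<Phi> u" if "u \<in> U" for u using mP_odd[OF UP(1)[OF that]] J_even by (simp add: \<Phi>_def)
      show "c \<le> \<Phi> u" if "u \<in> U" for u using \<Phi>_ge that .
      show "\<exists>l\<in>U. z \<longlonglongrightarrow> l" if "\<And>n. z n \<in> U" "\<And>n. \<Phi> (z n) \<le> \<beta>" "Cauchy z" for z \<beta>
        using that by (rule complete)
      show "\<exists>\<mu>>0. no_chains U \<Phi> ?N \<beta> \<mu>" for \<beta>
        using chain[of "max \<beta> c"] no_chains_mono[of U \<Phi> ?N "max \<beta> c" _ \<beta>] by auto
    next
      fix k
      obtain \<tau> where "continuous_map (nsphere k) (top_of_set P) \<tau>"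
        and \<tau>_odd: "\<And>x. x \<in> Sph k \<Longrightarrow> \<tau> (\<lambda>i. - x i) = - \<tau> x" using \<tau>[of "Suc k"] by auto
      then have "continuous_map (top_of_set (Sph k)) (top_of_set P) \<tau>"
        by (simp only: nsphere_eq_top_of_set[symmetric])
      then have \<tau>c: "continuous_on (Sph k) \<tau>" and \<tau>P: "\<And>x. x \<in> Sph k \<Longrightarrow> \<tau> x \<in> P"
        by (auto simp: continuous_map_subtopology_eu)
      show "\<exists>\<sigma>. continuous_on (Sph k) \<sigma> \<and> \<sigma> ` Sph k \<subseteq> U \<and>
          (\<forall>x\<in>Sph k. \<sigma> (\<lambda>i. - x i) = - \<sigma> x)"
      \<comment> \<open>\<open>m' \<circ> mP\<close> is an odd projection of \<open>P\<close> to \<open>U\<close>\<close>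
      proof (intro exI[of _ "\<lambda>x. m' (mP (\<tau> x))"] conjI ballI)
        have mc: "continuous_on (Sph k) (\<lambda>x. mP (\<tau> x))"
          by (rule continuous_on_compose2[OF mP_cont \<tau>c]) (use \<tau>P in auto)
        have m'c: "continuous_on M m'" using m' by (simp add: homeomorphism_def)
        show "continuous_on (Sph k) (\<lambda>x. m' (mP (\<tau> x)))"
          by (rule continuous_on_compose2[OF m'c mc]) (use \<tau>P mP_M in blast)
        show "(\<lambda>x. m' (mP (\<tau> x))) ` Sph k \<subseteq> U" using \<tau>P mP_M m'U by blast
        fix x assume x: "x \<in> Sph k"
        define u where "u = m' (mP (\<tau> x))"
        have u: "u \<in> U" "mP u = mP (\<tau> x)" using m'U[OF mP_M[OF \<tau>P[OF x]]] by (auto simp: u_def)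
        have "mP (\<tau> (\<lambda>i. - x i)) = - mP (\<tau> x)" using \<tau>_odd[OF x] mP_odd[OF \<tau>P[OF x]] by simp
        also have "\<dots> = mP (- u)" using mP_odd[OF UP(1)[OF u(1)]] u(2) by simp
        finally show "m' (mP (\<tau> (\<lambda>i. - x i))) = - m' (mP (\<tau> x))"
          using m'm[OF neg[OF u(1)]] by (simp add: u_def)
      qed
    qed
    then show ?thesis by (simp add: crit_eq)
  qed

  interpret group_action G UNIV act using assms(2) by (simp add: isometric_action_def)
  have A1: "(\<exists>h\<in>carrier G. v = act h u) \<or> v = 0"
    if "(\<forall>n. g n \<in> carrier G) \<and> weakly_tendsto (\<lambda>n. act (g n) u) v" for g :: "nat \<Rightarrow> 'g" and u v
    using assms(13) that unfolding condition_A1_def by blast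
  have U_inv: "act g u \<in> U" if g: "g \<in> carrier G" and u: "u \<in> U" for g u
  proof -
    have "act g u \<in> Y" "act g u \<in> P"
      using g UP[OF u] assms(9) PG unfolding invariant_set_def unit_level_def by blast+
    moreover have "\<psi> (act g u) = 1"
      using g UP[OF u] assms(11) by (simp add: invariant_fun_on_def unit_level_def)
    ultimately show ?thesis by (simp add: U_def unit_level_def)
  qed
  have \<Phi>_inv: "\<Phi> (act g u) = \<Phi> u" if "g \<in> carrier G" "u \<in> U" for g u
    using that assms(13) mP_equi UP by (simp add: \<Phi>_def condition_A1_def invariant_fun_on_def)

  have b: "\<exists>u :: nat \<Rightarrow> 'a. (\<forall>n. u n \<in> M \<and> critical_point J (u n)) \<and>
           (\<forall>n m. n \<noteq> m \<longrightarrow> orbit G act (u n) \<inter> orbit G act (u m) = {})"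
    if Mi: "\<And>\<beta>. \<beta> \<ge> c \<Longrightarrow> condition_M_i G act J Y \<psi> P mP \<beta>"
      and Mii: "\<And>\<beta>. \<beta> \<ge> c \<Longrightarrow> condition_M_ii G act J Y \<psi> P mP \<beta>"
      and S: "condition_S J M Y \<psi> P mP"
  proof -
    let ?K = "critical_set Y \<psi> U \<Phi>"
    have KU: "u \<in> U" if "u \<in> ?K" for u using that by (simp add: critical_set_def)
    have inf: "infinite {orbit G act u | u. u \<in> ?K}"
    proof
      assume fin: "finite {orbit G act u | u. u \<in> ?K}"
      have "\<Phi> ` ?K \<subseteq> (\<lambda>C. \<Phi> (SOME x. x \<in> C)) ` {orbit G act u | u. u \<in> ?K}"
      proof
        fix v assume "v \<in> \<Phi> ` ?K"
        then obtain u where u: "u \<in> ?K" "v = \<Phi> u" by blast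
        have "u \<in> orbit G act u" using orbit_refl[of u] by simp
        then have "(SOME x. x \<in> orbit G act u) \<in> orbit G act u" by (rule someI)
        then obtain g where "g \<in> carrier G" "(SOME x. x \<in> orbit G act u) = act g u" by (auto simp: orbit_def)
        then have "\<Phi> (SOME x. x \<in> orbit G act u) = v" using \<Phi>_inv KU u by simp
        then show "v \<in> (\<lambda>C. \<Phi> (SOME x. x \<in> C)) ` {orbit G act u | u. u \<in> ?K}" using u(1) by blast
      qed
      then have "finite (\<Phi> ` ?K)" using fin finite_surj by blast
      moreover have "infinite (\<Phi> ` ?K)"
      proof (rule core[OF S])
        fix \<beta> assume "\<beta> \<ge> c"
        then obtain \<mu> where \<mu>: "\<mu> > 0" and lim: "\<And>u. (\<forall>n. u n \<in> U) \<and> (\<lambda>n. ?N (u n)) \<longlonglongrightarrow> 0 \<and>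
            (\<forall>n. \<Phi> (u n) \<le> \<beta>) \<and> (\<forall>n. norm (u n - u (Suc n)) < \<mu>) \<Longrightarrow>
            liminf (\<lambda>n. ereal (norm (u n - u (Suc n)))) = 0"
          using Mii fin unfolding condition_M_ii_def Let_def U_def[symmetric] \<Phi>_def[symmetric] by blast
        have "no_chains U \<Phi> ?N \<beta> \<mu>"
          unfolding no_chains_def
        proof (intro allI impI notI)
          fix z and e :: real assume e: "e > 0" and
            z: "\<forall>n. z n \<in> U \<and> \<Phi> (z n) \<le> \<beta> \<and> e \<le> dist (z n) (z (Suc n)) \<and> dist (z n) (z (Suc n)) < \<mu>"
            and "(\<lambda>n. ?N (z n)) \<longlonglongrightarrow> 0"
          then have "liminf (\<lambda>n. ereal (norm (z n - z (Suc n)))) = 0" by (intro lim) (auto simp: dist_norm)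
          moreover have "ereal e \<le> liminf (\<lambda>n. ereal (norm (z n - z (Suc n))))"
            using z by (intro Liminf_bounded always_eventually) (auto simp: dist_norm)
          ultimately show False using e by simp
        qed
        then show "\<exists>\<mu>>0. no_chains U \<Phi> ?N \<beta> \<mu>" using \<mu> by blast
      qed
      ultimately show False by blast
    qed
    then obtain \<omega> :: "nat \<Rightarrow> 'a set" where \<omega>: "inj \<omega>" "range \<omega> \<subseteq> {orbit G act u | u. u \<in> ?K}"
      using infinite_countable_subset by blast
    then have "\<forall>n. \<exists>u. u \<in> ?K \<and> \<omega> n = orbit G act u" by blast
    then obtain u where u: "\<And>n. u n \<in> ?K" "\<And>n. \<omega> n = orbit G act (u n)" by metis
    \<comment> \<open>the weak limit of the translates of \<open>mP v\<close> is not 0, as it lies in \<open>P\<close>, hence is itself a translate\<close>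
    have "\<exists>h\<in>carrier G. critical_point J (act h (mP v)) \<and> act h (mP v) \<in> M" if v: "v \<in> ?K" for v
    proof -
      have vU: "v \<in> U" using KU v .
      obtain g :: "nat \<Rightarrow> 'g" and l and r :: "nat \<Rightarrow> nat" where g: "\<forall>n. g n \<in> carrier G" and l: "l \<in> P" "critical_point J (mP l)"
        and w: "weakly_tendsto (\<lambda>n. act (g (r n)) (mP v)) l"
        using Mi[OF \<Phi>_ge[OF vU]] const_PS[OF v]
        unfolding condition_M_i_def U_def[symmetric] \<Phi>_def[symmetric] by blast
      have "(\<exists>h\<in>carrier G. l = act h (mP v)) \<or> l = 0"
        using A1[of "\<lambda>n. g (r n)" "mP v" l] g w by blast
      then obtain h where h: "h \<in> carrier G" "l = act h (mP v)" using l(1) P0 by blast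
      have "l \<in> M" using h MG mP_M[OF UP(1)[OF vU]] by (auto simp: invariant_set_def)
      then show ?thesis using h l mP_id by force
    qed
    then have "\<forall>n. \<exists>h. h \<in> carrier G \<and> critical_point J (act h (mP (u n))) \<and> act h (mP (u n)) \<in> M"
      using u(1) by blast
    from choice[OF this] obtain h where h: "\<And>n. h n \<in> carrier G" "\<And>n. critical_point J (act (h n) (mP (u n)))"
        "\<And>n. act (h n) (mP (u n)) \<in> M" by blast
    define w where "w = (\<lambda>n. act (h n) (mP (u n)))"
    have orb_eq: "orbit G act x = orbit G act y" if "z \<in> orbit G act x" "z \<in> orbit G act y" for x y z
    proof -
      have "orbit G act x \<in> orbits G UNIV act" "orbit G act y \<in> orbits G UNIV act" by (auto simp: orbits_def)
      then show ?thesis using disjoint_union that by blast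
    qed
    have in_orb: "act g x \<in> orbit G act x" if "g \<in> carrier G" for g x using that by (auto simp: orbit_def)
    have "orbit G act (w n) \<inter> orbit G act (w k) = {}" if "n \<noteq> k" for n k
    proof (rule ccontr)
      assume "\<not> ?thesis"
      then obtain z where "z \<in> orbit G act (w n)" "z \<in> orbit G act (w k)" by blast
      then have "orbit G act (w n) = orbit G act (w k)" by (rule orb_eq)
      moreover have "orbit G act (w i) = orbit G act (mP (u i))" for i
        using orb_eq[of "w i" "w i" "mP (u i)"] orbit_refl[of "w i"] in_orb[OF h(1)] by (simp add: w_def)
      ultimately have "mP (u n) \<in> orbit G act (mP (u k))" using orbit_refl[of "mP (u n)"] by simp
      then obtain g where g: "g \<in> carrier G" "mP (u n) = act g (mP (u k))" by (auto simp: orbit_def)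
      have "mP (u n) = mP (act g (u k))" using g mP_equi UP(1)[OF KU[OF u(1)]] by simp
      then have "u n = act g (u k)" using m'm[OF KU[OF u(1)]] m'm[OF U_inv[OF g(1) KU[OF u(1)]]] by metis
      then have "orbit G act (u n) = orbit G act (u k)"
        using orb_eq[of "u n" "u n" "u k"] orbit_refl[of "u n"] in_orb[OF g(1)] by simp
      then show False using u(2) \<omega>(1) that by (metis injD)
    qed
    then show ?thesis using h by (intro exI[of _ w]) (auto simp: w_def)
  qed

  have c: "infinite {u\<in>M. critical_point J u}"
    if S: "condition_S J M Y \<psi> P mP"
      and PS: "\<And>\<beta> u. \<beta> \<ge> c \<Longrightarrow> PS_seq Y \<psi> U \<Phi> \<beta> u \<Longrightarrow> \<exists>l\<in>U. critical_point J (mP l) \<and>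
              (\<exists>r. strict_mono (r :: nat \<Rightarrow> nat) \<and> (u \<circ> r) \<longlonglongrightarrow> l)"
  proof
    assume fin: "finite {u\<in>M. critical_point J u}"
    define Z where "Z = {l\<in>U. critical_point J (mP l)}"
    have "inj_on mP Z" using m'm by (intro inj_on_inverseI[of _ m']) (auto simp: Z_def)
    moreover have "mP ` Z \<subseteq> {u\<in>M. critical_point J u}" using mP_M UP by (auto simp: Z_def)
    ultimately have finZ: "finite Z" using fin by (meson finite_imageD finite_subset)
    have "critical_set Y \<psi> U \<Phi> \<subseteq> Z"
    proof
      fix u assume u: "u \<in> critical_set Y \<psi> U \<Phi>"
      then have uU: "u \<in> U" by (simp add: critical_set_def)
      obtain l and r :: "nat \<Rightarrow> nat" where "l \<in> U" "critical_point J (mP l)" "((\<lambda>_. u) \<circ> r) \<longlonglongrightarrow> l"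
        using PS[OF \<Phi>_ge[OF uU] const_PS[OF u]] by blast
      moreover from this have "l = u" using LIMSEQ_unique[of "\<lambda>_. u" l u] by (simp add: comp_def)
      ultimately show "u \<in> Z" by (simp add: Z_def)
    qed
    then have "finite (\<Phi> ` critical_set Y \<psi> U \<Phi>)" using finZ finite_subset by blast
    moreover have "infinite (\<Phi> ` critical_set Y \<psi> U \<Phi>)"
    proof (rule core[OF S])
      fix \<beta> assume "\<beta> \<ge> c"
      \<comment> \<open>all limit points of a chain lie in the finite set \<open>Z\<close>, whose points are more than \<open>\<mu>\<close> apart\<close>
      define \<mu> where "\<mu> = Min (insert 1 ((\<lambda>(x, y). dist x y) ` {(x, y). x \<in> Z \<and> y \<in> Z \<and> x \<noteq> y})) / 2"
      have finD: "finite ((\<lambda>(x, y). dist x y) ` {(x, y). x \<in> Z \<and> y \<in> Z \<and> x \<noteq> y})"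
        by (intro finite_imageI finite_subset[OF _ finite_cartesian_product[OF finZ finZ]]) auto
      then have \<mu>: "\<mu> > 0" by (auto simp: \<mu>_def)
      have sep: "2 * \<mu> \<le> dist x y" if "x \<in> Z" "y \<in> Z" "x \<noteq> y" for x y
      proof -
        have "Min (insert 1 ((\<lambda>(x, y). dist x y) ` {(x, y). x \<in> Z \<and> y \<in> Z \<and> x \<noteq> y})) \<le> dist x y"
          using finD that by (intro Min_le) (auto intro!: image_eqI[of _ _ "(x, y)"])
        then show ?thesis by (simp add: \<mu>_def)
      qed
      have "no_chains U \<Phi> ?N \<beta> \<mu>"
        unfolding no_chains_def
      proof (intro allI impI notI)
        fix z and e :: real assume e: "e > 0" and
          z: "\<forall>n. z n \<in> U \<and> \<Phi> (z n) \<le> \<beta> \<and> e \<le> dist (z n) (z (Suc n)) \<and> dist (z n) (z (Suc n)) < \<mu>"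
          and N: "(\<lambda>n. ?N (z n)) \<longlonglongrightarrow> 0"
        have sub: "\<exists>l\<in>Z. \<exists>r. strict_mono (r :: nat \<Rightarrow> nat) \<and> (z \<circ> s \<circ> r) \<longlonglongrightarrow> l" if s: "strict_mono s" for s
        proof -
          have "\<forall>n. (\<Phi> \<circ> z \<circ> s) n \<in> {c..\<beta>}" using z \<Phi>_ge by auto
          then obtain b q where b: "b \<in> {c..\<beta>}" and q: "strict_mono (q :: nat \<Rightarrow> nat)" "((\<Phi> \<circ> z \<circ> s) \<circ> q) \<longlonglongrightarrow> b"
            using compact_Icc[of c \<beta>] unfolding compact_def by blast
          have "strict_mono (s \<circ> q)" using s q(1) by (simp add: strict_mono_o)
          then have "((\<lambda>n. ?N (z n)) \<circ> (s \<circ> q)) \<longlonglongrightarrow> 0" by (rule LIMSEQ_subseq_LIMSEQ[OF N])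
          then have "PS_seq Y \<psi> U \<Phi> b (z \<circ> s \<circ> q)" using q(2) z by (simp add: PS_seq_def comp_def)
          then obtain l r where "l \<in> U" "critical_point J (mP l)" "strict_mono (r :: nat \<Rightarrow> nat)" "(z \<circ> s \<circ> q \<circ> r) \<longlonglongrightarrow> l"
            using PS[of b "z \<circ> s \<circ> q"] b by auto
          then show ?thesis using q(1)
            by (intro bexI[of _ l] exI[of _ "q \<circ> r"]) (auto simp: Z_def strict_mono_o comp_assoc)
        qed
        obtain l r where l: "l \<in> Z" "strict_mono (r :: nat \<Rightarrow> nat)" "(z \<circ> id \<circ> r) \<longlonglongrightarrow> l"
          using sub[of id] by (auto simp: strict_mono_def)
        have "strict_mono (Suc \<circ> r)" using l(2) by (simp add: strict_mono_def)
        then obtain l' q where l': "l' \<in> Z" "strict_mono (q :: nat \<Rightarrow> nat)" "(z \<circ> (Suc \<circ> r) \<circ> q) \<longlonglongrightarrow> l'"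
          using sub by blast
        have "(z \<circ> id \<circ> r \<circ> q) \<longlonglongrightarrow> l" using LIMSEQ_subseq_LIMSEQ[OF l(3) l'(2)] .
        then have d: "(\<lambda>n. dist (z (r (q n))) (z (Suc (r (q n))))) \<longlonglongrightarrow> dist l l'"
          using tendsto_dist[of _ l sequentially _ l'] l'(3) by (simp add: comp_def)
        have "e \<le> dist l l'" by (rule LIMSEQ_le_const[OF d]) (use z in auto)
        moreover have "dist l l' \<le> \<mu>" by (rule LIMSEQ_le_const2[OF d]) (use z in \<open>auto intro: less_imp_le\<close>)
        ultimately show False using sep[OF l(1) l'(1)] e \<mu> by (cases "l = l'") auto
      qed
      then show "\<exists>\<mu>>0. no_chains U \<Phi> ?N \<beta> \<mu>" using \<mu> by blast
    qed
    ultimately show False by blast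
  qed
  show ?thesis using a b c unfolding c_def[symmetric] U_def[symmetric] \<Phi>_def[symmetric] by blast
qed

end
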